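(* Let $n,m,d\ge1$ be integers, let $\boldsymbol{\mathcal D}=\mathcal D^1\times\mathcal D^2$ be a product dyadic grid in $\mathbb{R}^n\times\mathbb{R}^m$, let $1<p<\infty$, and let $U,V$ be biparameter $(d\times d)$ matrix $\boldsymbol{\mathcal D}$-dyadic $A_p$ weights on $\mathbb{R}^n\times\mathbb{R}^m$. For any $B\in \mathrm{BMO}_{\mathrm{prod},\boldsymbol{\mathcal D}}(U,V,p)$, the linear functional $\ell_B:\mathrm{H}^1_{\boldsymbol{\mathcal D}}(U,V,p)\to\mathbb{C}$ given by $$\ell_B(\Phi):=\sum_{R\in\boldsymbol{\mathcal D},\,\varepsilon\in\mathcal E}\operatorname{tr}\big((B_R^\varepsilon)^*\Phi_R^\varepsilon\big),\qquad \Phi\in \mathrm{H}^1_{\boldsymbol{\mathcal D}}(U,V,p),$$ is well-defined and bounded, with $$\|\ell_B\|\sim\|B\|_{\mathrm{BMO}_{\mathrm{prod},\boldsymbol{\mathcal D}}(U,V,p)},$$ where the implicit constants (in both directions) depend only on $n,m,p,d$ and $[V]_{A_p,\boldsymbol{\mathcal D}}$. Conversely, for every bounded linear functional $\ell$ on $\mathrm{H}^1_{\boldsymbol{\mathcal D}}(U,V,p)$ there is $B\in\mathrm{BMO}_{\mathrm{prod},\boldsymbol{\mathcal D}}(U,V,p)$ with $\ell=\ell_B$.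
   Context: $|A|$ denotes the operator norm of $A\in \mathrm{M}_d(\mathbb{C})$ and $|v|$ the Euclidean norm on $\mathbb{C}^d$. $\mathcal D^1,\mathcal D^2$ are dyadic grids of cubes in $\mathbb{R}^n$, $\mathbb{R}^m$, and $\boldsymbol{\mathcal D}=\mathcal D^1\times\mathcal D^2$ is the collection of dyadic rectangles $R=R_1\times R_2$ with $R_j\in\mathcal D^j$. For $\Omega\subseteq\mathbb{R}^{n+m}$, $\boldsymbol{\mathcal D}(\Omega)=\{R\in\boldsymbol{\mathcal D}:R\subseteq\Omega\}$. The set of biparameter signatures is $\mathcal E=\mathcal E^1\times\mathcal E^2$ with $\mathcal E^1=\{0,1\}^n\setminus\{(1,\dots,1)\}$ and $\mathcal E^2=\{0,1\}^m\setminus\{(1,\dots,1)\}$. A $(d\times d)$ matrix weight on $\mathbb{R}^n\times\mathbb{R}^m$ is a locally integrable $\mathrm{M}_d(\mathbb{C})$-valued function that is (Hermitian) positive-definite a.e. It is a biparameter $\boldsymbol{\mathcal D}$-dyadic $A_p$ weight if $$[W]_{A_p,\boldsymbol{\mathcal D}}:=\sup_{R\in\boldsymbol{\mathcal D}}\frac1{|R|}\int_R\left(\frac1{|R|}\int_R|W(x)^{1/p}W(y)^{-1/p}|^{p'}dy\right)^{p/p'}dx<\infty,\qquad p'=\tfrac p{p-1}.$$ For $R\in\boldsymbol{\mathcal D}$, $\mathcal W_R$ denotes a reducing operator of $W$ over $R$ with respect to exponent $p$: a positive-definite matrix with $$\Big(\tfrac1{|R|}\int_R|W^{1/p}e|^p\Big)^{1/p}\le|\mathcal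 W_Re|\le\sqrt d\,\Big(\tfrac1{|R|}\int_R|W^{1/p}e|^p\Big)^{1/p}\quad\text{for all }e\in\mathbb{C}^d$$ (such a matrix exists; fix a choice for each $R$). $\mathcal U_R,\mathcal V_R$ are the reducing operators of $U,V$. For a sequence $B=\{B_R^\varepsilon\}_{R\in\boldsymbol{\mathcal D},\varepsilon\in\mathcal E}$ in $\mathrm{M}_d(\mathbb{C})$, $$\|B\|_{\mathrm{BMO}_{\mathrm{prod},\boldsymbol{\mathcal D}}(U,V,p)}:=\sup_\Omega\frac1{|\Omega|^{1/2}}\Big(\sum_{R\in\boldsymbol{\mathcal D}(\Omega),\,\varepsilon\in\mathcal E}|\mathcal V_RB_R^\varepsilon\mathcal U_R^{-1}|^2\Big)^{1/2},$$ the supremum over all Lebesgue-measurable $\Omega\subseteq\mathbb{R}^{n+m}$ of nonzero finite measure; the space $\mathrm{BMO}_{\mathrm{prod},\boldsymbol{\mathcal D}}(U,V,p)$ consists of the sequences with finite norm. $\mathrm{H}^1_{\boldsymbol{\mathcal D}}(U,V,p)$ is the Banach space of all sequences $\Phi=\{\Phi_R^\varepsilon\}_{R\in\boldsymbol{\mathcal D},\varepsilon\in\mathcal E}$ in $\mathrm{M}_d(\mathbb{C})$ with $$\|\Phi\|_{\mathrm{H}^1_{\boldsymbol{\mathcal D}}(U,V,p)}:=\Big\|\Big(\sum_{R\in\boldsymbol{\mathcal D},\,\varepsilon\in\mathcal E}|V^{-1/p}\Phi_R^\varepsilon\,\mathcal U_R|^2\frac{\mathbf 1_R}{|R|}\Big)^{1/2}\Big\|_{L^1(\mathbb{R}^{n+m})}<\infty.$$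 Sums over the countable unordered index set $\boldsymbol{\mathcal D}\times\mathcal E$ are understood as absolutely convergent sums. $X\sim Y$ means $c\,Y\le X\le C\,Y$ with positive finite constants $c,C$. *)

theory Defs
  imports "HOL-Analysis.Analysis" "HOL-Library.Disjoint_Sets"
begin

section \<open>Matrices\<close>

definition opnorm :: "complex^'d^'d \<Rightarrow> real" where
  "opnorm A = onorm (\<lambda>v. A *v v)"

definition conj_transpose :: "complex^'d^'d \<Rightarrow> complex^'d^'d" where
  "conj_transpose A = map_matrix cnj (transpose A)"

text \<open>For Hermitian \<open>A\<close> the quadratic form is real, so taking its real part loses nothing.\<close>

definition pos_def :: "complex^'d^'d \<Rightarrow> bool" where
  "pos_def A \<longleftrightarrow> conj_transpose A = A \<and>
     (\<forall>v. v \<noteq> 0 \<longrightarrow> 0 < Re (\<Sum>i\<in>UNIV. cnj (v $ i) * (A *v v) $ i))"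

definition diag_matrix :: "('d \<Rightarrow> real) \<Rightarrow> complex^'d^'d" where
  "diag_matrix l = (\<chi> i j. if i = j then complex_of_real (l i) else 0)"

text \<open>
  The real power \<open>A\<^sup>s\<close> of a positive definite \<open>A\<close>, by the spectral theorem: if
  \<open>A = P diag(l) P\<^sup>*\<close> with \<open>P\<close> unitary, then \<open>A\<^sup>s = P diag(l\<^sup>s) P\<^sup>*\<close>, whichever diagonalization
  is used. For other \<open>A\<close> the value is irrelevant: weights are positive definite a.e. and their
  powers occur only under integrals.
\<close>

definition matrix_powr :: "complex^'d^'d \<Rightarrow> real \<Rightarrow> complex^'d^'d" where
  "matrix_powr A s = (THE M. \<exists>P l.
     conj_transpose P ** P = mat 1 \<and> (\<forall>i. 0 < l i) \<and>
     A = P ** diag_matrix l ** conj_transpose P \<and>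
     M = P ** diag_matrix (\<lambda>i. l i powr s) ** conj_transpose P)"

section \<open>Nonnegative extended reals\<close>

text \<open>Meant for exponents \<open>s > 0\<close> only.\<close>

definition ennpow :: "ennreal \<Rightarrow> real \<Rightarrow> ennreal" where
  "ennpow x s = (if x = top then top else ennreal (enn2real x powr s))"

definition average :: "'a::euclidean_space set \<Rightarrow> ('a \<Rightarrow> ennreal) \<Rightarrow> ennreal" where
  "average R f = (\<integral>\<^sup>+x\<in>R. f x \<partial>lebesgue) / emeasure lebesgue R"

section \<open>Dyadic grids, rectangles and signatures\<close>

definition half_open_cube :: "real^'n \<Rightarrow> real \<Rightarrow> (real^'n) set" where
  "half_open_cube a r = {x. \<forall>i. a $ i \<le> x $ i \<and> x $ i < a $ i + r}"

text \<open>
  The usual abstract notion: the cubes of the grid have side length \<open>2\<^sup>k\<close> with \<open>k \<in> \<int>\<close>, those of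
  each fixed side length partition the space, and any two cubes are nested or disjoint. No
  particular position (e.g. a cube with a corner at the origin) is prescribed.
\<close>

definition dyadic_grid :: "(real^'n) set set \<Rightarrow> bool" where
  "dyadic_grid D \<longleftrightarrow>
     (\<forall>Q\<in>D. \<exists>a (k::int). Q = half_open_cube a (2 powi k)) \<and>
     (\<forall>k::int. partition_on UNIV {Q\<in>D. \<exists>a. Q = half_open_cube a (2 powi k)}) \<and>
     (\<forall>Q\<in>D. \<forall>Q'\<in>D. Q \<inter> Q' = Q \<or> Q \<inter> Q' = Q' \<or> Q \<inter> Q' = {})"

type_synonym ('n, 'm) rect = "((real^'n) \<times> (real^'m)) set"

definition rects :: "(real^'n) set set \<Rightarrow> (real^'m) set set \<Rightarrow> ('n, 'm) rect set" where
  "rects D1 D2 = {R1 \<times> R2 | R1 R2. R1 \<in> D1 \<and> R2 \<in> D2}"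

text \<open>\<open>{0, 1}\<close> is rendered as \<^typ>\<open>bool\<close>, with \<open>True\<close> for 1.\<close>

type_synonym ('n, 'm) signature = "(bool^'n) \<times> (bool^'m)"

definition signatures :: "('n::finite, 'm::finite) signature set" where
  "signatures = (UNIV - {\<chi> i. True}) \<times> (UNIV - {\<chi> i. True})"

section \<open>Matrix weights\<close>

definition matrix_weight :: "('a::euclidean_space \<Rightarrow> complex^'d^'d) \<Rightarrow> bool" where
  "matrix_weight W \<longleftrightarrow>
     (\<forall>K. compact K \<longrightarrow> set_integrable lebesgue K W) \<and> (AE x in lebesgue. pos_def (W x))"

definition Ap_char ::
  "real \<Rightarrow> (real^'n) set set \<Rightarrow> (real^'m) set set \<Rightarrow>
   ((real^'n) \<times> (real^'m) \<Rightarrow> complex^'d^'d) \<Rightarrow> ennreal" where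
  "Ap_char p D1 D2 W =
     (let p' = p / (p - 1) in
      SUP R\<in>rects D1 D2.
        average R (\<lambda>x. ennpow
          (average R (\<lambda>y. ennreal
             (opnorm (matrix_powr (W x) (1 / p) ** matrix_powr (W y) (- 1 / p)) powr p')))
          (p / p')))"

definition Ap_weight ::
  "real \<Rightarrow> (real^'n) set set \<Rightarrow> (real^'m) set set \<Rightarrow>
   ((real^'n) \<times> (real^'m) \<Rightarrow> complex^'d^'d) \<Rightarrow> bool" where
  "Ap_weight p D1 D2 W \<longleftrightarrow> matrix_weight W \<and> Ap_char p D1 D2 W < top"

definition reducing_operator ::
  "real \<Rightarrow> ('a::euclidean_space \<Rightarrow> complex^'d^'d) \<Rightarrow> 'a set \<Rightarrow> complex^'d^'d \<Rightarrow> bool" where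
  "reducing_operator p W R A \<longleftrightarrow> pos_def A \<and>
     (\<forall>e. let N = ennpow (average R (\<lambda>x. ennreal (norm (matrix_powr (W x) (1 / p) *v e) powr p)))
                         (1 / p)
          in N \<le> ennreal (norm (A *v e)) \<and>
             ennreal (norm (A *v e)) \<le> ennreal (sqrt (real CARD('d))) * N)"

section \<open>Sequence spaces\<close>

type_synonym ('n, 'm, 'd) matrix_seq =
  "('n, 'm) rect \<Rightarrow> ('n, 'm) signature \<Rightarrow> complex^'d^'d"

text \<open>
  Families indexed by \<open>rects D1 D2 \<times> signatures\<close> are total functions that vanish outside
  the index set, so that equality of families is equality of functions.
\<close>

definition matrix_seqs ::
  "(real^'n) set set \<Rightarrow> (real^'m) set set \<Rightarrow> ('n, 'm, 'd::finite) matrix_seq set" where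
  "matrix_seqs D1 D2 = {\<Phi>. \<forall>R \<epsilon>. (R, \<epsilon>) \<notin> rects D1 D2 \<times> signatures \<longrightarrow> \<Phi> R \<epsilon> = 0}"

definition bmo_norm ::
  "(real^'n) set set \<Rightarrow> (real^'m) set set \<Rightarrow>
   (('n, 'm) rect \<Rightarrow> complex^'d^'d) \<Rightarrow> (('n, 'm) rect \<Rightarrow> complex^'d^'d) \<Rightarrow>
   ('n, 'm, 'd) matrix_seq \<Rightarrow> ennreal" where
  "bmo_norm D1 D2 Ured Vred B =
     (SUP \<Omega>\<in>{\<Omega> \<in> sets lebesgue. 0 < emeasure lebesgue \<Omega> \<and> emeasure lebesgue \<Omega> < top}.
        ennpow (\<Sum>\<^sub>\<infinity>(R, \<epsilon>)\<in>{R \<in> rects D1 D2. R \<subseteq> \<Omega>} \<times> signatures.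
                  ennreal ((opnorm (Vred R ** B R \<epsilon> ** matrix_inv (Ured R)))\<^sup>2)) (1 / 2)
        / ennpow (emeasure lebesgue \<Omega>) (1 / 2))"

definition BMO ::
  "(real^'n) set set \<Rightarrow> (real^'m) set set \<Rightarrow>
   (('n, 'm) rect \<Rightarrow> complex^'d^'d) \<Rightarrow> (('n, 'm) rect \<Rightarrow> complex^'d^'d) \<Rightarrow>
   ('n, 'm, 'd) matrix_seq set" where
  "BMO D1 D2 Ured Vred = {B \<in> matrix_seqs D1 D2. bmo_norm D1 D2 Ured Vred B < top}"

definition H1_norm ::
  "real \<Rightarrow> (real^'n) set set \<Rightarrow> (real^'m) set set \<Rightarrow>
   (('n, 'm) rect \<Rightarrow> complex^'d^'d) \<Rightarrow> ((real^'n) \<times> (real^'m) \<Rightarrow> complex^'d^'d) \<Rightarrow>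
   ('n, 'm, 'd) matrix_seq \<Rightarrow> ennreal" where
  "H1_norm p D1 D2 Ured V \<Phi> =
     (\<integral>\<^sup>+x. ennpow (\<Sum>\<^sub>\<infinity>(R, \<epsilon>)\<in>rects D1 D2 \<times> signatures.
                    ennreal ((opnorm (matrix_powr (V x) (- 1 / p) ** \<Phi> R \<epsilon> ** Ured R))\<^sup>2)
                    * indicator R x / emeasure lebesgue R) (1 / 2) \<partial>lebesgue)"

definition H1 ::
  "real \<Rightarrow> (real^'n) set set \<Rightarrow> (real^'m) set set \<Rightarrow>
   (('n, 'm) rect \<Rightarrow> complex^'d^'d) \<Rightarrow> ((real^'n) \<times> (real^'m) \<Rightarrow> complex^'d^'d) \<Rightarrow>
   ('n, 'm, 'd) matrix_seq set" where
  "H1 p D1 D2 Ured V = {\<Phi> \<in> matrix_seqs D1 D2. H1_norm p D1 D2 Ured V \<Phi> < top}"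

section \<open>Linear functionals\<close>

definition H1_bounded_functional ::
  "real \<Rightarrow> (real^'n) set set \<Rightarrow> (real^'m) set set \<Rightarrow>
   (('n, 'm) rect \<Rightarrow> complex^'d^'d) \<Rightarrow> ((real^'n) \<times> (real^'m) \<Rightarrow> complex^'d^'d) \<Rightarrow>
   (('n, 'm, 'd) matrix_seq \<Rightarrow> complex) \<Rightarrow> bool" where
  "H1_bounded_functional p D1 D2 Ured V l \<longleftrightarrow>
     (\<forall>\<Phi>\<in>H1 p D1 D2 Ured V. \<forall>\<Psi>\<in>H1 p D1 D2 Ured V.
        l (\<lambda>R \<epsilon>. \<Phi> R \<epsilon> + \<Psi> R \<epsilon>) = l \<Phi> + l \<Psi>) \<and>
     (\<forall>\<Phi>\<in>H1 p D1 D2 Ured V. \<forall>c. l (\<lambda>R \<epsilon>. map_matrix ((*) c) (\<Phi> R \<epsilon>)) = c * l \<Phi>) \<and>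
     (\<exists>C::real. \<forall>\<Phi>\<in>H1 p D1 D2 Ured V.
        ennreal (norm (l \<Phi>)) \<le> ennreal C * H1_norm p D1 D2 Ured V \<Phi>)"

definition H1_functional_norm ::
  "real \<Rightarrow> (real^'n) set set \<Rightarrow> (real^'m) set set \<Rightarrow>
   (('n, 'm) rect \<Rightarrow> complex^'d^'d) \<Rightarrow> ((real^'n) \<times> (real^'m) \<Rightarrow> complex^'d^'d) \<Rightarrow>
   (('n, 'm, 'd) matrix_seq \<Rightarrow> complex) \<Rightarrow> ennreal" where
  "H1_functional_norm p D1 D2 Ured V l =
     (SUP \<Phi>\<in>{\<Phi> \<in> H1 p D1 D2 Ured V. H1_norm p D1 D2 Ured V \<Phi> \<le> 1}. ennreal (norm (l \<Phi>)))"

definition ell ::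
  "(real^'n) set set \<Rightarrow> (real^'m) set set \<Rightarrow>
   ('n, 'm, 'd::finite) matrix_seq \<Rightarrow> ('n, 'm, 'd) matrix_seq \<Rightarrow> complex" where
  "ell D1 D2 B \<Phi> =
     (\<Sum>\<^sub>\<infinity>(R, \<epsilon>)\<in>rects D1 D2 \<times> signatures. trace (conj_transpose (B R \<epsilon>) ** \<Phi> R \<epsilon>))"

end

theory Submission
  imports Defs
begin

text \<open>
  Put \<open>M\<^sub>R = \<V>\<^sub>R B\<^sub>R \<U>\<^sub>R\<^sup>-\<^sup>1\<close> and \<open>N\<^sub>R = \<V>\<^sub>R\<^sup>-\<^sup>1 \<Phi>\<^sub>R \<U>\<^sub>R\<close>, so that
  \<open>tr (B\<^sub>R\<^sup>* \<Phi>\<^sub>R) = tr (M\<^sub>R\<^sup>* N\<^sub>R)\<close>. By Chebyshev's inequality \<open>|N\<^sub>R|\<close> is at most a constant times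
  \<open>|V\<^sup>-\<^sup>1\<^sup>/\<^sup>p(x) \<Phi>\<^sub>R \<U>\<^sub>R|\<close> on most of \<open>R\<close>, which reduces the upper bound to scalar product
  \<open>H\<^sup>1\<close>-BMO duality. There one splits every pairing at the median over \<open>R\<close> of the square function; its
  level sets are enlarged in a controlled way by a weak-type bound for the strong maximal function.

  For the lower bound and for the converse one tests with finite sequences such that
  \<open>N\<^sub>R = M\<^sub>R\<close>. For \<open>p > 2\<close> the \<open>A\<^sub>p\<close> condition gives no square integrability of
  \<open>|\<V>\<^sub>R V\<^sup>-\<^sup>1\<^sup>/\<^sup>p|\<close> over \<open>R\<close>; but by Cauchy-Schwarz the \<open>H\<^sup>1\<close> norm is controlled as soon as the integral over
  \<open>\<Omega>\<close> of the supremum of \<open>|\<V>\<^sub>R V\<^sup>-\<^sup>1\<^sup>/\<^sup>p(x)|\<close>, taken over the \<open>R \<subseteq> \<Omega>\<close> containing \<open>x\<close>, is at most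
  a constant times \<open>|\<Omega>|\<close>. This maximal bound follows from a stopping-time argument in each variable: the
  first one gives an \<open>L\<^sup>q\<close> bound, \<open>q = p / (p - 1)\<close>, that the second one turns into an \<open>L\<^sup>1\<close> bound.
  Density of the finite sequences then identifies every bounded functional.
\<close>

section \<open>The spectral theorem for positive definite matrices\<close>

text \<open>Two obstacles shape the argument. In the upper bound the level sets of the square
  function are arbitrary sets, and the rectangles that see much of one overlap without being nested;
  product BMO, tested on all measurable sets, absorbs their union once its measure is controlled. In
  the maximal bound the matrices do not commute, so scalar maximal functions cannot simply be
  iterated. The way out is a reverse Hoelder inequality: the norm of \<open>Vred R *v e\<close> is
  comparable to an L^1 average over \<open>R\<close>, hence nearly additive when \<open>R\<close> is
  cut into strips, and this lets one side of a rectangle be exchanged at a time. The loss from L^q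
  to L^1 is harmless because the test sequences are estimated from first powers only.

  Estimates are made for finite families of rectangles, with constants that do not depend on the
  family: there maximal members, attained medians and common refinements exist, and infinite sums
  are reached through finite partial sums. The constants are assembled from \<open>p\<close>, the
  matrix dimension and a bound \<open>K\<close> of the characteristic of \<open>V\<close>.\<close>

definition cip :: "complex^'d \<Rightarrow> complex^'d \<Rightarrow> complex" where
  "cip u v = (\<Sum>i\<in>UNIV. cnj (u $ i) * v $ i)"

text \<open>The built-in \<open>inner\<close> on \<open>complex^'d\<close> is a real inner product.
  It serves for Cauchy-Schwarz and for variations; complex orthogonality has to be expressed by
  \<open>cip\<close>.\<close>

lemma inner_eq_Re_cip: "inner u v = Re (cip u v)"
  by (simp add: inner_vec_def cip_def inner_complex_def)

lemma cip_self: "cip u u = of_real ((norm u)\<^sup>2)"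
proof -
  have "cip u u = (\<Sum>i\<in>UNIV. of_real ((norm (u $ i))\<^sup>2))"
    unfolding cip_def by (intro sum.cong refl) (simp only: complex_norm_square mult.commute)
  also have "\<dots> = of_real ((norm u)\<^sup>2)"
    by (simp add: norm_vec_def L2_set_def real_sqrt_pow2 sum_nonneg)
  finally show ?thesis .
qed

lemma cip_commute: "cip u v = cnj (cip v u)"
  by (simp add: cip_def mult.commute)

lemma cip_add_right: "cip u (v + w) = cip u v + cip u w"
  by (simp add: cip_def sum.distrib algebra_simps)

lemma cip_diff_right: "cip u (v - w) = cip u v - cip u w"
  by (simp add: cip_def sum_subtractf algebra_simps)

lemma cip_scale_right: "cip u (c *s v) = c * cip u v"
  by (simp add: cip_def sum_distrib_left algebra_simps)

lemma cip_scale_left: "cip (c *s u) v = cnj c * cip u v"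
  by (simp add: cip_def sum_distrib_left algebra_simps)

lemma scaleR_eq_scale: "r *\<^sub>R (v :: complex^'d) = of_real r *s v"
  unfolding vec_eq_iff vector_scaleR_component vector_smult_component
  by (simp add: scaleR_conv_of_real)

lemma norm_scale: "norm (c *s (v :: complex^'d)) = norm c * norm v"
  by (simp add: norm_vec_def norm_mult L2_set_right_distrib)

lemma conj_transpose_nth: "conj_transpose A $ i $ j = cnj (A $ j $ i)"
  by (simp add: conj_transpose_def map_matrix_def transpose_def)

lemma conj_transpose_involutive [simp]: "conj_transpose (conj_transpose A) = A"
  by (simp add: vec_eq_iff conj_transpose_nth)

lemma conj_transpose_mult: "conj_transpose (A ** B) = conj_transpose B ** conj_transpose A"
  by (simp add: vec_eq_iff conj_transpose_nth matrix_matrix_mult_def mult.commute)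

lemma conj_transpose_mat_1 [simp]: "conj_transpose (mat 1) = mat 1"
  by (simp add: vec_eq_iff conj_transpose_nth mat_def)

lemma conj_transpose_diag [simp]: "conj_transpose (diag_matrix l) = diag_matrix l"
  by (simp add: vec_eq_iff conj_transpose_nth diag_matrix_def)

lemma cip_adjoint: "cip u (A *v v) = cip (conj_transpose A *v u) v"
proof -
  have "cip u (A *v v) = (\<Sum>i\<in>UNIV. \<Sum>j\<in>UNIV. cnj (u $ i) * (A $ i $ j * v $ j))"
    by (simp add: cip_def matrix_vector_mult_def sum_distrib_left)
  also have "\<dots> = (\<Sum>j\<in>UNIV. \<Sum>i\<in>UNIV. cnj (u $ i) * (A $ i $ j * v $ j))"
    by (rule sum.swap)
  also have "\<dots> = cip (conj_transpose A *v u) v"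
    by (simp add: cip_def matrix_vector_mult_def conj_transpose_nth sum_distrib_right
        sum_distrib_left mult_ac)
  finally show ?thesis .
qed

text \<open>A unimodular factor on \<open>v\<close> makes the pairing real and nonnegative, so that
  the real Cauchy-Schwarz inequality applies.\<close>

lemma norm_cip_le: "norm (cip u v) \<le> norm u * norm v"
proof (cases "cip u v = 0")
  case False
  define c where "c = cnj (cip u v) / norm (cip u v)"
  have c: "norm c = 1" using False by (simp add: c_def norm_divide)
  have "cip u (c *s v) = norm (cip u v)"
    using False by (simp add: cip_scale_right c_def complex_norm_square[symmetric] power2_eq_square
        mult.commute)
  then have "norm (cip u v) = inner u (c *s v)"
    by (simp add: inner_eq_Re_cip)
  also have "\<dots> \<le> norm u * norm (c *s v)" by (rule norm_cauchy_schwarz)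
  finally show ?thesis by (simp add: norm_scale c)
qed auto

lemma pos_def_cip: "pos_def A \<longleftrightarrow> conj_transpose A = A \<and> (\<forall>v. v \<noteq> 0 \<longrightarrow> 0 < Re (cip v (A *v v)))"
  by (simp add: pos_def_def cip_def)

text \<open>Small \<open>t\<close> of either sign leaves no room for a linear term. This is the
  first-order condition at a maximum, in a form without derivatives.\<close>

lemma linear_le_quadratic_imp_zero:
  fixes a b :: real
  assumes "\<And>t. a * t \<le> b * t\<^sup>2"
  shows "a = 0"
proof (rule ccontr)
  assume "a \<noteq> 0"
  define t where "t = a / (2 * (\<bar>b\<bar> + 1))"
  have a: "a = 2 * (\<bar>b\<bar> + 1) * t" by (simp add: t_def)
  have "b * t\<^sup>2 \<le> \<bar>b\<bar> * t\<^sup>2" by (intro mult_right_mono) auto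
  also have "\<dots> < (2 * (\<bar>b\<bar> + 1)) * t\<^sup>2"
    using \<open>a \<noteq> 0\<close> by (intro mult_strict_right_mono) (auto simp: t_def)
  also have "\<dots> = a * t"
    by (simp only: a power2_eq_square mult.assoc)
  finally show False using assms[of t] by simp
qed

text \<open>Complex orthogonality to \<open>f i\<close> is real orthogonality to both
  \<open>f i\<close> and \<open>\<i> *s f i\<close>, so fewer than d complex conditions are fewer
  than 2d real ones.\<close>

lemma exists_cip_orthogonal:
  fixes f :: "'d::finite \<Rightarrow> complex^'d"
  assumes "k \<notin> J"
  shows "\<exists>v. v \<noteq> 0 \<and> (\<forall>i\<in>J. cip (f i) v = 0)"
proof -
  define X where "X = f ` J \<union> (\<lambda>i. \<i> *s f i) ` J"
  have fin: "finite J" by simp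
  have "card X \<le> card (f ` J) + card ((\<lambda>i. \<i> *s f i) ` J)"
    unfolding X_def by (rule card_Un_le)
  also have "\<dots> \<le> card J + card J"
    by (intro add_mono card_image_le fin)
  also have "card J < CARD('d)"
    using assms by (intro psubset_card_mono) auto
  finally have "card X < 2 * CARD('d)" by simp
  moreover have "dim X \<le> card X" by (rule dim_le_card') (simp add: X_def)
  ultimately have "dim X < DIM(complex^'d)" by simp
  from orthogonal_to_subspace_exists[OF this]
  obtain v where v: "v \<noteq> 0" "\<And>y. y \<in> span X \<Longrightarrow> orthogonal v y" by blast
  have "cip (f i) v = 0" if "i \<in> J" for i
  proof -
    have "inner (f i) v = 0" "inner (\<i> *s f i) v = 0"
      using v(2)[OF span_base, of "f i"] v(2)[OF span_base, of "\<i> *s f i"] that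
      by (auto simp: X_def orthogonal_def inner_commute)
    then have "Re (cip (f i) v) = 0" "Im (cip (f i) v) = 0"
      by (auto simp: inner_eq_Re_cip cip_scale_left)
    then show ?thesis by (simp add: complex_eq_iff)
  qed
  with v(1) show ?thesis by blast
qed

text \<open>A maximizer of the Rayleigh quotient on the orthogonal complement of the eigenvectors found
  so far is again an eigenvector.\<close>

lemma hermitian_partial_eigenbasis:
  fixes A :: "complex^'d^'d"
    and J :: "'d set"
  assumes herm: "conj_transpose A = A"
  shows "\<exists>f l. (\<forall>i\<in>J. A *v f i = of_real (l i) *s f i) \<and>
           (\<forall>i\<in>J. \<forall>j\<in>J. cip (f i) (f j) = (if i = j then 1 else 0))"
proof -
  have "finite J" by simp
  then show ?thesis
  proof induction
    case empty
    show ?case by auto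
  next
    case (insert k J)
    then obtain f l where eig: "\<And>i. i \<in> J \<Longrightarrow> A *v f i = of_real (l i) *s f i"
      and on: "\<And>i j. i \<in> J \<Longrightarrow> j \<in> J \<Longrightarrow> cip (f i) (f j) = (if i = j then 1 else 0)"
      by blast
    define S where "S = {v. \<forall>i\<in>J. cip (f i) v = 0}"
    have S_scale: "c *s v \<in> S" if "v \<in> S" for c v
      using that by (simp add: S_def cip_scale_right)
    have S_diff: "v - w \<in> S" and S_add: "v + w \<in> S" if "v \<in> S" "w \<in> S" for v w
      using that by (simp_all add: S_def cip_diff_right cip_add_right)
    have S_A: "A *v v \<in> S" if "v \<in> S" for v
      using that eig by (simp add: S_def cip_adjoint herm cip_scale_left)
    have cont: "continuous_on UNIV (\<lambda>v. cip u v)" for u :: "complex^'d"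
      unfolding cip_def by (intro continuous_intros)
    have "closed S"
    proof -
      have "S = (\<Inter>i\<in>J. {v. cip (f i) v = 0})" by (auto simp: S_def)
      then show ?thesis
        by (auto intro!: closed_Collect_eq cont continuous_intros)
    qed
    then have comp: "compact (sphere 0 1 \<inter> S)" by (intro compact_Int_closed) auto
    obtain v0 where "v0 \<noteq> 0" "v0 \<in> S"
      using exists_cip_orthogonal[OF insert(2), of f] by (auto simp: S_def)
    then have "of_real (1 / norm v0) *s v0 \<in> sphere 0 1 \<inter> S"
      using S_scale by (auto simp: norm_scale norm_divide)
    then have ne: "sphere 0 1 \<inter> S \<noteq> {}" by blast
    have contA: "continuous_on (sphere 0 1 \<inter> S) (\<lambda>v. inner v (A *v v))"
      by (intro continuous_intros continuous_on_subset[OF matrix_vector_mult_linear_continuous_on]) auto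
    from continuous_attains_sup[OF comp ne contA]
    obtain v where v: "norm v = 1" "v \<in> S"
      and max: "\<And>w. norm w = 1 \<Longrightarrow> w \<in> S \<Longrightarrow> inner w (A *v w) \<le> inner v (A *v v)"
      by auto
    define \<mu> where "\<mu> = inner v (A *v v)"
    have maxall: "inner w (A *v w) \<le> \<mu> * (norm w)\<^sup>2" if "w \<in> S" for w
    proof (cases "w = 0")
      case False
      let ?w = "of_real (1 / norm w) *s w"
      have "inner ?w (A *v ?w) \<le> \<mu>"
        unfolding \<mu>_def using False that by (intro max S_scale) (auto simp: norm_scale norm_divide)
      moreover have "inner ?w (A *v ?w) = inner w (A *v w) / (norm w)\<^sup>2"
        using False
        by (simp add: inner_eq_Re_cip vector_scalar_commute vector_smult_assoc
            cip_scale_left cip_scale_right power2_eq_square field_simps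
            flip: of_real_divide of_real_mult)
      ultimately have "inner w (A *v w) / (norm w)\<^sup>2 \<le> \<mu>" by simp
      then show ?thesis using False by (simp add: pos_divide_le_eq)
    qed simp
    \<comment> \<open>Half the gradient at \<open>v\<close> of
      \<open>inner v (A *v v) - \<mu> * (norm v)\<^sup>2\<close>. It lies in \<open>S\<close>, so
      moving along \<open>w\<close> is an admissible variation, and maximality forces
      \<open>w = 0\<close>.\<close>
    define w where "w = A *v v - of_real \<mu> *s v"
    have wS: "w \<in> S" unfolding w_def by (intro S_diff S_A S_scale v)
    have sym: "inner v (A *v w) = inner w (A *v v)"
    proof -
      have "cip v (A *v w) = cnj (cip w (A *v v))" by (subst cip_adjoint) (simp add: herm cip_commute[of "A *v v" w])
      then show ?thesis by (simp add: inner_eq_Re_cip)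
    qed
    have ww: "inner w w = inner w (A *v v) - \<mu> * inner v w"
      unfolding inner_eq_Re_cip
      by (subst (2) w_def) (simp add: cip_diff_right cip_scale_right cip_commute[of v w])
    have "(2 * inner w w) * t \<le> (\<mu> * (norm w)\<^sup>2 - inner w (A *v w)) * t\<^sup>2" for t :: real
    proof -
      have Atw: "A *v (t *\<^sub>R w) = t *\<^sub>R (A *v w)"
        by (simp only: scaleR_eq_scale vector_scalar_commute)
      have vt: "v + t *\<^sub>R w \<in> S" by (simp add: scaleR_eq_scale S_add S_scale v wS)
      have "inner (v + t *\<^sub>R w) (A *v (v + t *\<^sub>R w)) \<le> \<mu> * (norm (v + t *\<^sub>R w))\<^sup>2"
        by (rule maxall[OF vt])
      moreover have "inner (v + t *\<^sub>R w) (A *v (v + t *\<^sub>R w)) =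
          \<mu> + 2 * t * inner w (A *v v) + t\<^sup>2 * inner w (A *v w)"
        by (simp add: matrix_vector_right_distrib Atw inner_add_left
            inner_add_right sym \<mu>_def[symmetric] power2_eq_square algebra_simps)
      moreover have "(norm (v + t *\<^sub>R w))\<^sup>2 = 1 + 2 * t * inner v w + t\<^sup>2 * (norm w)\<^sup>2"
        using v(1) unfolding power2_norm_eq_inner
        by (simp add: inner_add_left inner_add_right norm_eq_1
            inner_commute[of w v] power2_eq_square algebra_simps)
      ultimately show ?thesis by (simp add: ww algebra_simps)
    qed
    then have "2 * inner w w = 0" by (rule linear_le_quadratic_imp_zero)
    then have "w = 0" by simp
    then have Av: "A *v v = of_real \<mu> *s v" by (simp add: w_def)
    have vv: "cip v v = 1" using v(1) by (simp add: cip_self)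
    have fv: "cip (f i) v = 0" "cip v (f i) = 0" if "i \<in> J" for i
      using v(2) that by (auto simp: S_def cip_commute[of v])
    show ?case
      using insert(2) eig on Av vv fv
      by (intro exI[of _ "f(k := v)"] exI[of _ "l(k := \<mu>)"]) auto
  qed
qed

lemma pos_def_diagonalizable:
  fixes A :: "complex^'d^'d"
  assumes "pos_def A"
  obtains P l where "conj_transpose P ** P = mat 1" "\<And>i. 0 < l i"
    "A = P ** diag_matrix l ** conj_transpose P"
proof -
  have herm: "conj_transpose A = A" using assms by (simp add: pos_def_def)
  from hermitian_partial_eigenbasis[OF herm, of UNIV]
  obtain f :: "'d \<Rightarrow> complex^'d" and l where "\<forall>i\<in>UNIV. A *v f i = of_real (l i) *s f i"
      and "\<forall>i\<in>UNIV. \<forall>j\<in>UNIV. cip (f i) (f j) = (if i = j then 1 else 0)"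
    by blast
  then have eig: "\<And>i. A *v f i = of_real (l i) *s f i"
      and on: "\<And>i j. cip (f i) (f j) = (if i = j then 1 else 0)"
    by auto
  define P :: "complex^'d^'d" where "P = (\<chi> i j. f j $ i)"
  have P1: "conj_transpose P ** P = mat 1"
    using on by (simp add: vec_eq_iff matrix_matrix_mult_def conj_transpose_nth P_def mat_def cip_def)
  then have P2: "P ** conj_transpose P = mat 1" by (simp add: matrix_left_right_inverse)
  have "A ** P = P ** diag_matrix l"
  proof -
    have "(A ** P) $ i $ j = (P ** diag_matrix l) $ i $ j" for i j
    proof -
      have "(A ** P) $ i $ j = (A *v f j) $ i"
        by (simp add: matrix_matrix_mult_def matrix_vector_mult_def P_def)
      also have "\<dots> = (P ** diag_matrix l) $ i $ j"
        by (simp add: eig matrix_matrix_mult_def P_def diag_matrix_def if_distrib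
            cong: if_cong)
      finally show ?thesis .
    qed
    then show ?thesis by (simp add: vec_eq_iff)
  qed
  then have "A = P ** diag_matrix l ** conj_transpose P"
    by (metis P2 matrix_mul_assoc matrix_mul_rid)
  moreover have "0 < l i" for i
  proof -
    have "f i \<noteq> 0" using on[of i i] by (auto simp: cip_def)
    then have "0 < Re (cip (f i) (A *v f i))" using assms by (simp add: pos_def_cip)
    then show ?thesis by (simp add: eig cip_scale_right on)
  qed
  ultimately show ?thesis using that P1 by blast
qed

section \<open>Powers and operator norms of matrices\<close>

definition conj_diag :: "complex^'d^'d \<Rightarrow> ('d \<Rightarrow> real) \<Rightarrow> complex^'d^'d" where
  "conj_diag P l = P ** diag_matrix l ** conj_transpose P"

lemma diag_matrix_mult_left: "(diag_matrix l ** B) $ i $ j = of_real (l i) * B $ i $ j"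
proof -
  have "(if i = k then c else 0) * x = (if k = i then c * x else 0)" for k and c x :: complex
    by simp
  then show ?thesis by (simp add: matrix_matrix_mult_def diag_matrix_def)
qed

lemma diag_matrix_mult_right: "(B ** diag_matrix l) $ i $ j = B $ i $ j * of_real (l j)"
proof -
  have "x * (if k = j then c else 0) = (if k = j then x * c else 0)" for k and c x :: complex
    by simp
  then show ?thesis by (simp add: matrix_matrix_mult_def diag_matrix_def)
qed

lemma conj_diag_nth: "conj_diag P l $ i $ j = (\<Sum>k\<in>UNIV. P $ i $ k * of_real (l k) * cnj (P $ j $ k))"
  unfolding conj_diag_def matrix_matrix_mult_def[of "P ** diag_matrix l"]
  by (simp add: diag_matrix_mult_right conj_transpose_nth)

lemma diag_matrix_mult: "diag_matrix l ** diag_matrix k = diag_matrix (\<lambda>i. l i * k i)"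
  unfolding vec_eq_iff diag_matrix_mult_left by (simp add: diag_matrix_def)

lemma conj_diag_mult:
  assumes "conj_transpose P ** P = mat 1"
  shows "conj_diag P l ** conj_diag P k = conj_diag P (\<lambda>i. l i * k i)"
proof -
  have "conj_diag P l ** conj_diag P k =
      P ** diag_matrix l ** (conj_transpose P ** P) ** diag_matrix k ** conj_transpose P"
    by (simp add: conj_diag_def matrix_mul_assoc)
  also have "\<dots> = P ** (diag_matrix l ** diag_matrix k) ** conj_transpose P"
    by (simp add: assms matrix_mul_assoc)
  finally show ?thesis by (simp add: conj_diag_def diag_matrix_mult)
qed

lemma conj_diag_one:
  assumes "conj_transpose P ** P = mat 1"
  shows "conj_diag P (\<lambda>_. 1) = mat 1"
proof -
  have "diag_matrix (\<lambda>_. 1) = (mat 1 :: complex^'a^'a)"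
    by (simp add: vec_eq_iff diag_matrix_def mat_def)
  then show ?thesis using assms by (simp add: conj_diag_def matrix_left_right_inverse)
qed

lemma conj_transpose_conj_diag: "conj_transpose (conj_diag P l) = conj_diag P l"
  by (simp add: conj_diag_def conj_transpose_mult matrix_mul_assoc)

lemma conj_diag_tendsto:
  assumes "\<And>i. (\<lambda>k. g k i) \<longlonglongrightarrow> l i"
  shows "(\<lambda>k. conj_diag P (g k)) \<longlonglongrightarrow> conj_diag P l"
  by (intro vec_tendstoI, unfold conj_diag_nth)
    (intro tendsto_sum tendsto_mult tendsto_const tendsto_of_real assms)

text \<open>Polynomials in \<open>A\<close> are independent of any diagonalization and measurable in
  \<open>A\<close>; pointwise limits carry both properties over to real powers.\<close>

definition matrix_poly :: "(nat \<Rightarrow> real) \<Rightarrow> nat \<Rightarrow> complex^'d^'d \<Rightarrow> complex^'d^'d" where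
  "matrix_poly a n A = (\<Sum>i\<le>n. a i *\<^sub>R (((**) A) ^^ i) (mat 1))"

lemma matrix_poly_conj_diag:
  assumes "conj_transpose P ** P = mat 1"
  shows "matrix_poly a n (conj_diag P l) = conj_diag P (\<lambda>j. \<Sum>i\<le>n. a i * l j ^ i)"
proof -
  have pow: "(((**) (conj_diag P l)) ^^ i) (mat 1) = conj_diag P (\<lambda>j. l j ^ i)" for i
    by (induction i) (simp_all add: conj_diag_one conj_diag_mult assms)
  have "(\<Sum>i\<le>n. a i *\<^sub>R conj_diag P (\<lambda>j. l j ^ i)) $ r $ s
      = conj_diag P (\<lambda>j. \<Sum>i\<le>n. a i * l j ^ i) $ r $ s" for r s
  proof -
    have "(\<Sum>i\<le>n. a i *\<^sub>R conj_diag P (\<lambda>j. l j ^ i)) $ r $ s =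
        (\<Sum>i\<le>n. \<Sum>k\<in>UNIV. of_real (a i) * (P $ r $ k * of_real (l k ^ i) * cnj (P $ s $ k)))"
      unfolding sum_component vector_scaleR_component
      by (simp add: conj_diag_nth scaleR_conv_of_real sum_distrib_left del: of_real_power)
    also have "\<dots> = (\<Sum>k\<in>UNIV. \<Sum>i\<le>n. of_real (a i) * (P $ r $ k * of_real (l k ^ i) * cnj (P $ s $ k)))"
      by (rule sum.swap)
    also have "\<dots> = conj_diag P (\<lambda>j. \<Sum>i\<le>n. a i * l j ^ i) $ r $ s"
      by (simp add: conj_diag_nth sum_distrib_left sum_distrib_right mult_ac)
    finally show ?thesis .
  qed
  then show ?thesis by (simp add: matrix_poly_def pow vec_eq_iff)
qed

text \<open>Weierstrass approximation on the intervals from \<open>1 / k\<close> to \<open>k\<close>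
  with error \<open>1 / k\<close>: every positive \<open>x\<close> lies in all but finitely many of
  them. One sequence of polynomials serves all \<open>x\<close> at once.\<close>

lemma powr_pointwise_limit_of_polynomials:
  fixes s :: real
  shows "\<exists>a n. \<forall>x>0. (\<lambda>k. \<Sum>i\<le>n k. a k i * x ^ i) \<longlonglongrightarrow> x powr s"
proof -
  have "\<exists>a n. \<forall>x\<in>{1/real (Suc k)..real (Suc k)}. \<bar>x powr s - (\<Sum>i\<le>n. a i * x ^ i)\<bar> < 1 / real (Suc k)"
    for k :: nat
  proof -
    have "continuous_on {1/real (Suc k)..real (Suc k)} (\<lambda>x. x powr s)"
      by (intro continuous_intros) (auto simp: field_simps)
    from Stone_Weierstrass_real_polynomial_function[OF compact_Icc this, of "1 / real (Suc k)"]
    obtain g where "real_polynomial_function g"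
        "\<And>x. x \<in> {1/real (Suc k)..real (Suc k)} \<Longrightarrow> \<bar>x powr s - g x\<bar> < 1 / real (Suc k)"
      by auto
    then show ?thesis unfolding real_polynomial_function_iff_sum by metis
  qed
  then obtain a n where an: "\<And>k x. x \<in> {1/real (Suc k)..real (Suc k)} \<Longrightarrow>
      \<bar>x powr s - (\<Sum>i\<le>n k. a k i * x ^ i)\<bar> < 1 / real (Suc k)"
    by metis
  have "(\<lambda>k. \<Sum>i\<le>n k. a k i * x ^ i) \<longlonglongrightarrow> x powr s" if "0 < x" for x
  proof -
    obtain N :: nat where N: "x \<le> real N" "1 / x \<le> real N"
      using real_arch_simple[of "max x (1/x)"] by auto
    have "\<forall>\<^sub>F k in sequentially. norm ((\<Sum>i\<le>n k. a k i * x ^ i) - x powr s) \<le> 1 / real (Suc k)"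
    proof (rule eventually_sequentiallyI[of N])
      fix k assume "N \<le> k"
      then have "x \<le> real (Suc k)" "1 / x \<le> real (Suc k)" using N by auto
      then have "x \<in> {1/real (Suc k)..real (Suc k)}" using that by (auto simp: field_simps)
      from an[OF this] show "norm ((\<Sum>i\<le>n k. a k i * x ^ i) - x powr s) \<le> 1 / real (Suc k)"
        by simp
    qed
    then have "(\<lambda>k. (\<Sum>i\<le>n k. a k i * x ^ i) - x powr s) \<longlonglongrightarrow> 0"
      by (rule Lim_null_comparison) (rule LIMSEQ_Suc[OF lim_1_over_n])
    then show ?thesis by (simp add: LIM_zero_iff)
  qed
  then show ?thesis by blast
qed

text \<open>Both sides are limits of the same polynomials evaluated at the same matrix.\<close>

lemma conj_diag_powr_unique:
  assumes "conj_transpose P ** P = mat 1" "conj_transpose Q ** Q = mat 1"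
    and "\<And>i. 0 < l i" "\<And>i. 0 < m i" "conj_diag P l = conj_diag Q m"
  shows "conj_diag P (\<lambda>i. l i powr s) = conj_diag Q (\<lambda>i. m i powr s)"
proof -
  obtain a n where an: "\<forall>x>0. (\<lambda>k. \<Sum>i\<le>n k. a k i * x ^ i) \<longlonglongrightarrow> x powr s"
    using powr_pointwise_limit_of_polynomials[of s] by (elim exE)
  have 1: "(\<lambda>k. matrix_poly (a k) (n k) (conj_diag P l)) \<longlonglongrightarrow> conj_diag P (\<lambda>i. l i powr s)"
    using assms(1,3) by (auto simp: matrix_poly_conj_diag intro!: conj_diag_tendsto an[rule_format])
  have 2: "(\<lambda>k. matrix_poly (a k) (n k) (conj_diag Q m)) \<longlonglongrightarrow> conj_diag Q (\<lambda>i. m i powr s)"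
    using assms(2,4) by (auto simp: matrix_poly_conj_diag intro!: conj_diag_tendsto an[rule_format])
  show ?thesis by (rule LIMSEQ_unique[OF 1[unfolded assms(5)] 2])
qed

text \<open>Independence of the diagonalization is what gives the definite description in
  \<open>matrix_powr\<close> its value.\<close>

lemma matrix_powr_conj_diag:
  assumes "conj_transpose P ** P = mat 1" "\<And>i. 0 < l i"
  shows "matrix_powr (conj_diag P l) s = conj_diag P (\<lambda>i. l i powr s)"
  unfolding matrix_powr_def conj_diag_def[symmetric]
proof (rule the_equality)
  fix M assume "\<exists>Q m. conj_transpose Q ** Q = mat 1 \<and> (\<forall>i. 0 < m i) \<and>
    conj_diag P l = conj_diag Q m \<and> M = conj_diag Q (\<lambda>i. m i powr s)"
  then obtain Q m where Q: "conj_transpose Q ** Q = mat 1" "\<forall>i. 0 < m i"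
    "conj_diag P l = conj_diag Q m" "M = conj_diag Q (\<lambda>i. m i powr s)"
    by (elim exE conjE)
  show "M = conj_diag P (\<lambda>i. l i powr s)"
    unfolding Q(4) using Q(2)
    by (intro conj_diag_powr_unique[OF assms(1) Q(1) assms(2) _ Q(3), symmetric]) auto
qed (use assms in \<open>auto intro!: exI[of _ P] exI[of _ l]\<close>)

lemma pos_def_conj_diag:
  assumes "pos_def A"
  obtains P l where "conj_transpose P ** P = mat 1" "\<And>i. 0 < l i" "A = conj_diag P l"
  by (rule pos_def_diagonalizable[OF assms, folded conj_diag_def]) (rule that)

lemma conj_transpose_matrix_powr:
  assumes "pos_def A"
  shows "conj_transpose (matrix_powr A s) = matrix_powr A s"
proof -
  obtain P l where P: "conj_transpose P ** P = mat 1" "\<And>i. 0 < l i" "A = conj_diag P l"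
    using pos_def_conj_diag[OF assms] by blast
  then show ?thesis by (simp add: matrix_powr_conj_diag conj_transpose_conj_diag)
qed

lemma matrix_powr_mult_minus:
  assumes "pos_def A"
  shows "matrix_powr A s ** matrix_powr A (- s) = mat 1"
proof -
  obtain P l where P: "conj_transpose P ** P = mat 1" "\<And>i. 0 < l i" "A = conj_diag P l"
    using pos_def_conj_diag[OF assms] by blast
  have "l i powr s * l i powr (- s) = 1" for i
    using P(2)[of i] by (simp flip: powr_add)
  then show ?thesis by (simp add: P matrix_powr_conj_diag conj_diag_mult conj_diag_one)
qed

lemma pos_def_matrix_inv:
  assumes "pos_def A"
  shows "A ** matrix_inv A = mat 1" "matrix_inv A ** A = mat 1"
proof -
  obtain P l where P: "conj_transpose P ** P = mat 1" "\<And>i. 0 < l i" "A = conj_diag P l"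
    using pos_def_conj_diag[OF assms] by blast
  have "l i * inverse (l i) = 1" for i using P(2)[of i] by simp
  then have "A ** conj_diag P (\<lambda>i. inverse (l i)) = mat 1"
    by (simp add: P conj_diag_mult conj_diag_one)
  then have "invertible A" using invertible_right_inverse by blast
  then have "A ** matrix_inv A = mat 1 \<and> matrix_inv A ** A = mat 1"
    unfolding invertible_def matrix_inv_def by (rule someI_ex)
  then show "A ** matrix_inv A = mat 1" "matrix_inv A ** A = mat 1" by auto
qed

lemma conj_transpose_matrix_inv:
  assumes "pos_def A"
  shows "conj_transpose (matrix_inv A) = matrix_inv A"
proof -
  have "conj_transpose (matrix_inv A) ** A = mat 1"
    by (metis assms conj_transpose_mat_1 conj_transpose_mult pos_def_def pos_def_matrix_inv(1))
  then show ?thesis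
    by (metis assms matrix_mul_assoc matrix_mul_lid matrix_mul_rid pos_def_matrix_inv(1))
qed

section \<open>Operator norm, Hilbert-Schmidt norm and trace pairing\<close>

lemma bounded_linear_matrix_vector: "bounded_linear ((*v) (A :: complex^'d^'d))"
  by (rule matrix_vector_mul_bounded_linear)

lemma norm_matrix_vector_le: "norm (A *v v) \<le> opnorm A * norm v"
  unfolding opnorm_def by (rule onorm[OF bounded_linear_matrix_vector])

lemma opnorm_nonneg [simp]: "0 \<le> opnorm A"
  unfolding opnorm_def by (rule onorm_pos_le[OF bounded_linear_matrix_vector])

lemma opnorm_le: "(\<And>v. norm (A *v v) \<le> c * norm v) \<Longrightarrow> opnorm A \<le> c"
  unfolding opnorm_def by (rule onorm_le)

lemma opnorm_zero [simp]: "opnorm 0 = 0"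
  by (intro antisym opnorm_le) auto

lemma matrix_mult_zero [simp]: "A ** (0 :: complex^'d^'d) = 0" "(0 :: complex^'d^'d) ** A = 0"
  by (simp_all add: vec_eq_iff matrix_matrix_mult_def)

lemma opnorm_mult_le: "opnorm (A ** B) \<le> opnorm A * opnorm B"
proof (rule opnorm_le)
  fix v
  have "norm ((A ** B) *v v) \<le> opnorm A * norm (B *v v)"
    by (simp flip: matrix_vector_mul_assoc add: norm_matrix_vector_le)
  also have "\<dots> \<le> opnorm A * (opnorm B * norm v)"
    by (intro mult_left_mono norm_matrix_vector_le) auto
  finally show "norm ((A ** B) *v v) \<le> opnorm A * opnorm B * norm v" by (simp add: mult.assoc)
qed

lemma opnorm_add_le: "opnorm (A + B) \<le> opnorm A + opnorm B"
proof (rule opnorm_le)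
  fix v
  have "norm ((A + B) *v v) \<le> norm (A *v v) + norm (B *v v)"
    by (simp add: matrix_vector_mult_add_rdistrib norm_triangle_ineq)
  also have "\<dots> \<le> (opnorm A + opnorm B) * norm v"
    using norm_matrix_vector_le[of A v] norm_matrix_vector_le[of B v] by (simp add: distrib_right)
  finally show "norm ((A + B) *v v) \<le> (opnorm A + opnorm B) * norm v" .
qed

lemma opnorm_le_norm: "opnorm A \<le> norm A"
proof (rule opnorm_le)
  fix v
  have comp: "norm ((A *v v) $ i) \<le> norm (A $ i) * norm v" for i
  proof -
    have "(A *v v) $ i = cip (\<chi> j. cnj (A $ i $ j)) v"
      by (simp add: cip_def matrix_vector_mult_def)
    moreover have "norm (\<chi> j. cnj (A $ i $ j)) = norm (A $ i)" by (simp add: norm_vec_def)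
    ultimately show ?thesis using norm_cip_le by metis
  qed
  have "norm (A *v v) = L2_set (\<lambda>i. norm ((A *v v) $ i)) UNIV" by (simp add: norm_vec_def)
  also have "\<dots> \<le> L2_set (\<lambda>i. norm (A $ i) * norm v) UNIV"
    by (intro L2_set_mono comp) auto
  also have "\<dots> = norm A * norm v"
    by (simp add: norm_vec_def[of A] L2_set_left_distrib[symmetric])
  finally show "norm (A *v v) \<le> norm A * norm v" .
qed

lemma opnorm_adjoint [simp]: "opnorm (conj_transpose A) = opnorm A"
proof -
  have le: "opnorm (conj_transpose A) \<le> opnorm A" for A :: "complex^'a^'a"
  proof (rule opnorm_le)
    fix v
    let ?w = "conj_transpose A *v v"
    have "(norm ?w)\<^sup>2 = norm (cip ?w ?w)" by (simp add: cip_self norm_power)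
    also have "cip ?w ?w = cip v (A *v ?w)" by (simp add: cip_adjoint)
    also have "norm \<dots> \<le> norm v * (opnorm A * norm ?w)"
      by (intro order.trans[OF norm_cip_le] mult_left_mono norm_matrix_vector_le) auto
    finally have "norm ?w * norm ?w \<le> (opnorm A * norm v) * norm ?w"
      by (simp add: power2_eq_square mult_ac)
    then show "norm ?w \<le> opnorm A * norm v"
      by (cases "norm ?w = 0") (auto dest: mult_right_le_imp_le)
  qed
  show ?thesis using le[of A] le[of "conj_transpose A"] by simp
qed

text \<open>Reversing a product of Hermitian factors is taking its adjoint, which keeps the norm.
  This substitutes for commutativity of weights and reducing operators.\<close>

lemma opnorm_mult_swap:
  assumes "conj_transpose A = A" "conj_transpose B = B"
  shows "opnorm (A ** B) = opnorm (B ** A)"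
  by (metis assms conj_transpose_mult opnorm_adjoint)

lemma matrix_vector_axis: "(A :: complex^'d^'d) *v axis j 1 = column j A"
  by (simp add: vec_eq_iff matrix_vector_mult_def axis_def column_def if_distrib cong: if_cong)

lemma opnorm_le_sum_columns: "opnorm A \<le> (\<Sum>j\<in>UNIV. norm (A *v axis j 1))"
proof (rule opnorm_le)
  fix v
  have "norm (A *v v) \<le> (\<Sum>j\<in>UNIV. norm (v $ j *s column j A))"
    by (simp add: matrix_mult_sum norm_sum)
  also have "\<dots> \<le> (\<Sum>j\<in>UNIV. norm v * norm (column j A))"
    by (intro sum_mono) (auto simp: norm_scale intro!: mult_right_mono Finite_Cartesian_Product.norm_nth_le)
  finally show "norm (A *v v) \<le> (\<Sum>j\<in>UNIV. norm (A *v axis j 1)) * norm v"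
    by (simp add: matrix_vector_axis sum_distrib_left mult.commute)
qed

text \<open>The sum over the columns is at most d times its largest term, and that bound survives
  any nonnegative power. It converts averages over the standard basis vectors into averages of
  operator norms, at the price of dimensional constants.\<close>

lemma opnorm_powr_le_sum:
  fixes A :: "complex^'d^'d"
  assumes "0 \<le> s"
  shows "opnorm A powr s \<le> real CARD('d) powr s * (\<Sum>j\<in>UNIV. norm (A *v axis j 1) powr s)"
proof -
  let ?f = "\<lambda>j. norm (A *v axis j 1)"
  have "Max (range ?f) \<in> range ?f" by (intro Max_in) auto
  then obtain j where "Max (range ?f) = ?f j" by blast
  then have j: "?f i \<le> ?f j" for i
    using Max_ge[of "range ?f" "?f i"] by simp
  have "opnorm A \<le> (\<Sum>j\<in>UNIV. ?f j)" by (rule opnorm_le_sum_columns)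
  also have "\<dots> \<le> (\<Sum>i\<in>(UNIV :: 'd set). ?f j)" by (intro sum_mono j)
  finally have "opnorm A powr s \<le> (real CARD('d) * ?f j) powr s"
    using assms by (intro powr_mono2) auto
  also have "\<dots> = real CARD('d) powr s * ?f j powr s" by (simp add: powr_mult)
  also have "?f j powr s \<le> (\<Sum>j\<in>UNIV. ?f j powr s)"
    by (intro member_le_sum) auto
  finally show ?thesis by (simp add: mult_left_mono)
qed

lemma trace_adjoint_mult: "trace (conj_transpose A ** B) = (\<Sum>i\<in>UNIV. \<Sum>j\<in>UNIV. cnj (A $ i $ j) * B $ i $ j)"
  unfolding trace_def matrix_matrix_mult_def by (simp add: conj_transpose_nth) (rule sum.swap)

text \<open>The norm of the type \<open>complex^'d^'d\<close> is the Hilbert-Schmidt norm.\<close>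

lemma trace_adjoint_self: "trace (conj_transpose A ** A) = of_real ((norm A)\<^sup>2)"
proof -
  have "trace (conj_transpose A ** A) = (\<Sum>i\<in>UNIV. cip (A $ i) (A $ i))"
    by (simp add: trace_adjoint_mult cip_def)
  also have "\<dots> = of_real ((norm A)\<^sup>2)"
    by (simp add: cip_self norm_vec_def[of A] L2_set_def real_sqrt_pow2 sum_nonneg)
  finally show ?thesis .
qed

lemma norm_matrix_le_opnorm: "norm (A :: complex^'d^'d) \<le> sqrt (real CARD('d)) * opnorm A"
proof -
  have "(norm A)\<^sup>2 = (\<Sum>i\<in>UNIV. \<Sum>j\<in>UNIV. (norm (A $ i $ j))\<^sup>2)"
    by (simp add: norm_vec_def L2_set_def real_sqrt_pow2 sum_nonneg)
  also have "\<dots> = (\<Sum>j\<in>UNIV. \<Sum>i\<in>UNIV. (norm (A $ i $ j))\<^sup>2)" by (rule sum.swap)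
  also have "\<dots> = (\<Sum>j\<in>UNIV. (norm (A *v axis j 1))\<^sup>2)"
    by (simp add: matrix_vector_axis column_def norm_vec_def[of "vec_lambda _"] L2_set_def
        real_sqrt_pow2 sum_nonneg)
  also have "\<dots> \<le> (\<Sum>j\<in>(UNIV::'d set). (opnorm A)\<^sup>2)"
  proof (intro sum_mono power_mono)
    show "norm (A *v axis j 1) \<le> opnorm A" for j
      using norm_matrix_vector_le[of A "axis j 1"] by simp
  qed auto
  also have "\<dots> = (sqrt (real CARD('d)) * opnorm A)\<^sup>2" by (simp add: power_mult_distrib)
  finally show ?thesis by (rule power2_le_imp_le) simp
qed

lemma norm_trace_adjoint_mult_le: "norm (trace (conj_transpose A ** B)) \<le> norm A * norm B"
proof -
  have "norm (trace (conj_transpose A ** B)) \<le> (\<Sum>i\<in>UNIV. norm (cip (A $ i) (B $ i)))"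
    by (simp add: trace_adjoint_mult cip_def norm_sum)
  also have "\<dots> \<le> (\<Sum>i\<in>UNIV. norm (A $ i) * norm (B $ i))" by (intro sum_mono norm_cip_le)
  also have "\<dots> \<le> norm A * norm B"
    using L2_set_mult_ineq[of "\<lambda>i. norm (A $ i)" "\<lambda>i. norm (B $ i)" UNIV]
    by (simp add: norm_vec_def[of A] norm_vec_def[of B])
  finally show ?thesis .
qed

lemma norm_trace_adjoint_mult_le_opnorm:
  fixes A B :: "complex^'d^'d"
  shows "norm (trace (conj_transpose A ** B)) \<le> real CARD('d) * (opnorm A * opnorm B)"
proof -
  have "norm (trace (conj_transpose A ** B)) \<le> norm A * norm B" by (rule norm_trace_adjoint_mult_le)
  also have "\<dots> \<le> (sqrt (real CARD('d)) * opnorm A) * (sqrt (real CARD('d)) * opnorm B)"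
    by (intro mult_mono norm_matrix_le_opnorm) auto
  finally show ?thesis by (simp add: algebra_simps)
qed

section \<open>Measurability of matrix-valued functions and of powers of weights\<close>

lemma continuous_on_matrix_mult [continuous_intros]:
  fixes f g :: "'a::topological_space \<Rightarrow> complex^'d^'d"
  assumes "continuous_on S f" "continuous_on S g"
  shows "continuous_on S (\<lambda>x. f x ** g x)"
  unfolding matrix_matrix_mult_def
  by (intro continuous_intros continuous_on_component assms)

lemma continuous_on_opnorm: "continuous_on S (opnorm :: complex^'d^'d \<Rightarrow> real)"
proof -
  have "\<bar>opnorm A - opnorm B\<bar> \<le> norm (A - B)" for A B :: "complex^'d^'d"
  proof -
    have "opnorm A \<le> opnorm B + norm (A - B)" for A B :: "complex^'d^'d"
      using opnorm_add_le[of B "A - B"] opnorm_le_norm[of "A - B"] by simp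
    from this[of A B] this[of B A] show ?thesis by (simp add: norm_minus_commute)
  qed
  then show ?thesis
    unfolding continuous_on_iff dist_norm by (metis le_less_trans real_norm_def)
qed

lemma borel_measurable_opnorm [measurable]: "opnorm \<in> borel_measurable borel"
  by (rule borel_measurable_continuous_onI[OF continuous_on_opnorm])

lemma borel_measurable_matrix_mult [measurable (raw)]:
  fixes f g :: "'a \<Rightarrow> complex^'d^'d"
  assumes "f \<in> borel_measurable M" "g \<in> borel_measurable M"
  shows "(\<lambda>x. f x ** g x) \<in> borel_measurable M"
  by (rule borel_measurable_continuous_Pair[OF assms]) (intro continuous_intros)

lemma borel_measurable_matrix_vector [measurable (raw)]:
  fixes f :: "'a \<Rightarrow> complex^'d^'d" and g :: "'a \<Rightarrow> complex^'d"
  assumes "f \<in> borel_measurable M" "g \<in> borel_measurable M"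
  shows "(\<lambda>x. f x *v g x) \<in> borel_measurable M"
  by (rule borel_measurable_continuous_Pair[OF assms])
    (simp add: matrix_vector_mult_def, intro continuous_intros continuous_on_component)

lemma borel_measurable_matrix_poly:
  assumes [measurable]: "W \<in> borel_measurable M"
  shows "(\<lambda>x. matrix_poly a n (W x)) \<in> borel_measurable M"
proof -
  have [measurable]: "(\<lambda>x. (((**) (W x)) ^^ i) (mat 1)) \<in> borel_measurable M" for i
    by (induction i) simp_all
  show ?thesis unfolding matrix_poly_def by measurable
qed

lemma borel_measurable_matrix_weight:
  assumes "matrix_weight W"
  shows "W \<in> borel_measurable lebesgue"
proof -
  let ?f = "\<lambda>k x. indicator (cball 0 (real k)) x *\<^sub>R W x"
  have "?f k \<in> borel_measurable lebesgue" for k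
    using assms compact_cball[of "0 :: 'a" "real k"]
    unfolding matrix_weight_def set_integrable_def by (blast dest: borel_measurable_integrable)
  moreover have "(\<lambda>k. ?f k x) \<longlonglongrightarrow> W x" for x
  proof -
    obtain N :: nat where "norm x \<le> real N" using real_arch_simple by blast
    then have "\<forall>\<^sub>F k in sequentially. ?f k x = W x"
      by (intro eventually_sequentiallyI[of N]) auto
    then show ?thesis by (rule tendsto_eventually)
  qed
  ultimately show ?thesis by (rule borel_measurable_LIMSEQ_metric)
qed

text \<open>Lebesgue measure is complete, so every subset of the null set where \<open>f\<close> and
  \<open>g\<close> differ is measurable.\<close>

lemma borel_measurable_lebesgue_cong_AE:
  fixes f g :: "'a::euclidean_space \<Rightarrow> 'b::topological_space"
  assumes [measurable]: "f \<in> borel_measurable lebesgue" and ae: "AE x in lebesgue. f x = g x"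
  shows "g \<in> borel_measurable lebesgue"
proof (rule borel_measurableI)
  fix S :: "'b set" assume "open S"
  then have [measurable]: "S \<in> sets borel" by simp
  have ae': "AE x in lborel. f x = g x" using ae by (simp add: AE_completion_iff)
  have [measurable]: "Measurable.pred lebesgue (\<lambda>x. g x \<in> S \<and> f x \<notin> S)"
    "Measurable.pred lebesgue (\<lambda>x. f x \<in> S \<and> g x \<notin> S)"
    using ae' by (auto intro!: sets_completion_AE elim!: eventually_mono)
  have "Measurable.pred lebesgue
      (\<lambda>x. f x \<in> S \<and> \<not> (f x \<in> S \<and> g x \<notin> S) \<or> (g x \<in> S \<and> f x \<notin> S))"
    by measurable
  also have "(\<lambda>x. f x \<in> S \<and> \<not> (f x \<in> S \<and> g x \<notin> S) \<or> (g x \<in> S \<and> f x \<notin> S)) = (\<lambda>x. g x \<in> S)"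
    by auto
  finally show "g -` S \<inter> space lebesgue \<in> sets lebesgue"
    by (simp add: pred_def vimage_def Int_def)
qed

text \<open>A pointwise limit of polynomials in \<open>W x\<close>. Where \<open>W x\<close> fails
  to be positive definite the power has an unspecified value, hence the detour through a function
  that is 0 there.\<close>

lemma borel_measurable_matrix_powr:
  assumes "matrix_weight W"
  shows "(\<lambda>x. matrix_powr (W x) s) \<in> borel_measurable lebesgue"
proof -
  obtain a n where an: "\<forall>x>0. (\<lambda>k. \<Sum>i\<le>n k. a k i * x ^ i) \<longlonglongrightarrow> x powr s"
    using powr_pointwise_limit_of_polynomials[of s] by (elim exE)
  let ?f = "\<lambda>k x. if pos_def (W x) then matrix_poly (a k) (n k) (W x) else 0"
  have ae: "AE x in lebesgue. pos_def (W x)" using assms by (simp add: matrix_weight_def)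
  have "?f k \<in> borel_measurable lebesgue" for k
  proof -
    have "AE x in lebesgue. matrix_poly (a k) (n k) (W x) = ?f k x" using ae by eventually_elim simp
    moreover have "(\<lambda>x. matrix_poly (a k) (n k) (W x)) \<in> borel_measurable lebesgue"
      using borel_measurable_matrix_poly[OF borel_measurable_matrix_weight[OF assms]] .
    ultimately show ?thesis by (rule borel_measurable_lebesgue_cong_AE[rotated])
  qed
  moreover have "(\<lambda>k. ?f k x) \<longlonglongrightarrow> (if pos_def (W x) then matrix_powr (W x) s else 0)" for x
  proof (cases "pos_def (W x)")
    case True
    obtain P l where P: "conj_transpose P ** P = mat 1" "\<And>i. 0 < l i" "W x = conj_diag P l"
      using pos_def_conj_diag[OF True] by blast
    show ?thesis
      using True by (auto simp: P matrix_poly_conj_diag matrix_powr_conj_diag intro!: conj_diag_tendsto an[rule_format])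
  qed simp
  ultimately have "(\<lambda>x. if pos_def (W x) then matrix_powr (W x) s else 0) \<in> borel_measurable lebesgue"
    by (rule borel_measurable_LIMSEQ_metric)
  moreover have "AE x in lebesgue. (if pos_def (W x) then matrix_powr (W x) s else 0) = matrix_powr (W x) s"
    using ae by eventually_elim simp
  ultimately show ?thesis by (rule borel_measurable_lebesgue_cong_AE)
qed

section \<open>Hoelder's inequality and laminar families\<close>

text \<open>Young's inequality for \<open>f / A\<close> and \<open>g / B\<close>. Upper bounds take
  the place of the norms, so that real numbers can be used throughout; a bound equal to 0 cannot be
  divided by, but then that factor vanishes almost everywhere.\<close>

lemma nn_integral_Holder:
  fixes f g :: "'a \<Rightarrow> real"
  assumes pq: "1 < p" "1 < q" "1 / p + 1 / q = 1"
    and [measurable]: "f \<in> borel_measurable M" "g \<in> borel_measurable M"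
    and nonneg: "\<And>x. 0 \<le> f x" "\<And>x. 0 \<le> g x" "0 \<le> A" "0 \<le> B"
    and f: "(\<integral>\<^sup>+x. ennreal (f x powr p) \<partial>M) \<le> ennreal (A powr p)"
    and g: "(\<integral>\<^sup>+x. ennreal (g x powr q) \<partial>M) \<le> ennreal (B powr q)"
  shows "(\<integral>\<^sup>+x. ennreal (f x * g x) \<partial>M) \<le> ennreal (A * B)"
proof -
  have zero: "AE x in M. h x = 0"
    if "(\<integral>\<^sup>+x. ennreal (h x powr r) \<partial>M) \<le> ennreal (0 powr r)" "h \<in> borel_measurable M" for h :: "'a \<Rightarrow> real" and r
  proof -
    have [measurable]: "h \<in> borel_measurable M" by fact
    have "(\<integral>\<^sup>+x. ennreal (h x powr r) \<partial>M) = 0" using that by simp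
    then have "AE x in M. ennreal (h x powr r) = 0"
      by (subst (asm) nn_integral_0_iff_AE) auto
    then show ?thesis by eventually_elim (simp add: ennreal_eq_0_iff)
  qed
  show ?thesis
  proof (cases "A = 0 \<or> B = 0")
    case True
    then have "AE x in M. f x * g x = 0"
    proof
      assume "A = 0"
      with f zero[of f p] have "AE x in M. f x = 0" by simp
      then show ?thesis by eventually_elim simp
    next
      assume "B = 0"
      with g zero[of g q] have "AE x in M. g x = 0" by simp
      then show ?thesis by eventually_elim simp
    qed
    then have "(\<integral>\<^sup>+x. ennreal (f x * g x) \<partial>M) = (\<integral>\<^sup>+x. 0 \<partial>M)"
      by (intro nn_integral_cong_AE) (auto elim!: eventually_mono)
    then show ?thesis by simp
  next
    case False
    then have AB: "0 < A" "0 < B" using nonneg by auto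
    have young: "f x * g x \<le> A * B * (f x powr p / (p * A powr p) + g x powr q / (q * B powr q))" for x
    proof -
      have "(f x / A) * (g x / B) \<le> (f x / A) powr p / p + (g x / B) powr q / q"
        using pq AB nonneg by (intro Youngs_inequality) auto
      also have "\<dots> = f x powr p / (p * A powr p) + g x powr q / (q * B powr q)"
        using AB nonneg by (simp add: powr_divide mult.commute)
      finally show ?thesis using AB by (simp add: field_simps)
    qed
    have "(\<integral>\<^sup>+x. ennreal (f x * g x) \<partial>M) \<le>
        (\<integral>\<^sup>+x. ennreal (A * B / (p * A powr p)) * ennreal (f x powr p)
              + ennreal (A * B / (q * B powr q)) * ennreal (g x powr q) \<partial>M)"
    proof (intro nn_integral_mono)
      fix x
      have "ennreal (f x * g x) \<le> ennreal (A * B / (p * A powr p) * f x powr p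
          + A * B / (q * B powr q) * g x powr q)"
        using young[of x] by (intro ennreal_leI) (simp add: distrib_left mult.assoc)
      also have "\<dots> = ennreal (A * B / (p * A powr p)) * ennreal (f x powr p)
              + ennreal (A * B / (q * B powr q)) * ennreal (g x powr q)"
        using AB pq by (simp only: ennreal_plus ennreal_mult mult_nonneg_nonneg divide_nonneg_nonneg
            powr_ge_zero less_imp_le zero_le_one order.trans[OF zero_le_one])
      finally show "ennreal (f x * g x) \<le> \<dots>" .
    qed
    also have "\<dots> = ennreal (A * B / (p * A powr p)) * (\<integral>\<^sup>+x. ennreal (f x powr p) \<partial>M)
        + ennreal (A * B / (q * B powr q)) * (\<integral>\<^sup>+x. ennreal (g x powr q) \<partial>M)"
      by (simp add: nn_integral_add nn_integral_cmult)
    also have "\<dots> \<le> ennreal (A * B / (p * A powr p)) * ennreal (A powr p)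
        + ennreal (A * B / (q * B powr q)) * ennreal (B powr q)"
      by (intro add_mono mult_left_mono f g) auto
    also have "\<dots> = ennreal (A * B / (p * A powr p) * A powr p + A * B / (q * B powr q) * B powr q)"
      using AB pq by (simp only: ennreal_plus ennreal_mult mult_nonneg_nonneg divide_nonneg_nonneg
          powr_ge_zero less_imp_le zero_le_one order.trans[OF zero_le_one])
    also have "A * B / (p * A powr p) * A powr p + A * B / (q * B powr q) * B powr q = A * B * (1 / p + 1 / q)"
      using AB pq by (simp add: field_simps)
    finally show ?thesis using pq by simp
  qed
qed

section \<open>Laminar families: covering and stopping-time arguments\<close>

definition laminar :: "'a set set \<Rightarrow> bool" where
  "laminar \<Q> \<longleftrightarrow> (\<forall>Q\<in>\<Q>. \<forall>Q'\<in>\<Q>. Q \<subseteq> Q' \<or> Q' \<subseteq> Q \<or> Q \<inter> Q' = {})"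

lemma laminar_subset: "laminar \<Q> \<Longrightarrow> \<S> \<subseteq> \<Q> \<Longrightarrow> laminar \<S>"
  by (auto simp: laminar_def)

lemma laminar_maximal:
  assumes "finite \<S>" "laminar \<S>"
  shows "\<exists>\<M>\<subseteq>\<S>. disjoint \<M> \<and> (\<forall>S\<in>\<S>. \<exists>T\<in>\<M>. S \<subseteq> T)"
proof -
  define \<M> where "\<M> = {T\<in>\<S>. \<forall>S\<in>\<S>. T \<subseteq> S \<longrightarrow> S = T}"
  have "disjoint \<M>"
  proof (rule pairwiseI)
    fix S T assume "S \<in> \<M>" "T \<in> \<M>" "S \<noteq> T"
    moreover from this have "S \<subseteq> T \<or> T \<subseteq> S \<or> S \<inter> T = {}"
      using assms(2) by (auto simp: laminar_def \<M>_def)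
    ultimately show "disjnt S T" by (auto simp: \<M>_def disjnt_def)
  qed
  moreover have "\<exists>T\<in>\<M>. S \<subseteq> T" if "S \<in> \<S>" for S
    using finite_has_maximal2[OF assms(1) that] by (auto simp: \<M>_def)
  ultimately show ?thesis by (intro exI[of _ \<M>]) (auto simp: \<M>_def)
qed

lemma emeasure_Union_disjoint:
  assumes "finite \<S>" "disjoint \<S>" "\<S> \<subseteq> sets M"
  shows "emeasure M (\<Union>\<S>) = (\<Sum>S\<in>\<S>. emeasure M S)"
  using sum_emeasure[of "\<lambda>S. S" \<S> M] assms
  by (simp add: disjoint_family_on_def pairwise_def disjnt_def)

text \<open>The weak-type (1,1) bound of a one-parameter maximal function on the indicator of
  \<open>E\<close>: the maximal members are disjoint and still cover the union.\<close>

lemma laminar_density_union: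
  assumes "finite \<Q>" "laminar \<Q>" "\<Q> \<subseteq> sets M" "E \<in> sets M"
    and dens: "\<And>Q. Q \<in> \<Q> \<Longrightarrow> emeasure M Q \<le> c * emeasure M (E \<inter> Q)"
  shows "emeasure M (\<Union>\<Q>) \<le> c * emeasure M E"
proof -
  obtain \<M> where \<M>: "\<M> \<subseteq> \<Q>" "disjoint \<M>" "\<forall>S\<in>\<Q>. \<exists>T\<in>\<M>. S \<subseteq> T"
    using laminar_maximal[OF assms(1,2)] by blast
  have fin: "finite \<M>" using \<M>(1) assms(1) finite_subset by blast
  have "\<Union>\<Q> = \<Union>\<M>" using \<M> by blast
  then have "emeasure M (\<Union>\<Q>) = (\<Sum>S\<in>\<M>. emeasure M S)"
    using fin \<M> assms(3) by (subst emeasure_Union_disjoint[symmetric]) auto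
  also have "\<dots> \<le> (\<Sum>S\<in>\<M>. c * emeasure M (E \<inter> S))"
    using \<M>(1) by (intro sum_mono dens) auto
  also have "\<dots> = c * (\<Sum>S\<in>\<M>. emeasure M (E \<inter> S))" by (simp add: sum_distrib_left)
  also have "(\<Sum>S\<in>\<M>. emeasure M (E \<inter> S)) = emeasure M (\<Union>S\<in>\<M>. E \<inter> S)"
    using \<M> assms(3,4) fin
    by (intro sum_emeasure) (auto simp: disjoint_family_on_def pairwise_def disjnt_def)
  also have "\<dots> \<le> emeasure M E" using assms(4) by (intro emeasure_mono) auto
  finally show ?thesis by (simp add: mult_left_mono)
qed

text \<open>A stopping-time bound: \<open>stop Q S\<close> marks the sets \<open>S \<subseteq> Q\<close> on which \<open>y S * b S\<close> is no longer
  controlled by \<open>y Q * b Q\<close>; half of the weighted measure escapes the maximal stopping sets, so the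
  contributions of all generations sum up geometrically.\<close>

lemma stopping_maximal_bound:
  fixes b :: "'a set \<Rightarrow> 'a \<Rightarrow> ennreal" and y :: "'a set \<Rightarrow> ennreal"
  assumes fin: "finite \<Q>" and lam: "laminar \<Q>" and sets: "\<Q> \<subseteq> sets M"
    and meas: "\<And>Q. Q \<in> \<Q> \<Longrightarrow> b Q \<in> borel_measurable M"
    and int: "\<And>Q. Q \<in> \<Q> \<Longrightarrow> (\<integral>\<^sup>+x\<in>Q. b Q x \<partial>M) \<le> C * emeasure M Q"
    and good: "\<And>Q S x. Q \<in> \<Q> \<Longrightarrow> S \<in> \<Q> \<Longrightarrow> S \<subseteq> Q \<Longrightarrow> \<not> stop Q S \<Longrightarrow> x \<in> S \<Longrightarrow>
      y S * b S x \<le> L * (y Q * b Q x)"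
    and irrefl: "\<And>Q. Q \<in> \<Q> \<Longrightarrow> \<not> stop Q Q"
    and small: "\<And>Q \<S>. Q \<in> \<Q> \<Longrightarrow> \<S> \<subseteq> \<Q> \<Longrightarrow> disjoint \<S> \<Longrightarrow>
      (\<And>S. S \<in> \<S> \<Longrightarrow> S \<subseteq> Q \<and> stop Q S) \<Longrightarrow>
      2 * (\<Sum>S\<in>\<S>. y S * emeasure M S) \<le> y Q * emeasure M Q"
    and Q0: "Q0 \<in> \<Q>"
  shows "(\<integral>\<^sup>+x. (SUP Q\<in>{Q\<in>\<Q>. Q \<subseteq> Q0}. indicator Q x * (y Q * b Q x)) \<partial>M)
    \<le> 2 * L * C * (y Q0 * emeasure M Q0)"
proof -
  define F where "F Q0 x = (SUP Q\<in>{Q\<in>\<Q>. Q \<subseteq> Q0}. indicator Q x * (y Q * b Q x))" for Q0 x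
  have [measurable]: "b Q \<in> borel_measurable M" "Q \<in> sets M" if "Q \<in> \<Q>" for Q
    using that meas sets by auto
  have F_meas: "F Q0 \<in> borel_measurable M" for Q0
  proof -
    have "(\<lambda>x. SUP Q\<in>{Q\<in>\<Q>. Q \<subseteq> Q0}. indicator Q x * (y Q * b Q x)) \<in> borel_measurable M"
      by (intro borel_measurable_SUP countable_finite) (auto simp: fin)
    then show ?thesis by (simp add: F_def[abs_def])
  qed
  show ?thesis
    unfolding F_def[symmetric] using Q0
  proof (induction "card {Q\<in>\<Q>. Q \<subset> Q0}" arbitrary: Q0 rule: less_induct)
    case less
    note Q0 = \<open>Q0 \<in> \<Q>\<close>
    let ?T = "{S\<in>\<Q>. S \<subseteq> Q0 \<and> stop Q0 S}"
    obtain \<S> where \<S>: "\<S> \<subseteq> ?T" "disjoint \<S>" "\<forall>S\<in>?T. \<exists>T\<in>\<S>. S \<subseteq> T"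
      using laminar_maximal[of ?T] laminar_subset[OF lam, of ?T] fin by auto
    have finS: "finite \<S>" using \<S>(1) fin by (auto intro: finite_subset)
    \<comment> \<open>A set marked by \<open>stop Q0\<close> lies inside a maximal marked one and is
      counted in its \<open>F\<close>; the others are controlled on the spot by \<open>Q0\<close>
      itself.\<close>
    have pt: "F Q0 x \<le> L * (y Q0 * (b Q0 x * indicator Q0 x)) + (\<Sum>S\<in>\<S>. F S x)" for x
      unfolding F_def[of Q0]
    proof (rule SUP_least)
      fix Q assume "Q \<in> {Q \<in> \<Q>. Q \<subseteq> Q0}"
      then have Q: "Q \<in> \<Q>" "Q \<subseteq> Q0" by auto
      show "indicator Q x * (y Q * b Q x) \<le> L * (y Q0 * (b Q0 x * indicator Q0 x)) + (\<Sum>S\<in>\<S>. F S x)"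
      proof (cases "stop Q0 Q")
        case True
        then obtain S where S: "S \<in> \<S>" "Q \<subseteq> S" using \<S>(3) Q by blast
        have "indicator Q x * (y Q * b Q x) \<le> F S x"
          unfolding F_def by (rule SUP_upper) (use Q S in auto)
        also have "\<dots> \<le> (\<Sum>S\<in>\<S>. F S x)" using S finS by (intro member_le_sum) auto
        finally show ?thesis by (simp add: add_increasing)
      next
        case False
        show ?thesis
        proof (cases "x \<in> Q")
          case True
          then have "x \<in> Q0" using Q by auto
          then show ?thesis
            using good[OF Q0 Q False True] True by (simp add: add_increasing2)
        qed simp
      qed
    qed
    have IH: "(\<integral>\<^sup>+x. F S x \<partial>M) \<le> 2 * L * C * (y S * emeasure M S)" if "S \<in> \<S>" for S
    proof (rule less(1))
      have S: "S \<in> \<Q>" "S \<subseteq> Q0" "stop Q0 S" using that \<S>(1) by auto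
      then have "S \<subset> Q0" using irrefl Q0 by auto
      then show "card {Q\<in>\<Q>. Q \<subset> S} < card {Q\<in>\<Q>. Q \<subset> Q0}"
        using S fin by (intro psubset_card_mono) auto
      show "S \<in> \<Q>" by fact
    qed
    have "(\<integral>\<^sup>+x. F Q0 x \<partial>M) \<le> (\<integral>\<^sup>+x. L * (y Q0 * (b Q0 x * indicator Q0 x)) + (\<Sum>S\<in>\<S>. F S x) \<partial>M)"
      by (intro nn_integral_mono pt)
    also have "\<dots> = L * (y Q0 * (\<integral>\<^sup>+x\<in>Q0. b Q0 x \<partial>M)) + (\<Sum>S\<in>\<S>. \<integral>\<^sup>+x. F S x \<partial>M)"
      using Q0 F_meas by (simp add: nn_integral_add nn_integral_cmult nn_integral_sum)
    also have "\<dots> \<le> L * (y Q0 * (C * emeasure M Q0)) + (\<Sum>S\<in>\<S>. 2 * L * C * (y S * emeasure M S))"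
      by (intro add_mono mult_left_mono sum_mono int IH Q0) auto
    \<comment> \<open>The factor 2 in \<open>small\<close> makes the claim reproduce itself: all
      later generations together cost no more than the top one.\<close>
    also have "\<dots> = L * C * (y Q0 * emeasure M Q0) + L * C * (2 * (\<Sum>S\<in>\<S>. y S * emeasure M S))"
      by (simp add: sum_distrib_left mult_ac)
    also have "\<dots> \<le> L * C * (y Q0 * emeasure M Q0) + L * C * (y Q0 * emeasure M Q0)"
      using \<S>(1,2) by (intro add_mono mult_left_mono small Q0) auto
    also have "\<dots> = 2 * L * C * (y Q0 * emeasure M Q0)"
      by (simp add: mult_2 distrib_right mult.assoc)
    finally show ?case .
  qed
qed

text \<open>The maximal members are disjoint, so the bounds for the single tops add up to what
  \<open>total\<close> controls.\<close>

lemma stopping_maximal_bound_union: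
  fixes b :: "'a set \<Rightarrow> 'a \<Rightarrow> ennreal" and y :: "'a set \<Rightarrow> ennreal"
  assumes fin: "finite \<Q>" and lam: "laminar \<Q>" and sets: "\<Q> \<subseteq> sets M"
    and meas: "\<And>Q. Q \<in> \<Q> \<Longrightarrow> b Q \<in> borel_measurable M"
    and int: "\<And>Q. Q \<in> \<Q> \<Longrightarrow> (\<integral>\<^sup>+x\<in>Q. b Q x \<partial>M) \<le> C * emeasure M Q"
    and good: "\<And>Q S x. Q \<in> \<Q> \<Longrightarrow> S \<in> \<Q> \<Longrightarrow> S \<subseteq> Q \<Longrightarrow> \<not> stop Q S \<Longrightarrow> x \<in> S \<Longrightarrow>
      y S * b S x \<le> L * (y Q * b Q x)"
    and irrefl: "\<And>Q. Q \<in> \<Q> \<Longrightarrow> \<not> stop Q Q"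
    and small: "\<And>Q \<S>. Q \<in> \<Q> \<Longrightarrow> \<S> \<subseteq> \<Q> \<Longrightarrow> disjoint \<S> \<Longrightarrow>
      (\<And>S. S \<in> \<S> \<Longrightarrow> S \<subseteq> Q \<and> stop Q S) \<Longrightarrow>
      2 * (\<Sum>S\<in>\<S>. y S * emeasure M S) \<le> y Q * emeasure M Q"
    and total: "\<And>\<S>. \<S> \<subseteq> \<Q> \<Longrightarrow> disjoint \<S> \<Longrightarrow> (\<Sum>S\<in>\<S>. y S * emeasure M S) \<le> A"
  shows "(\<integral>\<^sup>+x. (SUP Q\<in>\<Q>. indicator Q x * (y Q * b Q x)) \<partial>M) \<le> 2 * L * C * A"
proof -
  have [measurable]: "b Q \<in> borel_measurable M" "Q \<in> sets M" if "Q \<in> \<Q>" for Q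
    using that meas sets by auto
  obtain \<M> where \<M>: "\<M> \<subseteq> \<Q>" "disjoint \<M>" "\<forall>S\<in>\<Q>. \<exists>T\<in>\<M>. S \<subseteq> T"
    using laminar_maximal[OF fin lam] by blast
  have finM: "finite \<M>" using \<M>(1) fin finite_subset by blast
  let ?F = "\<lambda>Q0 x. SUP Q\<in>{Q\<in>\<Q>. Q \<subseteq> Q0}. indicator Q x * (y Q * b Q x)"
  have "(\<integral>\<^sup>+x. (SUP Q\<in>\<Q>. indicator Q x * (y Q * b Q x)) \<partial>M) \<le> (\<integral>\<^sup>+x. (\<Sum>Q0\<in>\<M>. ?F Q0 x) \<partial>M)"
  proof (intro nn_integral_mono SUP_least)
    fix x Q assume Q: "Q \<in> \<Q>"
    then obtain T where T: "T \<in> \<M>" "Q \<subseteq> T" using \<M>(3) by blast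
    have "indicator Q x * (y Q * b Q x) \<le> ?F T x" by (rule SUP_upper) (use Q T in auto)
    also have "\<dots> \<le> (\<Sum>Q0\<in>\<M>. ?F Q0 x)"
      using T finM by (intro member_le_sum[of T \<M> "\<lambda>Q0. ?F Q0 x"]) auto
    finally show "indicator Q x * (y Q * b Q x) \<le> (\<Sum>Q0\<in>\<M>. ?F Q0 x)" .
  qed
  also have "\<dots> = (\<Sum>Q0\<in>\<M>. \<integral>\<^sup>+x. ?F Q0 x \<partial>M)"
    by (intro nn_integral_sum borel_measurable_SUP countable_finite) (auto simp: fin)
  also have "\<dots> \<le> (\<Sum>Q0\<in>\<M>. 2 * L * C * (y Q0 * emeasure M Q0))"
    using \<M>(1) by (intro sum_mono stopping_maximal_bound[where stop = stop] fin lam sets meas int good irrefl small) auto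
  also have "\<dots> = 2 * L * C * (\<Sum>Q0\<in>\<M>. y Q0 * emeasure M Q0)" by (simp add: sum_distrib_left)
  also have "\<dots> \<le> 2 * L * C * A" by (intro mult_left_mono total \<M>) auto
  finally show ?thesis .
qed

section \<open>Dyadic cubes and rectangles\<close>

lemma half_open_cube_sandwich:
  "box a (a + (\<chi> i. r)) \<subseteq> half_open_cube a r" "half_open_cube a r \<subseteq> cbox a (a + (\<chi> i. r))"
  by (auto simp: half_open_cube_def mem_box_cart less_imp_le)

lemma half_open_cube_borel [measurable]: "half_open_cube a r \<in> sets borel"
proof -
  have "half_open_cube a r = (\<Inter>i. {x. a $ i \<le> x $ i} \<inter> {x. x $ i < a $ i + r})"
    by (auto simp: half_open_cube_def)
  also have "\<dots> \<in> sets borel"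
    by (intro sets.countable_INT'' sets.Int borel_closed borel_open closed_halfspace_component_ge_cart
        open_halfspace_component_lt_cart countable_finite) auto
  finally show ?thesis .
qed

lemma emeasure_half_open_cube:
  fixes a :: "real^'n"
  assumes "0 < r"
  shows "emeasure lborel (half_open_cube a r) = ennreal (r ^ CARD('n))"
proof -
  have le: "a \<bullet> b \<le> (a + (\<chi> i. r)) \<bullet> b" "(a + (\<chi> i. r) - a) \<bullet> b = r" if "b \<in> Basis" for b :: "real^'n"
    using that assms by (auto simp: Basis_vec_def inner_axis inner_add_left)
  have "(\<Prod>b\<in>(Basis :: (real^'n) set). (a + (\<chi> i. r) - a) \<bullet> b) = r ^ CARD('n)"
    using le(2) by (subst prod.cong[OF refl, of _ _ "\<lambda>_. r"]) auto
  then have "emeasure lborel (box a (a + (\<chi> i. r))) = ennreal (r ^ CARD('n))"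
    "emeasure lborel (cbox a (a + (\<chi> i. r))) = ennreal (r ^ CARD('n))"
    using emeasure_lborel_box[of a "a + (\<chi> i. r)"] emeasure_lborel_cbox[of a "a + (\<chi> i. r)"] le(1)
    by simp_all
  then show ?thesis
    using emeasure_mono[OF half_open_cube_sandwich(1)[of a r], of lborel]
      emeasure_mono[OF half_open_cube_sandwich(2)[of a r], of lborel]
    by (intro antisym) auto
qed

lemma half_open_cube_scale_le:
  fixes a b :: "real^'n"
  assumes sub: "half_open_cube a r \<subseteq> half_open_cube b s" and "0 < s" "s \<le> r"
  shows "half_open_cube b s = half_open_cube a r"
proof -
  have "a \<in> half_open_cube a r" using assms by (auto simp: half_open_cube_def)
  then have a: "b $ i \<le> a $ i" for i using sub by (auto simp: half_open_cube_def)
  have "a $ i = b $ i \<and> r = s" for i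
  proof (rule ccontr)
    assume neq: "\<not> (a $ i = b $ i \<and> r = s)"
    have lt: "b $ i + s < a $ i + r"
      using neq a[of i] assms(3) by (cases "a $ i = b $ i") auto
    \<comment> \<open>Moving the corner \<open>a\<close> by \<open>t\<close> along the diagonal
      stays inside the first cube, but the \<open>i\<close>-th coordinate reaches
      \<open>b $ i + s\<close>, which the half-open second cube excludes.\<close>
    define t where "t = max 0 (b $ i + s - a $ i)"
    have t: "0 \<le> t" "t < r" using lt assms by (auto simp: t_def)
    then have "(\<chi> j. a $ j + t) \<in> half_open_cube a r" by (auto simp: half_open_cube_def)
    then have "a $ i + t < b $ i + s" using sub by (fastforce simp: half_open_cube_def)
    then show False by (auto simp: t_def)
  qed
  then show ?thesis by (simp add: half_open_cube_def)
qed

lemma dyadic_grid_cube: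
  assumes "dyadic_grid D" "Q \<in> D"
  shows "\<exists>a (k :: int). Q = half_open_cube a (2 powi k)"
  using assms unfolding dyadic_grid_def by blast

lemma dyadic_grid_borel: "dyadic_grid D \<Longrightarrow> Q \<in> D \<Longrightarrow> Q \<in> sets borel"
  using dyadic_grid_cube[of D Q] by auto

lemma dyadic_grid_emeasure:
  fixes D :: "(real^'n) set set"
  assumes "dyadic_grid D" "Q \<in> D"
  shows "0 < measure lborel Q" "emeasure lborel Q = ennreal (measure lborel Q)"
proof -
  obtain a and k :: int where Q: "Q = half_open_cube a (2 powi k)"
    using dyadic_grid_cube[OF assms] by auto
  have pos: "0 < (2 powi k :: real)" by simp
  have e: "emeasure lborel Q = ennreal ((2 powi k) ^ CARD('n))"
    unfolding Q by (rule emeasure_half_open_cube[OF pos])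
  then have "measure lborel Q = (2 powi k) ^ CARD('n)" by (simp add: measure_def)
  then show "0 < measure lborel Q" "emeasure lborel Q = ennreal (measure lborel Q)"
    using e pos by simp_all
qed

lemma dyadic_grid_nonempty: "dyadic_grid D \<Longrightarrow> Q \<in> D \<Longrightarrow> Q \<noteq> {}"
  using dyadic_grid_emeasure(1)[of D Q] by auto

lemma dyadic_grid_laminar: "dyadic_grid D \<Longrightarrow> laminar D"
  unfolding dyadic_grid_def laminar_def by blast

lemma dyadic_grid_countable:
  fixes D :: "(real^'n) set set"
  assumes "dyadic_grid D"
  shows "countable D"
proof -
  let ?A = "\<lambda>k::int. {Q\<in>D. \<exists>a. Q = half_open_cube a (2 powi k)}"
  have "countable (?A k)" for k
  proof (rule countable_disjoint_nonempty_interior_subsets)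
    show "disjoint (?A k)"
      using assms unfolding dyadic_grid_def by (intro partition_onD2[of UNIV]) simp
  next
    fix Q assume "Q \<in> ?A k" "interior Q = {}"
    then obtain a where Q: "Q = half_open_cube a (2 powi k)" by auto
    have "box a (a + (\<chi> i. 2 powi k)) \<subseteq> interior Q"
      unfolding Q by (rule interior_maximal[OF half_open_cube_sandwich(1) open_box])
    moreover have "a + (\<chi> i. 2 powi k / 2) \<in> box a (a + (\<chi> i. 2 powi k))"
      by (simp add: mem_box_cart)
    ultimately show "Q = {}" using \<open>interior Q = {}\<close> by auto
  qed
  moreover have "D = (\<Union>k. ?A k)"
    using dyadic_grid_cube[OF assms] by (simp add: set_eq_iff) blast
  ultimately show ?thesis
    using countable_UN[of UNIV ?A] by simp
qed

text \<open>All cubes of one small generation \<open>m\<close> tile the space. One that meets a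
  member of \<open>\<G>\<close> is nested with it, and as it is not longer it lies inside; comparing
  volumes shows that only finitely many fit.\<close>

lemma dyadic_grid_common_refinement:
  fixes D :: "(real^'n) set set"
  assumes grid: "dyadic_grid D" and fin: "finite \<G>" and sub: "\<G> \<subseteq> D"
  shows "\<exists>\<A>\<subseteq>D. finite \<A> \<and> disjoint \<A> \<and> (\<forall>Q\<in>\<G>. \<Union>{I\<in>\<A>. I \<subseteq> Q} = Q)"
proof -
  have "\<forall>Q\<in>D. \<exists>a (k :: int). Q = half_open_cube a (2 powi k)"
    using dyadic_grid_cube[OF grid] by simp
  then obtain a k where cube: "\<forall>Q\<in>D. Q = half_open_cube (a Q) (2 powi (k Q :: int))"
    unfolding bchoice_iff by (elim exE)
  \<comment> \<open>The inserted 0 gives \<open>Min\<close> a value for empty \<open>\<G>\<close>;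
    otherwise it can only make the generation finer.\<close>
  define m where "m = Min (insert 0 (k ` \<G>))"
  have m: "m \<le> k Q" if "Q \<in> \<G>" for Q using that fin by (simp add: m_def)
  define A where "A = {Q\<in>D. \<exists>a. Q = half_open_cube a (2 powi m)}"
  have part: "partition_on UNIV A" using grid unfolding dyadic_grid_def A_def by simp
  then have disjA: "disjoint A" and unA: "\<Union>A = UNIV" by (auto simp: partition_on_def)
  have nested: "I \<subseteq> Q" if IQ: "I \<in> A" "Q \<in> \<G>" "I \<inter> Q \<noteq> {}" for I Q
  proof -
    obtain b where I: "I = half_open_cube b (2 powi m)" using IQ(1) by (auto simp: A_def)
    have "I \<subseteq> Q \<or> Q \<subseteq> I"
      using IQ sub dyadic_grid_laminar[OF grid] by (auto simp: laminar_def A_def)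
    moreover have "I = Q" if "Q \<subseteq> I"
    proof -
      have "Q = half_open_cube (a Q) (2 powi (k Q))" using cube sub \<open>Q \<in> \<G>\<close> by auto
      moreover have "(2 powi m :: real) \<le> 2 powi (k Q)"
        using m[OF \<open>Q \<in> \<G>\<close>] by (intro power_int_increasing) auto
      ultimately show ?thesis
        using that I half_open_cube_scale_le[of "a Q" "2 powi (k Q)" b "2 powi m"] by simp
    qed
    ultimately show ?thesis by blast
  qed
  have fin1: "finite {I\<in>A. I \<subseteq> Q}" if Q: "Q \<in> \<G>" for Q
  proof -
    let ?c = "(2 powi m :: real) ^ CARD('n)"
    have QD: "Q \<in> D" using Q sub by blast
    have c: "0 < ?c" by simp
    have "card T \<le> nat \<lceil>measure lborel Q / ?c\<rceil>" if T: "T \<subseteq> {I\<in>A. I \<subseteq> Q}" "finite T" for T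
    proof -
      have meas: "T \<subseteq> sets lborel"
        using T(1) dyadic_grid_borel[OF grid] by (auto simp: A_def)
      have "ennreal (real (card T) * ?c) = (\<Sum>I\<in>T. ennreal ?c)"
        by (simp add: ennreal_mult ennreal_of_nat_eq_real_of_nat)
      also have "\<dots> = (\<Sum>I\<in>T. emeasure lborel I)"
      proof (rule sum.cong)
        fix I assume "I \<in> T"
        then obtain b where "I = half_open_cube b (2 powi m)" using T(1) by (auto simp: A_def)
        then show "ennreal ?c = emeasure lborel I"
          using emeasure_half_open_cube[of "2 powi m" b] by simp
      qed simp
      also have "\<dots> = emeasure lborel (\<Union>T)"
        using T meas disjA by (intro emeasure_Union_disjoint[symmetric]) (auto intro: pairwise_subset)
      also have "\<dots> \<le> emeasure lborel Q"
        using T(1) dyadic_grid_borel[OF grid QD] by (intro emeasure_mono) auto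
      also have "\<dots> = ennreal (measure lborel Q)" by (rule dyadic_grid_emeasure[OF grid QD])
      finally have "real (card T) * ?c \<le> measure lborel Q" by simp
      then have "real (card T) \<le> measure lborel Q / ?c" using c by (simp add: pos_le_divide_eq)
      then show ?thesis by linarith
    qed
    then show ?thesis by (meson finite_if_finite_subsets_card_bdd)
  qed
  define \<A> where "\<A> = (\<Union>Q\<in>\<G>. {I\<in>A. I \<subseteq> Q})"
  have "\<Union>{I\<in>\<A>. I \<subseteq> Q} = Q" if "Q \<in> \<G>" for Q
  proof (intro equalityI subsetI)
    fix x assume x: "x \<in> Q"
    obtain I where "I \<in> A" "x \<in> I" using unA by blast
    then show "x \<in> \<Union>{I\<in>\<A>. I \<subseteq> Q}"
      using nested[of I Q] x that by (auto simp: \<A>_def)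
  qed auto
  moreover have "finite \<A>" using fin fin1 by (auto simp: \<A>_def)
  moreover have "disjoint \<A>" using disjA by (rule pairwise_subset) (auto simp: \<A>_def)
  moreover have "\<A> \<subseteq> D" by (auto simp: \<A>_def A_def)
  ultimately show ?thesis by (intro exI[of _ \<A>]) auto
qed

lemma emeasure_lebesgue_Times:
  fixes A :: "'a::euclidean_space set" and B :: "'b::euclidean_space set"
  assumes "A \<in> sets borel" "B \<in> sets borel"
  shows "A \<times> B \<in> sets borel" "emeasure lebesgue (A \<times> B) = emeasure lborel A * emeasure lborel B"
proof -
  have "A \<times> B \<in> sets (lborel \<Otimes>\<^sub>M lborel)" using assms by (intro pair_measureI) simp_all
  then show 1: "A \<times> B \<in> sets borel" by (simp only: lborel_prod sets_lborel)
  have "emeasure lebesgue (A \<times> B) = emeasure (lborel \<Otimes>\<^sub>M lborel) (A \<times> B)"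
    using 1 by (simp add: lborel_prod)
  also have "\<dots> = emeasure lborel A * emeasure lborel B"
    using assms by (intro lborel.emeasure_pair_measure_Times) auto
  finally show "emeasure lebesgue (A \<times> B) = emeasure lborel A * emeasure lborel B" .
qed

lemma rects_countable: "dyadic_grid D1 \<Longrightarrow> dyadic_grid D2 \<Longrightarrow> countable (rects D1 D2)"
proof -
  assume "dyadic_grid D1" "dyadic_grid D2"
  then have "countable ((\<lambda>(A, B). A \<times> B) ` (D1 \<times> D2))" by (simp add: dyadic_grid_countable)
  then show ?thesis by (rule countable_subset[rotated]) (auto simp: rects_def)
qed

lemma rect_emeasure_Times:
  assumes "dyadic_grid D1" "dyadic_grid D2" "Q1 \<in> D1" "Q2 \<in> D2"
  shows "emeasure lebesgue (Q1 \<times> Q2) = emeasure lborel Q1 * emeasure lborel Q2"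
  using assms by (intro emeasure_lebesgue_Times(2) dyadic_grid_borel)

lemma rect_emeasure:
  assumes "dyadic_grid D1" "dyadic_grid D2" "R \<in> rects D1 D2"
  shows "R \<in> sets lebesgue" "0 < measure lebesgue R" "emeasure lebesgue R = ennreal (measure lebesgue R)"
proof -
  obtain A B where R: "R = A \<times> B" "A \<in> D1" "B \<in> D2" using assms by (auto simp: rects_def)
  have AB: "A \<in> sets borel" "B \<in> sets borel"
    using R assms dyadic_grid_borel by blast+
  have pos: "0 < measure lborel A" "0 < measure lborel B"
    using R assms dyadic_grid_emeasure(1) by blast+
  have e: "emeasure lebesgue R = ennreal (measure lborel A * measure lborel B)"
    unfolding R emeasure_lebesgue_Times(2)[OF AB]
    using dyadic_grid_emeasure(2)[OF assms(1) R(2)] dyadic_grid_emeasure(2)[OF assms(2) R(3)] pos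
    by (simp add: ennreal_mult)
  have m: "measure lebesgue R = measure lborel A * measure lborel B"
    unfolding measure_def[of lebesgue] e using pos by simp
  show "emeasure lebesgue R = ennreal (measure lebesgue R)" "0 < measure lebesgue R"
    using e m pos by simp_all
  show "R \<in> sets lebesgue" using emeasure_lebesgue_Times(1)[OF AB] by (simp add: R(1))
qed

text \<open>General rectangles are not laminar. With one side confined to a disjoint family, two
  rectangles are disjoint or share that side, and then the other sides decide. All two-parameter
  arguments below are reduced to this situation.\<close>

lemma laminar_Times:
  assumes "laminar \<Q>" "disjoint \<A>"
  shows "laminar ((\<lambda>(Q, P). Q \<times> P) ` (\<Q> \<times> \<A>))" "laminar ((\<lambda>(P, Q). P \<times> Q) ` (\<A> \<times> \<Q>))"
proof -
  have A: "P = P' \<or> P \<inter> P' = {}" if "P \<in> \<A>" "P' \<in> \<A>" for P P'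
    using that assms(2) by (auto simp: pairwise_def disjnt_def)
  have Q: "Q \<subseteq> Q' \<or> Q' \<subseteq> Q \<or> Q \<inter> Q' = {}" if "Q \<in> \<Q>" "Q' \<in> \<Q>" for Q Q'
    using that assms(1) by (auto simp: laminar_def)
  have "Q \<times> P \<subseteq> Q' \<times> P' \<or> Q' \<times> P' \<subseteq> Q \<times> P \<or> Q \<times> P \<inter> Q' \<times> P' = {}"
    and "P \<times> Q \<subseteq> P' \<times> Q' \<or> P' \<times> Q' \<subseteq> P \<times> Q \<or> P \<times> Q \<inter> P' \<times> Q' = {}"
    if "Q \<in> \<Q>" "P \<in> \<A>" "Q' \<in> \<Q>" "P' \<in> \<A>" for P P' Q Q'
    using A[OF that(2,4)] Q[OF that(1,3)] by auto
  then show "laminar ((\<lambda>(Q, P). Q \<times> P) ` (\<Q> \<times> \<A>))" "laminar ((\<lambda>(P, Q). P \<times> Q) ` (\<A> \<times> \<Q>))"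
    unfolding laminar_def by simp_all
qed

section \<open>Rectangles of a product grid, their rows and columns\<close>

locale dyadic_grids =
  fixes D1 :: "(real^'n) set set" and D2 :: "(real^'m) set set"
  assumes grid1: "dyadic_grid D1" and grid2: "dyadic_grid D2"
begin

lemma rect_facts:
  assumes "R \<in> rects D1 D2"
  shows "R \<in> sets lebesgue" "0 < measure lebesgue R" "emeasure lebesgue R = ennreal (measure lebesgue R)"
    "emeasure lebesgue R \<noteq> 0" "emeasure lebesgue R \<noteq> top"
  using rect_emeasure[OF grid1 grid2 assms] by auto

lemmas times_emeasure = rect_emeasure_Times[OF grid1 grid2]

lemma rectsI: "Q1 \<in> D1 \<Longrightarrow> Q2 \<in> D2 \<Longrightarrow> Q1 \<times> Q2 \<in> rects D1 D2"
  by (auto simp: rects_def)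

lemma side_emeasure:
  "Q \<in> D1 \<Longrightarrow> emeasure lborel Q \<noteq> 0 \<and> emeasure lborel Q \<noteq> top"
  "P \<in> D2 \<Longrightarrow> emeasure lborel P \<noteq> 0 \<and> emeasure lborel P \<noteq> top"
  using dyadic_grid_emeasure[OF grid1, of Q] dyadic_grid_emeasure[OF grid2, of P] by auto

lemma common_refinement:
  assumes "finite G" "G \<subseteq> D1 \<times> D2"
  shows "\<exists>A1 A2. A1 \<subseteq> D1 \<and> A2 \<subseteq> D2 \<and> finite A1 \<and> finite A2 \<and> disjoint A1 \<and> disjoint A2 \<and>
    (\<forall>(Q1, Q2)\<in>G. \<Union>{I\<in>A1. I \<subseteq> Q1} = Q1 \<and> \<Union>{P\<in>A2. P \<subseteq> Q2} = Q2)"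
proof -
  have "finite (fst ` G)" "fst ` G \<subseteq> D1" "finite (snd ` G)" "snd ` G \<subseteq> D2"
    using assms by auto
  from dyadic_grid_common_refinement[OF grid1 this(1,2)]
    dyadic_grid_common_refinement[OF grid2 this(3,4)]
  obtain A1 A2 where "A1 \<subseteq> D1" "A2 \<subseteq> D2" "finite A1" "finite A2" "disjoint A1" "disjoint A2"
    "\<forall>Q\<in>fst ` G. \<Union>{I\<in>A1. I \<subseteq> Q} = Q" "\<forall>Q\<in>snd ` G. \<Union>{P\<in>A2. P \<subseteq> Q} = Q"
    by (elim exE conjE)
  then show ?thesis by (intro exI[of _ A1] exI[of _ A2]) force
qed

lemma sum_pieces:
  assumes "disjoint A2" "finite A2" "A2 \<subseteq> D2" "\<Union>{P\<in>A2. P \<subseteq> Q2} = Q2"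
  shows "emeasure lborel Q2 = (\<Sum>P\<in>{P\<in>A2. P \<subseteq> Q2}. emeasure lborel P)"
proof -
  have "emeasure lborel Q2 = emeasure lborel (\<Union>{P\<in>A2. P \<subseteq> Q2})" by (simp only: assms(4))
  also have "\<dots> = (\<Sum>P\<in>{P\<in>A2. P \<subseteq> Q2}. emeasure lborel P)"
    using assms(1-3) dyadic_grid_borel[OF grid2]
    by (intro emeasure_Union_disjoint) (auto intro: pairwise_subset)
  finally show ?thesis .
qed

text \<open>Cubes are nonempty, so a rectangle determines its sides as its two projections.\<close>

lemma finite_pairs_of_rects:
  assumes "finite F"
  shows "finite {(Q1, Q2)\<in>D1 \<times> D2. Q1 \<times> Q2 \<in> F}"
proof (rule finite_subset)
  show "{(Q1, Q2)\<in>D1 \<times> D2. Q1 \<times> Q2 \<in> F} \<subseteq> (\<lambda>R. (fst ` R, snd ` R)) ` F"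
  proof
    fix z assume "z \<in> {(Q1, Q2)\<in>D1 \<times> D2. Q1 \<times> Q2 \<in> F}"
    then obtain Q1 Q2 where z: "z = (Q1, Q2)" "Q1 \<in> D1" "Q2 \<in> D2" "Q1 \<times> Q2 \<in> F" by auto
    then have "Q1 \<noteq> {}" "Q2 \<noteq> {}"
      using dyadic_grid_nonempty[OF grid1] dyadic_grid_nonempty[OF grid2] by auto
    then have "z = (\<lambda>R. (fst ` R, snd ` R)) (Q1 \<times> Q2)"
      using z(1) by (simp add: fst_image_times snd_image_times)
    then show "z \<in> (\<lambda>R. (fst ` R, snd ` R)) ` F" using z(4) by (rule image_eqI)
  qed
qed (use assms in simp)

text \<open>Whole first sides are crossed with small pieces of the second sides. For a disjoint
  \<open>A\<close> the family becomes laminar; \<open>columns\<close> exchanges the roles of the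
  sides.\<close>

definition rows :: "((real^'n) set \<times> (real^'m) set) set \<Rightarrow> (real^'m) set set \<Rightarrow> ('n, 'm) rect set" where
  "rows G A = (\<lambda>(Q1, P). Q1 \<times> P) ` {(Q1, P)\<in>fst ` G \<times> A. \<exists>Q2. (Q1, Q2) \<in> G \<and> P \<subseteq> Q2}"

definition columns :: "((real^'n) set \<times> (real^'m) set) set \<Rightarrow> (real^'n) set set \<Rightarrow> ('n, 'm) rect set" where
  "columns G A = (\<lambda>(I, Q2). I \<times> Q2) ` {(I, Q2)\<in>A \<times> snd ` G. \<exists>Q1. (Q1, Q2) \<in> G \<and> I \<subseteq> Q1}"

lemma rowsI:
  assumes "(Q1, Q2) \<in> G" "P \<in> A" "P \<subseteq> Q2"
  shows "Q1 \<times> P \<in> rows G A"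
proof -
  have "Q1 \<in> fst ` G" using assms(1) by (rule image_eqI[rotated]) simp
  then have "(Q1, P) \<in> {(Q1, P)\<in>fst ` G \<times> A. \<exists>Q2. (Q1, Q2) \<in> G \<and> P \<subseteq> Q2}" using assms by auto
  then show ?thesis unfolding rows_def by (rule image_eqI[rotated]) simp
qed

lemma columnsI:
  assumes "(Q1, Q2) \<in> G" "I \<in> A" "I \<subseteq> Q1"
  shows "I \<times> Q2 \<in> columns G A"
proof -
  have "Q2 \<in> snd ` G" using assms(1) by (rule image_eqI[rotated]) simp
  then have "(I, Q2) \<in> {(I, Q2)\<in>A \<times> snd ` G. \<exists>Q1. (Q1, Q2) \<in> G \<and> I \<subseteq> Q1}" using assms by auto
  then show ?thesis unfolding columns_def by (rule image_eqI[rotated]) simp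
qed

lemma rowsE:
  assumes "Q \<in> rows G A"
  shows "\<exists>Q1 Q2 P. Q = Q1 \<times> P \<and> (Q1, Q2) \<in> G \<and> P \<in> A \<and> P \<subseteq> Q2"
  using assms unfolding rows_def by auto

lemma columnsE:
  assumes "Q \<in> columns G A"
  shows "\<exists>Q1 Q2 I. Q = I \<times> Q2 \<and> (Q1, Q2) \<in> G \<and> I \<in> A \<and> I \<subseteq> Q1"
  using assms unfolding columns_def by auto

lemma rows_laminar:
  assumes "finite G" "G \<subseteq> D1 \<times> D2" "finite A" "A \<subseteq> D2" "disjoint A"
  shows "finite (rows G A)" "rows G A \<subseteq> rects D1 D2" "laminar (rows G A)"
proof -
  have GD: "fst ` G \<subseteq> D1" using assms(2) by auto
  show "finite (rows G A)"
    unfolding rows_def using assms by (auto intro!: finite_imageI intro: finite_subset[of _ "fst ` G \<times> A"])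
  show "rows G A \<subseteq> rects D1 D2"
    using GD assms(4) unfolding rows_def by (auto intro!: rectsI simp del: image_subset_iff)
  show "laminar (rows G A)"
    by (rule laminar_subset[OF laminar_Times(1)[OF dyadic_grid_laminar[OF grid1] assms(5)]])
      (use GD in \<open>auto simp: rows_def intro!: image_mono\<close>)
qed

lemma columns_laminar:
  assumes "finite G" "G \<subseteq> D1 \<times> D2" "finite A" "A \<subseteq> D1" "disjoint A"
  shows "finite (columns G A)" "columns G A \<subseteq> rects D1 D2" "laminar (columns G A)"
proof -
  have GD: "snd ` G \<subseteq> D2" using assms(2) by auto
  show "finite (columns G A)"
    unfolding columns_def using assms by (auto intro!: finite_imageI intro: finite_subset[of _ "A \<times> snd ` G"])
  show "columns G A \<subseteq> rects D1 D2"
    using GD assms(4) unfolding columns_def by (auto intro!: rectsI simp del: image_subset_iff)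
  show "laminar (columns G A)"
    by (rule laminar_subset[OF laminar_Times(2)[OF dyadic_grid_laminar[OF grid2] assms(5)]])
      (use GD in \<open>auto simp: columns_def intro!: image_mono\<close>)
qed

text \<open>A weak-type bound for the strong maximal function on indicator functions, obtained by applying
  the one-parameter bound first to the rows \<open>Q1 \<times> P\<close> and then to the columns \<open>I \<times> Q2\<close>.\<close>

lemma strong_density_union:
  assumes fin: "finite G" and sub: "G \<subseteq> D1 \<times> D2" and E: "E \<in> sets lebesgue"
    and dens: "\<And>Q1 Q2. (Q1, Q2) \<in> G \<Longrightarrow>
      emeasure lebesgue (Q1 \<times> Q2) < 2 * emeasure lebesgue (E \<inter> Q1 \<times> Q2)"
  shows "emeasure lebesgue (\<Union>(Q1, Q2)\<in>G. Q1 \<times> Q2) \<le> 16 * emeasure lebesgue E"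
proof -
  obtain A1 A2 where A: "A1 \<subseteq> D1" "A2 \<subseteq> D2" "finite A1" "finite A2" "disjoint A1" "disjoint A2"
    and un: "\<forall>(Q1, Q2)\<in>G. \<Union>{I\<in>A1. I \<subseteq> Q1} = Q1 \<and> \<Union>{P\<in>A2. P \<subseteq> Q2} = Q2"
    using common_refinement[OF fin sub] by (elim exE conjE)
  have un1: "\<Union>{I\<in>A1. I \<subseteq> Q1} = Q1" and un2: "\<Union>{P\<in>A2. P \<subseteq> Q2} = Q2"
    if "(Q1, Q2) \<in> G" for Q1 Q2
    using bspec[OF un that] by auto
  let ?e = "emeasure lebesgue" and ?l = "emeasure lborel"
  \<comment> \<open>Good rows are those where \<open>E\<close> has density at least 1/4. If they
    filled less than a quarter of \<open>Q2\<close>, the density of \<open>E\<close> in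
    \<open>Q1 \<times> Q2\<close> would be at most 1/4 + 1/4, against \<open>dens\<close>.\<close>
  define good where "good Q1 P \<longleftrightarrow> ?e (Q1 \<times> P) \<le> 4 * ?e (E \<inter> Q1 \<times> P)" for Q1 P
  define F1 where "F1 = {Q\<in>rows G A2. ?e Q \<le> 4 * ?e (E \<inter> Q)}"
  let ?F2 = "columns G A1"
  note R = rows_laminar[OF fin sub A(4,2,6)] and S = columns_laminar[OF fin sub A(3,1,5)]
  have F1: "finite F1" "laminar F1" using R laminar_subset[OF R(3), of F1] by (auto simp: F1_def)
  have setsF: "F1 \<subseteq> sets lebesgue" "?F2 \<subseteq> sets lebesgue" using R(2) S(2) rect_facts(1) by (auto simp: F1_def)
  define H where "H = \<Union>F1"
  have H: "H \<in> sets lebesgue" unfolding H_def using F1 setsF by (intro sets.finite_Union) auto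
  have H_le: "?e H \<le> 4 * ?e E"
    unfolding H_def by (rule laminar_density_union[OF F1 setsF(1) E]) (simp add: F1_def)
  \<comment> \<open>Which pieces \<open>P\<close> are good depends on \<open>Q1\<close> but not on
    \<open>I\<close>. Hence the density of \<open>H\<close> in the column
    \<open>I \<times> Q2\<close> is at least the share of good pieces in \<open>Q2\<close>, which is
    at least a quarter. Each of the two coverings costs a factor 4.\<close>
  have F2_dens: "emeasure lebesgue (I \<times> Q2) \<le> 4 * emeasure lebesgue (H \<inter> I \<times> Q2)"
    if G: "(Q1, Q2) \<in> G" and I: "I \<in> A1" "I \<subseteq> Q1" for Q1 Q2 I
  proof -
    let ?P = "{P\<in>A2. P \<subseteq> Q2}"
    have Q: "Q1 \<in> D1" "Q2 \<in> D2" using G sub by auto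
    have PD: "P \<in> D2" if "P \<in> A2" for P using that A by auto
    have finP: "finite ?P" using A by auto
    have sets: "Q1 \<times> P \<in> sets lebesgue" "I \<times> P \<in> sets lebesgue" if "P \<in> A2" for P
      using rect_facts(1)[OF rectsI[OF Q(1) PD]] rect_facts(1)[OF rectsI[OF _ PD]] that I A by auto
    have disjP: "disjoint_family_on (\<lambda>P. Y \<inter> X \<times> P) ?P" for X :: "(real^'n) set" and Y
      using A(6) by (auto simp: disjoint_family_on_def pairwise_def disjnt_def)
    let ?g = "\<Sum>P\<in>{P\<in>?P. good Q1 P}. ?l P"
    have cover: "Q1 \<times> Q2 = (\<Union>P\<in>?P. Q1 \<times> P)"
      using un2[OF G] by blast
    have "?e (E \<inter> Q1 \<times> Q2) = ?e (\<Union>P\<in>?P. E \<inter> Q1 \<times> P)"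
      by (simp only: cover Int_UN_distrib)
    also have "\<dots> = (\<Sum>P\<in>?P. ?e (E \<inter> Q1 \<times> P))"
      using sets E finP by (intro sum_emeasure[symmetric] disjP) auto
    finally have "4 * ?e (E \<inter> Q1 \<times> Q2) = (\<Sum>P\<in>?P. 4 * ?e (E \<inter> Q1 \<times> P))"
      by (simp add: sum_distrib_left)
    also have "\<dots> \<le> (\<Sum>P\<in>?P. (if good Q1 P then 4 * ?e (Q1 \<times> P) else 0) + ?e (Q1 \<times> P))"
    proof (intro sum_mono)
      fix P assume "P \<in> ?P"
      show "4 * ?e (E \<inter> Q1 \<times> P) \<le> (if good Q1 P then 4 * ?e (Q1 \<times> P) else 0) + ?e (Q1 \<times> P)"
      proof (cases "good Q1 P")
        case True
        have "4 * ?e (E \<inter> Q1 \<times> P) \<le> 4 * ?e (Q1 \<times> P)"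
          using sets \<open>P \<in> ?P\<close> by (intro mult_left_mono emeasure_mono) auto
        then show ?thesis using True by (simp add: add_increasing2)
      qed (simp add: good_def)
    qed
    also have "\<dots> = (\<Sum>P\<in>?P. if good Q1 P then 4 * ?e (Q1 \<times> P) else 0) + (\<Sum>P\<in>?P. ?e (Q1 \<times> P))"
      by (rule sum.distrib)
    also have "(\<Sum>P\<in>?P. if good Q1 P then 4 * ?e (Q1 \<times> P) else 0) = (\<Sum>P\<in>{P\<in>?P. good Q1 P}. 4 * ?e (Q1 \<times> P))"
      using finP by (simp add: sum.If_cases Int_def Collect_conj_eq[symmetric])
    also have "\<dots> = (\<Sum>P\<in>{P\<in>?P. good Q1 P}. 4 * ?l Q1 * ?l P)"
      using Q PD by (intro sum.cong) (auto simp: times_emeasure mult.assoc)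
    also have "\<dots> = 4 * ?l Q1 * ?g" by (simp add: sum_distrib_left)
    also have "(\<Sum>P\<in>?P. ?e (Q1 \<times> P)) = ?l Q1 * ?l Q2"
      using Q PD sum_pieces[OF A(6,4,2) un2[OF G]]
      by (simp add: times_emeasure sum_distrib_left)
    finally have up: "4 * ?e (E \<inter> Q1 \<times> Q2) \<le> ?l Q1 * (4 * ?g) + ?l Q1 * ?l Q2"
      by (simp add: mult_ac)
    have four: "2 * (2 * t) = 4 * t" for t :: ennreal by (simp flip: mult.assoc)
    have "?l Q2 \<le> 4 * ?g"
    proof (rule ccontr)
      assume "\<not> ?l Q2 \<le> 4 * ?g"
      then have "4 * ?g \<le> ?l Q2" by simp
      then have "4 * ?e (E \<inter> Q1 \<times> Q2) \<le> ?l Q1 * ?l Q2 + ?l Q1 * ?l Q2"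
        by (intro order.trans[OF up] add_right_mono mult_left_mono) auto
      then have "2 * (2 * ?e (E \<inter> Q1 \<times> Q2)) \<le> 2 * ?e (Q1 \<times> Q2)"
        unfolding four times_emeasure[OF Q] mult_2[of "?l Q1 * ?l Q2"] .
      then have "2 * ?e (E \<inter> Q1 \<times> Q2) \<le> ?e (Q1 \<times> Q2)"
        by (subst (asm) ennreal_mult_le_mult_iff) auto
      then show False using dens[OF G] by simp
    qed
    then have "?e (I \<times> Q2) \<le> ?l I * (4 * ?g)"
      using I A Q by (subst times_emeasure) (auto intro!: mult_left_mono)
    also have "\<dots> = 4 * (\<Sum>P\<in>{P\<in>?P. good Q1 P}. ?l I * ?l P)" by (simp add: sum_distrib_left mult_ac)
    also have "(\<Sum>P\<in>{P\<in>?P. good Q1 P}. ?l I * ?l P) = (\<Sum>P\<in>{P\<in>?P. good Q1 P}. ?e (I \<times> P))"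
      using I A PD by (intro sum.cong) (auto simp: times_emeasure)
    also have "\<dots> = ?e (\<Union>P\<in>{P\<in>?P. good Q1 P}. I \<times> P)"
      using sets A(4) disjP[of UNIV I] by (intro sum_emeasure) (auto simp: disjoint_family_on_def)
    also have "\<dots> \<le> ?e (H \<inter> I \<times> Q2)"
    proof (rule emeasure_mono)
      have "I \<times> P \<subseteq> H" if "P \<in> ?P" "good Q1 P" for P
        using that I rowsI[OF G, of P A2] unfolding H_def F1_def good_def by auto
      then show "(\<Union>P\<in>{P\<in>?P. good Q1 P}. I \<times> P) \<subseteq> H \<inter> I \<times> Q2" by blast
      show "H \<inter> I \<times> Q2 \<in> sets lebesgue"
        using H rect_facts(1)[OF rectsI[OF _ Q(2)]] I A by auto
    qed
    finally show ?thesis by (simp add: mult_left_mono)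
  qed
  have "(\<Union>(Q1, Q2)\<in>G. Q1 \<times> Q2) \<subseteq> \<Union>?F2"
  proof
    fix z assume "z \<in> (\<Union>(Q1, Q2)\<in>G. Q1 \<times> Q2)"
    then obtain Q1 Q2 where Q: "(Q1, Q2) \<in> G" "z \<in> Q1 \<times> Q2" by blast
    have "fst z \<in> \<Union>{I\<in>A1. I \<subseteq> Q1}" using Q un1[OF Q(1)] by auto
    then obtain I where I: "I \<in> A1" "I \<subseteq> Q1" "fst z \<in> I" by auto
    have "z \<in> I \<times> Q2" using I Q by (auto simp: mem_Times_iff)
    then show "z \<in> \<Union>?F2" by (rule UnionI[OF columnsI[OF Q(1) I(1,2)]])
  qed
  then have "?e (\<Union>(Q1, Q2)\<in>G. Q1 \<times> Q2) \<le> ?e (\<Union>?F2)"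
    using S(1) setsF by (intro emeasure_mono sets.finite_Union) auto
  also have "\<dots> \<le> 4 * ?e H"
  proof (rule laminar_density_union[OF S(1,3) setsF(2) H])
    fix Q assume "Q \<in> ?F2"
    then show "?e Q \<le> 4 * ?e (H \<inter> Q)" using columnsE[of Q G A1] F2_dens by auto
  qed
  also have "\<dots> \<le> 4 * (4 * ?e E)" by (intro mult_left_mono H_le) auto
  finally show ?thesis by (simp add: mult.assoc[symmetric])
qed

end

section \<open>Averages\<close>

lemma ennpow_ennreal: "0 \<le> x \<Longrightarrow> ennpow (ennreal x) s = ennreal (x powr s)"
  by (simp add: ennpow_def)

lemma ennpow_leD:
  assumes "ennpow x s \<le> ennreal c" "0 < s" "0 \<le> c"
  shows "x \<le> ennreal (c powr (1 / s))"
proof -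
  have "x \<noteq> top" using assms(1) by (auto simp: ennpow_def top_unique)
  then obtain r where r: "x = ennreal r" "0 \<le> r" by (cases x) auto
  have "r powr s \<le> c" using assms r by (simp add: ennpow_ennreal)
  then have "(r powr s) powr (1 / s) \<le> c powr (1 / s)" using assms r by (intro powr_mono2) auto
  then show ?thesis using assms r by (simp add: powr_powr ennreal_leI)
qed

lemma ennpow_le_mult:
  assumes "ennreal a \<le> ennreal c * ennpow x (1 / s)" "0 < s" "0 \<le> a" "0 < c"
  shows "ennreal (a powr s) \<le> ennreal (c powr s) * x"
proof (cases "x = top")
  case True
  then show ?thesis using assms by (simp add: ennreal_mult_top)
next
  case False
  then obtain r where r: "x = ennreal r" "0 \<le> r" by (cases x) auto
  have "a \<le> c * r powr (1 / s)" using assms r by (simp add: ennpow_ennreal flip: ennreal_mult)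
  then have "a powr s \<le> (c * r powr (1 / s)) powr s" using assms by (intro powr_mono2) auto
  also have "\<dots> = c powr s * r" using assms r by (simp add: powr_mult powr_powr)
  finally show ?thesis using r assms by (simp flip: ennreal_mult)
qed

lemma average_eq_uniform:
  assumes "R \<in> sets lebesgue" "f \<in> borel_measurable lebesgue"
  shows "average R f = (\<integral>\<^sup>+x. f x \<partial>uniform_measure lebesgue R)"
  using assms by (simp add: average_def nn_integral_uniform_measure)

section \<open>Matrix weights and reducing operators\<close>

locale reduced_weight = dyadic_grids D1 D2
  for D1 :: "(real^'n) set set" and D2 :: "(real^'m) set set" +
  fixes p K :: real and V :: "(real^'n) \<times> (real^'m) \<Rightarrow> complex^'d^'d"
    and Vred :: "('n, 'm) rect \<Rightarrow> complex^'d^'d"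
  assumes p: "1 < p" and K: "0 \<le> K" and weight: "matrix_weight V"
    and Ap: "Ap_char p D1 D2 V \<le> ennreal K"
    and red: "\<And>R. R \<in> rects D1 D2 \<Longrightarrow> reducing_operator p V R (Vred R)"
begin

definition q :: real where "q = p / (p - 1)"

lemma q: "1 < q" "1 / p + 1 / q = 1" "1 / q + 1 / p = 1" "(q - 1) * p = q"
  using p by (auto simp: q_def field_simps)

definition vp :: "(real^'n) \<times> (real^'m) \<Rightarrow> complex^'d^'d" where "vp x = matrix_powr (V x) (1 / p)"
definition vm :: "(real^'n) \<times> (real^'m) \<Rightarrow> complex^'d^'d" where "vm x = matrix_powr (V x) (- 1 / p)"

lemma vp_vm_measurable [measurable]: "vp \<in> borel_measurable lebesgue" "vm \<in> borel_measurable lebesgue"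
  unfolding vp_def[abs_def] vm_def[abs_def] by (intro borel_measurable_matrix_powr weight)+

lemma AE_pos_def: "AE x in lebesgue. pos_def (V x)"
  using weight by (simp add: matrix_weight_def)

lemma vp_vm:
  assumes "pos_def (V x)"
  shows "vp x ** vm x = mat 1" "vm x ** vp x = mat 1"
    "conj_transpose (vp x) = vp x" "conj_transpose (vm x) = vm x"
  using matrix_powr_mult_minus[OF assms, of "1 / p"] matrix_powr_mult_minus[OF assms, of "- 1 / p"]
    conj_transpose_matrix_powr[OF assms]
  by (simp_all add: vp_def vm_def)

text \<open>An average over a rectangle becomes an integral against a probability measure on the
  Lebesgue sets, so that Hoelder, Cauchy-Schwarz and the Bochner integral apply to it
  directly.\<close>

definition avg :: "('n, 'm) rect \<Rightarrow> ((real^'n) \<times> (real^'m)) measure" where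
  "avg R = uniform_measure lebesgue R"

lemma sets_avg [simp, measurable_cong]: "sets (avg R) = sets lebesgue"
  by (simp add: avg_def)

lemma emeasure_avg:
  assumes "R \<in> rects D1 D2"
  shows "emeasure (avg R) (space (avg R)) = 1"
  using rect_facts[OF assms] by (simp add: avg_def ennreal_divide_self)

lemma average_avg:
  assumes "R \<in> rects D1 D2" "f \<in> borel_measurable lebesgue"
  shows "average R f = (\<integral>\<^sup>+x. f x \<partial>avg R)"
  unfolding avg_def by (intro average_eq_uniform rect_facts assms)

lemma set_integral_avg:
  assumes "R \<in> rects D1 D2" "f \<in> borel_measurable lebesgue"
  shows "(\<integral>\<^sup>+x\<in>R. f x \<partial>lebesgue) = (\<integral>\<^sup>+x. f x \<partial>avg R) * emeasure lebesgue R"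
  using rect_facts[OF assms(1)] assms(2)
  by (simp add: avg_def nn_integral_uniform_measure ennreal_divide_times ennreal_mult_divide_eq)

lemma AE_avg: "R \<in> rects D1 D2 \<Longrightarrow> AE x in lebesgue. P x \<Longrightarrow> AE x in avg R. P x"
  unfolding avg_def using rect_facts[of R]
  by (intro AE_uniform_measureI) (auto elim!: eventually_mono)

lemma Vred_pos_def: "R \<in> rects D1 D2 \<Longrightarrow> pos_def (Vred R)"
  using red[of R] by (simp add: reducing_operator_def)

lemma Vred_inv:
  assumes "R \<in> rects D1 D2"
  shows "Vred R ** matrix_inv (Vred R) = mat 1" "matrix_inv (Vred R) ** Vred R = mat 1"
    "conj_transpose (Vred R) = Vred R" "conj_transpose (matrix_inv (Vred R)) = matrix_inv (Vred R)"
  using Vred_pos_def[OF assms] pos_def_matrix_inv[of "Vred R"] conj_transpose_matrix_inv[of "Vred R"]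
  by (auto simp: pos_def_def)

lemma reducing_lower:
  assumes R: "R \<in> rects D1 D2"
  shows "(\<integral>\<^sup>+x. ennreal (norm (vp x *v e) powr p) \<partial>avg R) \<le> ennreal (norm (Vred R *v e) powr p)"
proof -
  have "ennpow (average R (\<lambda>x. ennreal (norm (vp x *v e) powr p))) (1 / p) \<le> ennreal (norm (Vred R *v e))"
    using red[OF R] by (simp add: reducing_operator_def vp_def Let_def)
  from ennpow_leD[OF this] show ?thesis
    using p R by (subst average_avg[symmetric]) auto
qed

lemma reducing_upper:
  assumes R: "R \<in> rects D1 D2"
  shows "ennreal (norm (Vred R *v e) powr p) \<le>
    ennreal (sqrt (real CARD('d)) powr p) * (\<integral>\<^sup>+x. ennreal (norm (vp x *v e) powr p) \<partial>avg R)"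
proof -
  have "ennreal (norm (Vred R *v e)) \<le>
      ennreal (sqrt (real CARD('d))) * ennpow (average R (\<lambda>x. ennreal (norm (vp x *v e) powr p))) (1 / p)"
    using red[OF R] by (simp add: reducing_operator_def vp_def Let_def)
  from ennpow_le_mult[OF this] show ?thesis
    using p R by (subst average_avg[symmetric]) auto
qed

lemma opnorm_powr_average_le:
  fixes f :: "(real^'n) \<times> (real^'m) \<Rightarrow> complex^'d^'d"
  assumes "0 \<le> s" and [measurable]: "f \<in> borel_measurable lebesgue" and c: "0 \<le> c"
    and le: "\<And>j. (\<integral>\<^sup>+x. ennreal (norm (f x *v axis j 1) powr s) \<partial>avg R) \<le> ennreal c"
  shows "(\<integral>\<^sup>+x. ennreal (opnorm (f x) powr s) \<partial>avg R) \<le> ennreal (real CARD('d) powr s * (real CARD('d) * c))"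
proof -
  have "(\<integral>\<^sup>+x. ennreal (opnorm (f x) powr s) \<partial>avg R) \<le>
      (\<integral>\<^sup>+x. ennreal (real CARD('d) powr s) * (\<Sum>j\<in>UNIV. ennreal (norm (f x *v axis j 1) powr s)) \<partial>avg R)"
  proof (intro nn_integral_mono)
    fix x
    show "ennreal (opnorm (f x) powr s) \<le>
        ennreal (real CARD('d) powr s) * (\<Sum>j\<in>UNIV. ennreal (norm (f x *v axis j 1) powr s))"
      using opnorm_powr_le_sum[OF assms(1), of "f x"]
      by (subst sum_ennreal) (auto simp: sum_nonneg simp flip: ennreal_mult)
  qed
  also have "\<dots> = ennreal (real CARD('d) powr s) * (\<Sum>j\<in>UNIV. \<integral>\<^sup>+x. ennreal (norm (f x *v axis j 1) powr s) \<partial>avg R)"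
    by (simp add: nn_integral_cmult nn_integral_sum del: sum_ennreal)
  also have "\<dots> \<le> ennreal (real CARD('d) powr s) * (\<Sum>j\<in>(UNIV :: 'd set). ennreal c)"
    by (intro mult_left_mono sum_mono le) auto
  also have "\<dots> = ennreal (real CARD('d) powr s * (real CARD('d) * c))"
    using c by (simp add: ennreal_mult ennreal_of_nat_eq_real_of_nat)
  finally show ?thesis .
qed

section \<open>Consequences of the A_p condition on a single rectangle\<close>

lemma Ap_rect:
  assumes "R \<in> rects D1 D2"
  shows "average R (\<lambda>x. ennpow (average R (\<lambda>y. ennreal (opnorm (vp x ** vm y) powr q))) (p / q)) \<le> ennreal K"
  using assms Ap unfolding Ap_char_def Let_def vp_def vm_def q_def
  by (rule order.trans[OF SUP_upper])

definition Cv :: real where "Cv = real CARD('d) powr p * real CARD('d)"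

lemma Cv_pos: "0 < Cv" by (simp add: Cv_def)

text \<open>The reducing operator cancels its inverse, so every column has \<open>p\<close>-average
  at most 1; \<open>Cv\<close> is the price of passing from columns to the operator norm.\<close>

lemma average_vp_inverse:
  assumes R: "R \<in> rects D1 D2"
  shows "(\<integral>\<^sup>+x. ennreal (opnorm (vp x ** matrix_inv (Vred R)) powr p) \<partial>avg R) \<le> ennreal Cv"
proof -
  have "(\<integral>\<^sup>+x. ennreal (norm ((vp x ** matrix_inv (Vred R)) *v axis j 1) powr p) \<partial>avg R) \<le> ennreal 1" for j
  proof -
    have "Vred R *v (matrix_inv (Vred R) *v axis j 1) = axis j 1"
      by (simp add: matrix_vector_mul_assoc Vred_inv R)
    then show ?thesis
      using reducing_lower[OF R, of "matrix_inv (Vred R) *v axis j 1"]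
      by (simp add: matrix_vector_mul_assoc)
  qed
  from opnorm_powr_average_le[OF _ _ _ this] p show ?thesis by (simp add: Cv_def)
qed

text \<open>The innermost factor is the bound of \<open>average_vm_vector\<close>; the powers of d
  come from passing from columns to operator norms.\<close>

definition Cw :: real where
  "Cw = real CARD('d) powr q * (real CARD('d) * (sqrt (real CARD('d)) * K powr (1 / p)) powr q)"

lemma Cw_nonneg: "0 \<le> Cw" by (simp add: Cw_def)

text \<open>A qualitative step, with no control of the value: some positive definite
  \<open>V x\<close> has a finite inner average in the A_p condition, and multiplying by
  \<open>vm x\<close> removes \<open>vp x\<close>. It makes the quantity \<open>N\<close> of the
  next lemma finite, so that a power of it can be cancelled.\<close>

lemma average_vm_opnorm_finite:
  assumes R: "R \<in> rects D1 D2"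
  shows "(\<integral>\<^sup>+y. ennreal (opnorm (vm y) powr q) \<partial>avg R) < top"
proof -
  define a where "a x = average R (\<lambda>y. ennreal (opnorm (vp x ** vm y) powr q))" for x
  have Ap_R: "average R (\<lambda>x. ennpow (a x) (p / q)) \<le> ennreal K"
    unfolding a_def by (rule Ap_rect[OF R])
  have "\<exists>x. pos_def (V x) \<and> a x < top"
  proof (rule ccontr)
    assume "\<not> ?thesis"
    then have "AE x in lebesgue. (top :: ennreal) * indicator R x \<le> ennpow (a x) (p / q) * indicator R x"
      using AE_pos_def by (auto elim!: eventually_mono simp: ennpow_def indicator_def less_top)
    then have "(\<integral>\<^sup>+x. top * indicator R x \<partial>lebesgue) \<le> (\<integral>\<^sup>+x\<in>R. ennpow (a x) (p / q) \<partial>lebesgue)"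
      by (rule nn_integral_mono_AE)
    then have "(\<integral>\<^sup>+x\<in>R. ennpow (a x) (p / q) \<partial>lebesgue) = top"
      using rect_facts[OF R]
      by (subst (asm) nn_integral_cmult_indicator) (simp_all add: ennreal_top_mult top_unique)
    then show False
      using Ap_R rect_facts[OF R] by (simp add: average_def ennreal_top_divide top_unique)
  qed
  then obtain x where x: "pos_def (V x)" "a x < top" by blast
  have le: "opnorm (vm y) powr q \<le> opnorm (vm x) powr q * opnorm (vp x ** vm y) powr q" for y
  proof -
    have "opnorm (vm y) = opnorm (vm x ** (vp x ** vm y))"
      by (simp add: matrix_mul_assoc vp_vm x)
    also have "\<dots> \<le> opnorm (vm x) * opnorm (vp x ** vm y)" by (rule opnorm_mult_le)
    finally have "opnorm (vm y) powr q \<le> (opnorm (vm x) * opnorm (vp x ** vm y)) powr q"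
      using q by (intro powr_mono2) auto
    then show ?thesis by (simp add: powr_mult)
  qed
  have "(\<integral>\<^sup>+y. ennreal (opnorm (vm y) powr q) \<partial>avg R) \<le>
      (\<integral>\<^sup>+y. ennreal (opnorm (vm x) powr q) * ennreal (opnorm (vp x ** vm y) powr q) \<partial>avg R)"
    using le by (intro nn_integral_mono) (simp flip: ennreal_mult)
  also have "\<dots> = ennreal (opnorm (vm x) powr q) * a x"
    using R by (simp add: nn_integral_cmult a_def average_avg)
  also have "\<dots> < top" using x by (simp add: ennreal_mult_less_top)
  finally show ?thesis .
qed

text \<open>The vector \<open>e\<close> is, up to scaling, the norming functional of \<open>u\<close> for the norm
  \<open>(avg |V\<^sup>-\<^sup>1\<^sup>/\<^sup>p u|\<^sup>q)\<^sup>1\<^sup>/\<^sup>q\<close>; this turns the \<open>A\<^sub>p\<close> condition into a bound of that norm by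
  \<open>|(Vred R)\<^sup>-\<^sup>1 u|\<close> without a reducing operator of the dual weight.\<close>

lemma average_vm_vector:
  assumes R: "R \<in> rects D1 D2"
  shows "(\<integral>\<^sup>+y. ennreal (norm (vm y *v u) powr q) \<partial>avg R) \<le>
    ennreal ((sqrt (real CARD('d)) * K powr (1 / p) * norm (matrix_inv (Vred R) *v u)) powr q)"
proof -
  define a where "a x = average R (\<lambda>y. ennreal (opnorm (vp x ** vm y) powr q))" for x
  have Ap_R: "average R (\<lambda>x. ennpow (a x) (p / q)) \<le> ennreal K"
    unfolding a_def by (rule Ap_rect[OF R])
  define h where "h y = norm (vm y *v u)" for y
  have h_nonneg: "0 \<le> h y" for y by (simp add: h_def)
  have [measurable]: "h \<in> borel_measurable lebesgue" unfolding h_def[abs_def] by measurable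
  have h_le: "h y \<le> opnorm (vm y) * norm u" for y unfolding h_def by (rule norm_matrix_vector_le)
  have "(\<integral>\<^sup>+y. ennreal (h y powr q) \<partial>avg R) \<le>
      (\<integral>\<^sup>+y. ennreal (norm u powr q) * ennreal (opnorm (vm y) powr q) \<partial>avg R)"
  proof (intro nn_integral_mono)
    fix y
    have "h y powr q \<le> (opnorm (vm y) * norm u) powr q"
      using h_le h_nonneg q by (intro powr_mono2) auto
    then show "ennreal (h y powr q) \<le> ennreal (norm u powr q) * ennreal (opnorm (vm y) powr q)"
      by (simp add: powr_mult mult.commute flip: ennreal_mult)
  qed
  also have "\<dots> < top"
    using average_vm_opnorm_finite[OF R] by (simp add: nn_integral_cmult ennreal_mult_less_top)
  finally obtain N where N: "(\<integral>\<^sup>+y. ennreal (h y powr q) \<partial>avg R) = ennreal N" "0 \<le> N"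
    by (cases "\<integral>\<^sup>+y. ennreal (h y powr q) \<partial>avg R") auto
  \<comment> \<open>The density of the norming functional: its pairing with \<open>u\<close> is
    \<open>h y powr q\<close>, while \<open>B *v F y\<close> costs \<open>h y powr (q - 1)\<close>
    besides the norm of \<open>B ** vm y\<close>, and the \<open>p\<close>-th power of that is again
    \<open>h y powr q\<close>.\<close>
  define F where "F y = (h y powr (q - 2)) *\<^sub>R (vm y *v (vm y *v u))" for y
  have [measurable]: "F \<in> borel_measurable lebesgue" unfolding F_def[abs_def] by measurable
  have mult_F: "norm (B *v F y) \<le> opnorm (B ** vm y) * h y powr (q - 1)" for B y
  proof (cases "h y = 0")
    case True
    then show ?thesis by (simp add: F_def)
  next
    case False
    have "norm (B *v F y) = h y powr (q - 2) * norm ((B ** vm y) *v (vm y *v u))"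
      by (simp add: F_def scaleR_eq_scale vector_scalar_commute norm_scale matrix_vector_mul_assoc matrix_mul_assoc)
    also have "\<dots> \<le> h y powr (q - 2) * (opnorm (B ** vm y) * h y)"
      unfolding h_def by (intro mult_left_mono norm_matrix_vector_le) auto
    also have "\<dots> = opnorm (B ** vm y) * (h y powr (q - 2) * h y powr 1)"
      using h_nonneg[of y] by (simp add: mult_ac)
    also have "h y powr (q - 2) * h y powr 1 = h y powr (q - 1)"
      by (subst powr_add[symmetric]) simp
    finally show ?thesis .
  qed
  have Holder_h: "(\<integral>\<^sup>+y. ennreal (opnorm (B ** vm y) * h y powr (q - 1)) \<partial>avg R) \<le>
      ennreal (c powr (1 / q) * N powr (1 / p))"
    if "(\<integral>\<^sup>+y. ennreal (opnorm (B ** vm y) powr q) \<partial>avg R) \<le> ennreal c" "0 \<le> c" for B c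
  proof (rule nn_integral_Holder[of q p])
    show "(\<integral>\<^sup>+y. ennreal ((h y powr (q - 1)) powr p) \<partial>avg R) \<le> ennreal ((N powr (1 / p)) powr p)"
      using N p q h_nonneg by (simp add: powr_powr)
  qed (use that p q in \<open>auto simp: powr_powr\<close>)
  have int_F: "integrable (avg R) F"
  proof -
    obtain c where c: "(\<integral>\<^sup>+y. ennreal (opnorm (mat 1 ** vm y) powr q) \<partial>avg R) = ennreal c" "0 \<le> c"
      using average_vm_opnorm_finite[OF R]
      by (cases "\<integral>\<^sup>+y. ennreal (opnorm (vm y) powr q) \<partial>avg R") auto
    have "(\<integral>\<^sup>+y. ennreal (norm (F y)) \<partial>avg R) \<le> (\<integral>\<^sup>+y. ennreal (opnorm (mat 1 ** vm y) * h y powr (q - 1)) \<partial>avg R)"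
      using mult_F[of "mat 1"] by (intro nn_integral_mono ennreal_leI) simp
    also have "\<dots> < top" using Holder_h[OF c(1)[THEN eq_refl] c(2)] by (rule le_less_trans) simp
    finally show ?thesis by (simp add: integrable_iff_bounded)
  qed
  define e where "e = (\<integral>y. F y \<partial>avg R)"
  have e_bound: "ennreal (norm (vp x *v e) powr p) \<le> ennreal N * ennpow (a x) (p / q)" for x
  proof (cases "a x = top")
    \<comment> \<open>An infinite \<open>a x\<close> makes the right side infinite, except for
      \<open>N = 0\<close>, where \<open>0 * top = 0\<close> and \<open>e\<close> has to
      vanish.\<close>
    case True
    show ?thesis
    proof (cases "N = 0")
      case True
      then have "(\<integral>\<^sup>+y. ennreal (h y powr q) \<partial>avg R) = 0" using N by simp
      then have "AE y in avg R. h y = 0"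
        by (subst (asm) nn_integral_0_iff_AE) (auto elim!: eventually_mono simp: ennreal_eq_0_iff)
      then have "AE y in avg R. F y = 0" by (auto elim!: eventually_mono simp: F_def)
      then have "e = 0" unfolding e_def by (rule integral_eq_zero_AE)
      then show ?thesis using p by simp
    next
      case False
      then show ?thesis using True N by (simp add: ennpow_def ennreal_mult_top)
    qed
  next
    case False
    then obtain c where c: "a x = ennreal c" "0 \<le> c" by (cases "a x") auto
    then have c': "(\<integral>\<^sup>+y. ennreal (opnorm (vp x ** vm y) powr q) \<partial>avg R) \<le> ennreal c"
      using R by (simp add: a_def average_avg)
    have "ennreal (norm (vp x *v e)) = ennreal (norm (\<integral>y. vp x *v F y \<partial>avg R))"
      unfolding e_def by (subst integral_bounded_linear[OF bounded_linear_matrix_vector int_F]) simp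
    also have "\<dots> \<le> (\<integral>\<^sup>+y. ennreal (norm (vp x *v F y)) \<partial>avg R)"
      by (rule integral_norm_bound_ennreal) (rule integrable_bounded_linear[OF bounded_linear_matrix_vector int_F])
    also have "\<dots> \<le> (\<integral>\<^sup>+y. ennreal (opnorm (vp x ** vm y) * h y powr (q - 1)) \<partial>avg R)"
      by (intro nn_integral_mono ennreal_leI mult_F)
    also have "\<dots> \<le> ennreal (c powr (1 / q) * N powr (1 / p))" by (rule Holder_h[OF c' c(2)])
    finally have "norm (vp x *v e) \<le> c powr (1 / q) * N powr (1 / p)" by simp
    then have "norm (vp x *v e) powr p \<le> (c powr (1 / q) * N powr (1 / p)) powr p"
      using p by (intro powr_mono2) auto
    also have "\<dots> = N * c powr (p / q)" using p N by (simp add: powr_mult powr_powr)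
    finally show ?thesis using c N by (simp add: ennpow_ennreal flip: ennreal_mult)
  qed
  have cip_e: "cip u e = of_real N"
  proof -
    have lin: "bounded_linear (\<lambda>v. cip u v)"
    proof (rule bounded_linear_intro[of _ "norm u"])
      show "cip u (r *\<^sub>R x) = r *\<^sub>R cip u x" for r x
        unfolding scaleR_eq_scale cip_scale_right by (simp add: scaleR_conv_of_real)
      show "norm (cip u x) \<le> norm x * norm u" for x using norm_cip_le[of u x] by (simp add: mult.commute)
    qed (rule cip_add_right)
    have "cip u (F y) = of_real (h y powr q)" if "pos_def (V y)" for y
    proof (cases "h y = 0")
      case True
      then show ?thesis by (simp add: F_def cip_def)
    next
      case False
      have "cip u (F y) = of_real (h y powr (q - 2)) * cip (vm y *v u) (vm y *v u)"
        unfolding F_def scaleR_eq_scale cip_scale_right by (simp add: cip_adjoint vp_vm that)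
      also have "\<dots> = of_real (h y powr (q - 2) * (h y)\<^sup>2)" by (simp add: cip_self h_def)
      also have "h y powr (q - 2) * (h y)\<^sup>2 = h y powr (q - 2) * h y powr 2"
        using h_nonneg[of y] False by (simp add: powr_numeral)
      also have "\<dots> = h y powr q" by (simp flip: powr_add)
      finally show ?thesis .
    qed
    then have "AE y in avg R. cip u (F y) = of_real (h y powr q)"
      using AE_avg[OF R AE_pos_def] by (auto elim!: eventually_mono)
    then have "(\<integral>y. cip u (F y) \<partial>avg R) = (\<integral>y. of_real (h y powr q) \<partial>avg R)"
      using borel_measurable_integrable[OF integrable_bounded_linear[OF lin int_F]]
      by (intro integral_cong_AE) auto
    also have "\<dots> = of_real (\<integral>y. h y powr q \<partial>avg R)" by (rule integral_complex_of_real)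
    also have "(\<integral>y. h y powr q \<partial>avg R) = N"
      using N by (subst integral_eq_nn_integral) auto
    finally show ?thesis unfolding e_def by (simp add: integral_bounded_linear[OF lin int_F])
  qed
  have N_le: "N \<le> norm (matrix_inv (Vred R) *v u) * norm (Vred R *v e)"
  proof -
    have "cip (matrix_inv (Vred R) *v u) (Vred R *v e) = cip u e"
      using cip_adjoint[of u "matrix_inv (Vred R)" "Vred R *v e"]
      by (simp add: Vred_inv R matrix_vector_mul_assoc)
    then show ?thesis using norm_cip_le[of "matrix_inv (Vred R) *v u" "Vred R *v e"] cip_e N by simp
  qed
  show ?thesis
  proof (cases "N = 0")
    case True
    then show ?thesis using N by (simp add: h_def)
  next
    case False
    then have Npos: "0 < N" using N by simp
    have "(\<integral>\<^sup>+x. ennreal (norm (vp x *v e) powr p / N) \<partial>avg R) = average R (\<lambda>x. ennreal (norm (vp x *v e) powr p / N))"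
      by (rule average_avg[OF R, symmetric]) measurable
    also have "\<dots> \<le> average R (\<lambda>x. ennpow (a x) (p / q))"
      unfolding average_def
    proof (intro divide_right_mono_ennreal nn_integral_mono mult_right_mono)
      fix x
      have "ennreal (norm (vp x *v e) powr p / N) = ennreal (norm (vp x *v e) powr p) / ennreal N"
        using Npos by (simp add: divide_ennreal)
      also have "\<dots> \<le> ennreal N * ennpow (a x) (p / q) / ennreal N"
        by (intro divide_right_mono_ennreal e_bound)
      also have "\<dots> = ennpow (a x) (p / q)"
        using Npos by (subst mult.commute) (simp add: ennreal_mult_divide_eq)
      finally show "ennreal (norm (vp x *v e) powr p / N) \<le> ennpow (a x) (p / q)" .
    qed simp
    also note Ap_R
    finally have K_bound: "(\<integral>\<^sup>+x. ennreal (norm (vp x *v e) powr p / N) \<partial>avg R) \<le> ennreal K" .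
    have "ennreal (norm (Vred R *v e) powr p) \<le>
        ennreal (sqrt (real CARD('d)) powr p) * (\<integral>\<^sup>+x. ennreal N * ennreal (norm (vp x *v e) powr p / N) \<partial>avg R)"
      using reducing_upper[OF R, of e] Npos by (simp flip: ennreal_mult)
    also have "\<dots> = ennreal (sqrt (real CARD('d)) powr p) * (ennreal N * (\<integral>\<^sup>+x. ennreal (norm (vp x *v e) powr p / N) \<partial>avg R))"
      by (subst nn_integral_cmult) auto
    also have "\<dots> \<le> ennreal (sqrt (real CARD('d)) powr p) * (ennreal N * ennreal K)"
      by (intro mult_left_mono K_bound) auto
    finally have "norm (Vred R *v e) powr p \<le> sqrt (real CARD('d)) powr p * (N * K)"
      using N K by (simp flip: ennreal_mult)
    then have "(norm (Vred R *v e) powr p) powr (1 / p) \<le> (sqrt (real CARD('d)) powr p * (N * K)) powr (1 / p)"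
      using p by (intro powr_mono2) auto
    then have Ve: "norm (Vred R *v e) \<le> sqrt (real CARD('d)) * (N powr (1 / p) * K powr (1 / p))"
      using p N K by (simp add: powr_mult powr_powr)
    \<comment> \<open>The bound for \<open>N\<close> contains \<open>N powr (1 / p)\<close> on its
      right side. Since \<open>N\<close> is finite and positive this factor cancels and leaves
      \<open>N powr (1 / q)\<close>, the norm to be estimated.\<close>
    have "N powr (1 / q) * N powr (1 / p) = N"
      using Npos q by (simp flip: powr_add)
    also have "N \<le> norm (matrix_inv (Vred R) *v u) * (sqrt (real CARD('d)) * (N powr (1 / p) * K powr (1 / p)))"
      by (rule order.trans[OF N_le]) (intro mult_left_mono Ve, simp)
    finally have "N powr (1 / q) * N powr (1 / p) \<le>
        (sqrt (real CARD('d)) * K powr (1 / p) * norm (matrix_inv (Vred R) *v u)) * N powr (1 / p)"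
      by (simp add: mult_ac)
    then have "N powr (1 / q) \<le> sqrt (real CARD('d)) * K powr (1 / p) * norm (matrix_inv (Vred R) *v u)"
      using Npos by simp
    then have "(N powr (1 / q)) powr q \<le> (sqrt (real CARD('d)) * K powr (1 / p) * norm (matrix_inv (Vred R) *v u)) powr q"
      using q by (intro powr_mono2) auto
    then show ?thesis using N q by (simp add: powr_powr h_def ennreal_leI)
  qed
qed

text \<open>The size of \<open>V^(-1/p)\<close> relative to the reducing operator. From here on the
  A_p condition acts through the bounded averages of \<open>w R powr q\<close> over
  \<open>R\<close>.\<close>

definition w :: "('n, 'm) rect \<Rightarrow> (real^'n) \<times> (real^'m) \<Rightarrow> real" where
  "w R x = opnorm (Vred R ** vm x)"

lemma w_nonneg [simp]: "0 \<le> w R x" by (simp add: w_def)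

lemma w_measurable [measurable]: "w R \<in> borel_measurable lebesgue"
  unfolding w_def[abs_def] by measurable

lemma average_w_powr:
  assumes R: "R \<in> rects D1 D2"
  shows "(\<integral>\<^sup>+x. ennreal (w R x powr q) \<partial>avg R) \<le> ennreal Cw"
proof -
  have "AE x in avg R. w R x = opnorm (vm x ** Vred R)"
    using AE_avg[OF R AE_pos_def]
    by eventually_elim (simp add: w_def opnorm_mult_swap vp_vm Vred_inv R)
  then have "(\<integral>\<^sup>+x. ennreal (w R x powr q) \<partial>avg R) = (\<integral>\<^sup>+x. ennreal (opnorm (vm x ** Vred R) powr q) \<partial>avg R)"
    by (intro nn_integral_cong_AE) (auto elim!: eventually_mono)
  also have "\<dots> \<le> ennreal Cw"
    unfolding Cw_def
  proof (rule opnorm_powr_average_le)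
    show "(\<integral>\<^sup>+x. ennreal (norm ((vm x ** Vred R) *v axis j 1) powr q) \<partial>avg R)
        \<le> ennreal ((sqrt (real CARD('d)) * K powr (1 / p)) powr q)" for j
      using average_vm_vector[OF R, of "Vred R *v axis j 1"]
      by (simp add: matrix_vector_mul_assoc Vred_inv R)
  qed (use q in auto)
  finally show ?thesis .
qed

lemma average_w:
  assumes R: "R \<in> rects D1 D2"
  shows "(\<integral>\<^sup>+x. ennreal (w R x) \<partial>avg R) \<le> ennreal (1 + Cw)"
proof -
  have "(\<integral>\<^sup>+x. ennreal (w R x) \<partial>avg R) \<le> (\<integral>\<^sup>+x. 1 + ennreal (w R x powr q) \<partial>avg R)"
  proof (intro nn_integral_mono)
    fix x
    have "w R x \<le> 1 + w R x powr q"
    proof (cases "w R x \<le> 1")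
      case False
      then have "w R x powr 1 \<le> w R x powr q" using q by (intro powr_mono) auto
      then show ?thesis using False by simp
    qed (simp add: add_increasing2)
    then show "ennreal (w R x) \<le> 1 + ennreal (w R x powr q)"
      by (simp flip: ennreal_plus ennreal_1)
  qed
  also have "\<dots> = 1 + (\<integral>\<^sup>+x. ennreal (w R x powr q) \<partial>avg R)"
    using R by (subst nn_integral_add) (auto simp: emeasure_avg)
  also have "\<dots> \<le> 1 + ennreal Cw" by (intro add_left_mono average_w_powr R)
  finally show ?thesis using Cw_nonneg by (simp add: ennreal_plus)
qed

lemma norm_Vred_le_w:
  assumes "pos_def (V x)"
  shows "norm (Vred R *v e) \<le> w R x * norm (vp x *v e)"
proof -
  have "Vred R *v e = (Vred R ** vm x) *v (vp x *v e)"
    by (simp add: matrix_vector_mul_assoc vp_vm assms flip: matrix_mul_assoc)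
  then show ?thesis unfolding w_def using norm_matrix_vector_le by metis
qed

text \<open>A reverse Hoelder inequality: an L^1 average controls what is defined by an L^p average.
  Pointwise the left side is at most \<open>w R x * norm (vp x *v e)\<close>; averaging square
  roots, Cauchy-Schwarz separates the factors. Integrals of first powers of the norm add up over
  strips, which the passage from rows to columns needs.\<close>

lemma reducing_upper_average:
  assumes R: "R \<in> rects D1 D2"
  shows "ennreal (norm (Vred R *v e)) \<le> ennreal (1 + Cw) * (\<integral>\<^sup>+x. ennreal (norm (vp x *v e)) \<partial>avg R)"
proof -
  let ?t = "norm (Vred R *v e)"
  have "ennreal (sqrt ?t) = (\<integral>\<^sup>+x. ennreal (sqrt ?t) \<partial>avg R)"
    using emeasure_avg[OF R] by simp
  also have "\<dots> \<le> (\<integral>\<^sup>+x. ennreal (sqrt (w R x)) * ennreal (sqrt (norm (vp x *v e))) \<partial>avg R)"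
    using AE_avg[OF R AE_pos_def]
    by (intro nn_integral_mono_AE)
      (auto elim!: eventually_mono simp: norm_Vred_le_w simp flip: ennreal_mult real_sqrt_mult)
  finally have "(ennreal (sqrt ?t))\<^sup>2 \<le> (\<integral>\<^sup>+x. ennreal (sqrt (w R x)) * ennreal (sqrt (norm (vp x *v e))) \<partial>avg R)\<^sup>2"
    by (intro power_mono) auto
  also have "\<dots> \<le> (\<integral>\<^sup>+x. (ennreal (sqrt (w R x)))\<^sup>2 \<partial>avg R) * (\<integral>\<^sup>+x. (ennreal (sqrt (norm (vp x *v e))))\<^sup>2 \<partial>avg R)"
    by (rule Cauchy_Schwarz_nn_integral) auto
  also have "\<dots> = (\<integral>\<^sup>+x. ennreal (w R x) \<partial>avg R) * (\<integral>\<^sup>+x. ennreal (norm (vp x *v e)) \<partial>avg R)"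
    by (simp add: ennreal_power)
  also have "\<dots> \<le> ennreal (1 + Cw) * (\<integral>\<^sup>+x. ennreal (norm (vp x *v e)) \<partial>avg R)"
    by (intro mult_right_mono average_w R) auto
  finally show ?thesis by (simp add: ennreal_power)
qed

section \<open>Reducing operators of nested rectangles\<close>

lemma w_le_mult:
  assumes "R \<in> rects D1 D2"
  shows "w S x \<le> opnorm (Vred S ** matrix_inv (Vred R)) * w R x"
proof -
  have "Vred S ** vm x = (Vred S ** matrix_inv (Vred R)) ** (Vred R ** vm x)"
    by (metis Vred_inv(2)[OF assms] matrix_mul_assoc matrix_mul_rid)
  then show ?thesis unfolding w_def using opnorm_mult_le by metis
qed

definition Cb :: real where "Cb = real CARD('d) powr p * (real CARD('d) * sqrt (real CARD('d)) powr p) * Cv"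

lemma Cb_pos: "0 < Cb" using Cv_pos by (simp add: Cb_def)

text \<open>The \<open>p\<close>-th power of the ratio is at most a constant times the average over
  \<open>S\<close> of \<open>opnorm (vp x ** matrix_inv (Vred R)) powr p\<close>. For disjoint
  \<open>S\<close> the integrals add up to at most the one over \<open>R\<close>, which is
  normalized.\<close>

lemma disjoint_large_ratio:
  assumes R: "R \<in> rects D1 D2" and fin: "finite \<S>" and disj: "disjoint \<S>"
    and sub: "\<And>S. S \<in> \<S> \<Longrightarrow> S \<in> rects D1 D2 \<and> S \<subseteq> R \<and> t \<le> opnorm (Vred S ** matrix_inv (Vred R))"
    and t: "0 \<le> t"
  shows "ennreal (t powr p) * (\<Sum>S\<in>\<S>. emeasure lebesgue S) \<le> ennreal Cb * emeasure lebesgue R"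
proof -
  let ?i = "matrix_inv (Vred R)" and ?c = "real CARD('d) powr p * (real CARD('d) * sqrt (real CARD('d)) powr p)"
  let ?v = "\<lambda>x. ennreal (opnorm (vp x ** ?i) powr p)"
  have S_le: "ennreal (t powr p) * emeasure lebesgue S \<le> ennreal ?c * (\<integral>\<^sup>+x. ?v x * indicator S x \<partial>lebesgue)"
    if "S \<in> \<S>" for S
  proof -
    have S: "S \<in> rects D1 D2" "t \<le> opnorm (Vred S ** ?i)" using sub[OF that] by auto
    have col: "ennreal (norm ((Vred S ** ?i) *v axis j 1) powr p) \<le>
        ennreal (sqrt (real CARD('d)) powr p) * (\<integral>\<^sup>+x. ?v x \<partial>avg S)" for j
    proof -
      have "ennreal (norm (Vred S *v (?i *v axis j 1)) powr p) \<le>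
          ennreal (sqrt (real CARD('d)) powr p) * (\<integral>\<^sup>+x. ennreal (norm (vp x *v (?i *v axis j 1)) powr p) \<partial>avg S)"
        by (rule reducing_upper[OF S(1)])
      also have "\<dots> \<le> ennreal (sqrt (real CARD('d)) powr p) * (\<integral>\<^sup>+x. ?v x \<partial>avg S)"
      proof (intro mult_left_mono nn_integral_mono ennreal_leI powr_mono2)
        show "norm (vp x *v (?i *v axis j 1)) \<le> opnorm (vp x ** ?i)" for x
          using norm_matrix_vector_le[of "vp x ** ?i" "axis j 1"] by (simp add: matrix_vector_mul_assoc)
      qed (use p in auto)
      finally show ?thesis by (simp add: matrix_vector_mul_assoc)
    qed
    have "ennreal (t powr p) \<le> ennreal (opnorm (Vred S ** ?i) powr p)"
      using S t p by (intro ennreal_leI powr_mono2) auto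
    also have "\<dots> \<le> ennreal (real CARD('d) powr p * (\<Sum>j\<in>UNIV. norm ((Vred S ** ?i) *v axis j 1) powr p))"
      using p by (intro ennreal_leI opnorm_powr_le_sum) auto
    also have "\<dots> = ennreal (real CARD('d) powr p) * (\<Sum>j\<in>UNIV. ennreal (norm ((Vred S ** ?i) *v axis j 1) powr p))"
      by (simp add: ennreal_mult sum_nonneg)
    also have "\<dots> \<le> ennreal (real CARD('d) powr p) * (\<Sum>j\<in>(UNIV::'d set). ennreal (sqrt (real CARD('d)) powr p) * (\<integral>\<^sup>+x. ?v x \<partial>avg S))"
      by (intro mult_left_mono sum_mono col) auto
    also have "\<dots> = ennreal ?c * (\<integral>\<^sup>+x. ?v x \<partial>avg S)"
      by (simp add: ennreal_mult ennreal_of_nat_eq_real_of_nat mult.assoc)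
    finally have "ennreal (t powr p) * emeasure lebesgue S \<le> ennreal ?c * (\<integral>\<^sup>+x. ?v x \<partial>avg S) * emeasure lebesgue S"
      by (intro mult_right_mono) auto
    then show ?thesis
      by (simp add: set_integral_avg[OF S(1)] mult.assoc)
  qed
  have sets: "S \<in> sets lebesgue" if "S \<in> \<S>" for S using sub[OF that] rect_facts(1) by blast
  have "ennreal (t powr p) * (\<Sum>S\<in>\<S>. emeasure lebesgue S) \<le>
      ennreal ?c * (\<Sum>S\<in>\<S>. \<integral>\<^sup>+x. ?v x * indicator S x \<partial>lebesgue)"
    unfolding sum_distrib_left by (intro sum_mono S_le)
  also have "(\<Sum>S\<in>\<S>. \<integral>\<^sup>+x. ?v x * indicator S x \<partial>lebesgue) = (\<integral>\<^sup>+x. (\<Sum>S\<in>\<S>. ?v x * indicator S x) \<partial>lebesgue)"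
    using sets by (intro nn_integral_sum[symmetric]) auto
  also have "\<dots> \<le> (\<integral>\<^sup>+x. ?v x * indicator R x \<partial>lebesgue)"
  proof (intro nn_integral_mono)
    fix x
    have "(\<Sum>S\<in>\<S>. indicator S x) = (indicator (\<Union>\<S>) x :: ennreal)"
      using fin disj by (intro indicator_UN_disjoint[of \<S> "\<lambda>S. S" x, unfolded image_ident, symmetric])
        (simp_all add: disjoint_family_on_def pairwise_def disjnt_def)
    also have "\<dots> \<le> indicator R x" using sub by (auto simp: indicator_def)
    finally show "(\<Sum>S\<in>\<S>. ?v x * indicator S x) \<le> ?v x * indicator R x"
      by (simp add: mult_left_mono flip: sum_distrib_left)
  qed
  also have "\<dots> = (\<integral>\<^sup>+x. ?v x \<partial>avg R) * emeasure lebesgue R"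
    by (rule set_integral_avg[OF R]) auto
  also have "\<dots> \<le> ennreal Cv * emeasure lebesgue R"
    by (intro mult_right_mono average_vp_inverse R) auto
  finally have "ennreal (t powr p) * (\<Sum>S\<in>\<S>. emeasure lebesgue S) \<le> ennreal ?c * (ennreal Cv * emeasure lebesgue R)"
    by (simp add: mult_left_mono)
  then show ?thesis using Cv_pos by (simp add: Cb_def ennreal_mult mult.assoc)
qed

end

section \<open>Summation over disjoint rectangles\<close>

context dyadic_grids
begin

lemma sum_emeasure_rects:
  assumes "\<S> \<subseteq> rects D1 D2"
  shows "(\<Sum>S\<in>\<S>. emeasure lebesgue S) = ennreal (\<Sum>S\<in>\<S>. measure lebesgue S)"
proof -
  have "(\<Sum>S\<in>\<S>. emeasure lebesgue S) = (\<Sum>S\<in>\<S>. ennreal (measure lebesgue S))"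
    using assms rect_facts(3) by (intro sum.cong) blast+
  then show ?thesis by simp
qed

lemma sum_disjoint_emeasure_le:
  assumes "finite \<S>" "disjoint \<S>" "\<S> \<subseteq> rects D1 D2" "\<And>S. S \<in> \<S> \<Longrightarrow> S \<subseteq> \<Omega>" "\<Omega> \<in> sets lebesgue"
  shows "(\<Sum>S\<in>\<S>. emeasure lebesgue S) \<le> emeasure lebesgue \<Omega>"
proof -
  have "(\<Sum>S\<in>\<S>. emeasure lebesgue S) = emeasure lebesgue (\<Union>\<S>)"
    using assms rect_facts(1) by (intro emeasure_Union_disjoint[symmetric]) auto
  also have "\<dots> \<le> emeasure lebesgue \<Omega>" using assms by (intro emeasure_mono) auto
  finally show ?thesis .
qed

lemma sum_disjoint_nn_integral_le:
  assumes "finite \<S>" "disjoint \<S>" "\<S> \<subseteq> rects D1 D2" "\<And>S. S \<in> \<S> \<Longrightarrow> S \<subseteq> \<Omega>"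
    and [measurable]: "f \<in> borel_measurable lebesgue"
  shows "(\<Sum>S\<in>\<S>. \<integral>\<^sup>+x\<in>S. f x \<partial>lebesgue) \<le> (\<integral>\<^sup>+x\<in>\<Omega>. f x \<partial>lebesgue)"
proof -
  have sets: "S \<in> sets lebesgue" if "S \<in> \<S>" for S using assms(3) that rect_facts(1) by blast
  have "(\<Sum>S\<in>\<S>. \<integral>\<^sup>+x\<in>S. f x \<partial>lebesgue) = (\<integral>\<^sup>+x. (\<Sum>S\<in>\<S>. f x * indicator S x) \<partial>lebesgue)"
    using sets by (intro nn_integral_sum[symmetric]) auto
  also have "\<dots> \<le> (\<integral>\<^sup>+x\<in>\<Omega>. f x \<partial>lebesgue)"
  proof (intro nn_integral_mono)
    fix x
    have "(\<Sum>S\<in>\<S>. indicator S x) = (indicator (\<Union>\<S>) x :: ennreal)"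
      using assms(1,2) by (intro indicator_UN_disjoint[of \<S> "\<lambda>S. S" x, unfolded image_ident, symmetric])
        (simp_all add: disjoint_family_on_def pairwise_def disjnt_def)
    also have "\<dots> \<le> indicator \<Omega> x" using assms(4) by (auto simp: indicator_def)
    finally show "(\<Sum>S\<in>\<S>. f x * indicator S x) \<le> f x * indicator \<Omega> x"
      by (simp add: mult_left_mono flip: sum_distrib_left)
  qed
  finally show ?thesis .
qed

end

section \<open>A maximal function of Christ--Goldberg type\<close>

context reduced_weight
begin

lemma opnorm_Vred_self: "R \<in> rects D1 D2 \<Longrightarrow> opnorm (Vred R ** matrix_inv (Vred R)) \<le> 1"
  by (simp add: Vred_inv) (rule opnorm_le, simp)

lemma w_le_mult_const:
  assumes "R \<in> rects D1 D2" "opnorm (Vred S ** matrix_inv (Vred R)) \<le> t"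
  shows "w S x \<le> t * w R x"
  using w_le_mult[OF assms(1), of S x] mult_right_mono[OF assms(2), of "w R x"] by simp

text \<open>The level at which the packing bound leaves at most the share \<open>1 / (4 * M)\<close>
  of a rectangle. The maximum with 1 keeps the ratio of a rectangle to itself from exceeding
  it.\<close>

definition lam :: "real \<Rightarrow> real" where "lam M = max 1 (4 * M * Cb) powr (1 / p)"

lemma lam: "1 \<le> lam M" "4 * M * Cb \<le> lam M powr p"
proof -
  show "1 \<le> lam M" unfolding lam_def using p by (intro ge_one_powr_ge_zero) auto
  have "lam M powr p = max 1 (4 * M * Cb)" using p by (simp add: lam_def powr_powr)
  then show "4 * M * Cb \<le> lam M powr p" by simp
qed

lemma disjoint_large_ratio_measure:
  assumes R: "R \<in> rects D1 D2" and fin: "finite \<S>" and disj: "disjoint \<S>" and M: "0 \<le> M"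
    and sub: "\<And>S. S \<in> \<S> \<Longrightarrow> S \<in> rects D1 D2 \<and> S \<subseteq> R \<and> lam M \<le> opnorm (Vred S ** matrix_inv (Vred R))"
  shows "4 * M * (\<Sum>S\<in>\<S>. measure lebesgue S) \<le> measure lebesgue R"
proof -
  let ?s = "\<Sum>S\<in>\<S>. measure lebesgue S"
  have "(\<Sum>S\<in>\<S>. emeasure lebesgue S) = ennreal ?s"
    using sub by (intro sum_emeasure_rects) auto
  then have "ennreal (lam M powr p) * ennreal ?s \<le> ennreal Cb * ennreal (measure lebesgue R)"
    using disjoint_large_ratio[OF R fin disj sub] lam[of M] rect_facts(3)[OF R] by simp
  then have "lam M powr p * ?s \<le> Cb * measure lebesgue R"
    using Cb_pos by (simp add: sum_nonneg flip: ennreal_mult)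
  moreover have "4 * M * Cb * ?s \<le> lam M powr p * ?s"
    by (intro mult_right_mono lam sum_nonneg) auto
  ultimately have "Cb * (4 * M * ?s) \<le> Cb * measure lebesgue R" by (simp add: mult_ac)
  then show ?thesis using Cb_pos by simp
qed

definition C1 :: real where "C1 = 2 * lam 1 powr q * Cw"

lemma C1_nonneg: "0 \<le> C1" using Cw_nonneg by (simp add: C1_def)

text \<open>One stops when \<open>Vred\<close> has grown by more than the factor
  \<open>lam 1\<close>; up to then \<open>w S\<close> is at most \<open>lam 1 * w Q\<close> at every
  point. With \<open>y = 1\<close> the packing bound is the smallness required, and the exponent
  \<open>q\<close> is available because averages of \<open>w Q powr q\<close> are bounded.\<close>

lemma laminar_maximal_w_powr:
  assumes fin: "finite \<Q>" and lam\<Q>: "laminar \<Q>" and sub: "\<Q> \<subseteq> rects D1 D2"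
    and \<Omega>: "\<Omega> \<in> sets lebesgue" "\<And>Q. Q \<in> \<Q> \<Longrightarrow> Q \<subseteq> \<Omega>"
  shows "(\<integral>\<^sup>+x. (SUP Q\<in>\<Q>. indicator Q x * ennreal (w Q x powr q)) \<partial>lebesgue) \<le> ennreal C1 * emeasure lebesgue \<Omega>"
proof -
  define stop where "stop Q S \<longleftrightarrow> lam 1 < opnorm (Vred S ** matrix_inv (Vred Q))" for Q S
  have "(\<integral>\<^sup>+x. (SUP Q\<in>\<Q>. indicator Q x * (1 * ennreal (w Q x powr q))) \<partial>lebesgue)
    \<le> 2 * ennreal (lam 1 powr q) * ennreal Cw * emeasure lebesgue \<Omega>"
  proof (rule stopping_maximal_bound_union[where stop = stop, OF fin lam\<Q>])
    show "\<Q> \<subseteq> sets lebesgue" using sub rect_facts(1) by blast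
    show "(\<integral>\<^sup>+x\<in>Q. ennreal (w Q x powr q) \<partial>lebesgue) \<le> ennreal Cw * emeasure lebesgue Q" if "Q \<in> \<Q>" for Q
      using that sub by (subst set_integral_avg) (auto intro!: mult_right_mono average_w_powr)
    show "1 * ennreal (w S x powr q) \<le> ennreal (lam 1 powr q) * (1 * ennreal (w Q x powr q))"
      if "Q \<in> \<Q>" "\<not> stop Q S" for Q S x
    proof -
      have "w S x \<le> lam 1 * w Q x"
        using that sub by (intro w_le_mult_const) (auto simp: stop_def not_less)
      then have "w S x powr q \<le> (lam 1 * w Q x) powr q" using q by (intro powr_mono2) auto
      then show ?thesis by (simp add: powr_mult flip: ennreal_mult)
    qed
    show "\<not> stop Q Q" if "Q \<in> \<Q>" for Q
      using opnorm_Vred_self[of Q] that sub lam[of 1] by (auto simp: stop_def)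
    show "2 * (\<Sum>S\<in>\<S>. 1 * emeasure lebesgue S) \<le> 1 * emeasure lebesgue Q"
      if "Q \<in> \<Q>" "\<S> \<subseteq> \<Q>" "disjoint \<S>" and st: "\<And>S. S \<in> \<S> \<Longrightarrow> S \<subseteq> Q \<and> stop Q S" for Q \<S>
    proof -
      have "4 * 1 * (\<Sum>S\<in>\<S>. measure lebesgue S) \<le> measure lebesgue Q"
      proof (rule disjoint_large_ratio_measure)
        show "S \<in> rects D1 D2 \<and> S \<subseteq> Q \<and> lam 1 \<le> opnorm (Vred S ** matrix_inv (Vred Q))" if "S \<in> \<S>" for S
          using st[OF that] that \<open>\<S> \<subseteq> \<Q>\<close> sub by (auto simp: stop_def)
      qed (use that sub fin finite_subset in auto)
      then have "2 * (\<Sum>S\<in>\<S>. measure lebesgue S) \<le> measure lebesgue Q"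
        using sum_nonneg[of \<S> "measure lebesgue"] by simp
      then have "ennreal (2 * (\<Sum>S\<in>\<S>. measure lebesgue S)) \<le> ennreal (measure lebesgue Q)"
        by (rule ennreal_leI)
      moreover have "(\<Sum>S\<in>\<S>. 1 * emeasure lebesgue S) = ennreal (\<Sum>S\<in>\<S>. measure lebesgue S)"
        using that sub sum_emeasure_rects[of \<S>] by auto
      ultimately show ?thesis
        using that sub rect_facts(3)[of Q] by (auto simp: ennreal_mult sum_nonneg)
    qed
    show "(\<Sum>S\<in>\<S>. 1 * emeasure lebesgue S) \<le> emeasure lebesgue \<Omega>" if "\<S> \<subseteq> \<Q>" "disjoint \<S>" for \<S>
      unfolding mult_1_left
      by (rule sum_disjoint_emeasure_le) (use that fin sub \<Omega> finite_subset[OF that(1)] in auto)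
  qed simp
  then show ?thesis using Cw_nonneg by (simp add: C1_def ennreal_mult)
qed

text \<open>Solves \<open>Mq powr (1 - q) = 1 / 4\<close>: the rectangles on which \<open>z\<close>
  jumps by more than this factor carry at most a quarter of
  \<open>z Q * measure lebesgue Q\<close>.\<close>

definition Mq :: real where "Mq = 4 powr (1 / (q - 1))"

lemma Mq: "1 \<le> Mq" "Mq powr (1 - q) = 1 / 4"
proof -
  show "1 \<le> Mq" unfolding Mq_def using q by (intro ge_one_powr_ge_zero) auto
  have "1 / (q - 1) * (1 - q) = - 1" using q by (simp add: field_simps)
  then show "Mq powr (1 - q) = 1 / 4" by (simp add: Mq_def powr_powr powr_minus_divide)
qed

definition C2 :: real where "C2 = 2 * (lam Mq * Mq) * (1 + Cw)"

lemma C2_nonneg: "0 \<le> C2" using Cw_nonneg lam[of Mq] Mq by (simp add: C2_def)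

text \<open>There are two causes for stopping, growth of \<open>Vred\<close> and growth of
  \<open>z\<close>, and each is charged a quarter. The maximal members are summed with
  \<open>z S \<le> 1 + z S powr q\<close>, which accounts for the two terms on the right and for the
  drop to an L^1 bound.\<close>

lemma laminar_maximal_weighted_w:
  assumes fin: "finite \<Q>" and lam\<Q>: "laminar \<Q>" and sub: "\<Q> \<subseteq> rects D1 D2"
    and \<Omega>: "\<Omega> \<in> sets lebesgue" "\<And>Q. Q \<in> \<Q> \<Longrightarrow> Q \<subseteq> \<Omega>"
    and [measurable]: "g \<in> borel_measurable lebesgue" and z_nonneg: "\<And>Q. Q \<in> \<Q> \<Longrightarrow> 0 \<le> z Q"
    and z: "\<And>Q. Q \<in> \<Q> \<Longrightarrow> ennreal (z Q powr q * measure lebesgue Q) = (\<integral>\<^sup>+x\<in>Q. ennreal (g x powr q) \<partial>lebesgue)"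
  shows "(\<integral>\<^sup>+x. (SUP Q\<in>\<Q>. indicator Q x * (ennreal (z Q) * ennreal (w Q x))) \<partial>lebesgue)
    \<le> ennreal C2 * (emeasure lebesgue \<Omega> + (\<integral>\<^sup>+x. ennreal (g x powr q) \<partial>lebesgue))"
proof -
  let ?m = "measure lebesgue"
  define stop where
    "stop Q S \<longleftrightarrow> lam Mq < opnorm (Vred S ** matrix_inv (Vred Q)) \<or> Mq * z Q < z S" for Q S
  have to_real: "(\<Sum>S\<in>\<S>. ennreal (z S) * emeasure lebesgue S) = ennreal (\<Sum>S\<in>\<S>. z S * ?m S)" if "\<S> \<subseteq> \<Q>" for \<S>
  proof -
    have "(\<Sum>S\<in>\<S>. ennreal (z S) * emeasure lebesgue S) = (\<Sum>S\<in>\<S>. ennreal (z S * ?m S))"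
    proof (rule sum.cong)
      fix S assume "S \<in> \<S>"
      then have "S \<in> \<Q>" "S \<in> rects D1 D2" using that sub by auto
      then show "ennreal (z S) * emeasure lebesgue S = ennreal (z S * ?m S)"
        using z_nonneg[of S] rect_facts(3)[of S] by (simp only: ennreal_mult measure_nonneg)
    qed simp
    then show ?thesis using that z_nonneg by (subst sum_ennreal[symmetric]) auto
  qed
  have "(\<integral>\<^sup>+x. (SUP Q\<in>\<Q>. indicator Q x * (ennreal (z Q) * ennreal (w Q x))) \<partial>lebesgue)
    \<le> 2 * ennreal (lam Mq * Mq) * ennreal (1 + Cw) * (emeasure lebesgue \<Omega> + (\<integral>\<^sup>+x. ennreal (g x powr q) \<partial>lebesgue))"
  proof (rule stopping_maximal_bound_union[where stop = stop, OF fin lam\<Q>])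
    show "\<Q> \<subseteq> sets lebesgue" using sub rect_facts(1) by blast
    show "(\<integral>\<^sup>+x\<in>Q. ennreal (w Q x) \<partial>lebesgue) \<le> ennreal (1 + Cw) * emeasure lebesgue Q" if "Q \<in> \<Q>" for Q
      using that sub by (subst set_integral_avg) (auto intro!: mult_right_mono average_w)
    show "ennreal (z S) * ennreal (w S x) \<le> ennreal (lam Mq * Mq) * (ennreal (z Q) * ennreal (w Q x))"
      if "Q \<in> \<Q>" "S \<in> \<Q>" "\<not> stop Q S" for Q S x
    proof -
      have "w S x \<le> lam Mq * w Q x"
        using that sub by (intro w_le_mult_const) (auto simp: stop_def not_less)
      moreover have "z S \<le> Mq * z Q" using that by (auto simp: stop_def)
      ultimately have "z S * w S x \<le> (Mq * z Q) * (lam Mq * w Q x)"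
        using z_nonneg that Mq by (intro mult_mono) auto
      then show ?thesis
        using z_nonneg that Mq lam[of Mq] by (simp add: mult_ac flip: ennreal_mult)
    qed
    show "\<not> stop Q Q" if "Q \<in> \<Q>" for Q
    proof -
      have "1 * z Q \<le> Mq * z Q" using z_nonneg[OF that] Mq by (intro mult_right_mono) auto
      then show ?thesis using opnorm_Vred_self[of Q] that sub lam[of Mq] by (auto simp: stop_def)
    qed
    show "2 * (\<Sum>S\<in>\<S>. ennreal (z S) * emeasure lebesgue S) \<le> ennreal (z Q) * emeasure lebesgue Q"
      if Q: "Q \<in> \<Q>" and \<S>: "\<S> \<subseteq> \<Q>" "disjoint \<S>" and st: "\<And>S. S \<in> \<S> \<Longrightarrow> S \<subseteq> Q \<and> stop Q S" for Q \<S>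
    proof -
      have finS: "finite \<S>" using \<S> fin finite_subset by blast
      have QR: "Q \<in> rects D1 D2" and SR: "\<S> \<subseteq> rects D1 D2" using Q \<S> sub by auto
      have zS: "0 \<le> z S" if "S \<in> \<S>" for S using that \<S> z_nonneg by blast
      have zQ: "0 \<le> z Q" using Q z_nonneg by blast
      have mQ: "0 < ?m Q" using rect_facts(2)[OF QR] .
      \<comment> \<open>Jumps of \<open>z\<close> all go to \<open>?B\<close>. Whatever stays in
        \<open>?A\<close> has stopped because of \<open>Vred\<close>, and there
        \<open>z S \<le> Mq * z Q\<close>; the parameter of \<open>lam Mq\<close> compensates this
        factor.\<close>
      let ?A = "{S\<in>\<S>. z S \<le> Mq * z Q}" and ?B = "{S\<in>\<S>. Mq * z Q < z S}"
      have "4 * Mq * (\<Sum>S\<in>?A. ?m S) \<le> ?m Q"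
      proof (rule disjoint_large_ratio_measure[OF QR])
        show "disjoint ?A" using \<S>(2) by (rule pairwise_subset) auto
        show "S \<in> rects D1 D2 \<and> S \<subseteq> Q \<and> lam Mq \<le> opnorm (Vred S ** matrix_inv (Vred Q))" if "S \<in> ?A" for S
          using st[of S] that SR by (auto simp: stop_def)
      qed (use finS Mq in auto)
      then have "z Q * (4 * Mq * (\<Sum>S\<in>?A. ?m S)) \<le> z Q * ?m Q" using zQ by (rule mult_left_mono)
      moreover have "(\<Sum>S\<in>?A. z S * ?m S) \<le> (\<Sum>S\<in>?A. (Mq * z Q) * ?m S)"
        by (intro sum_mono mult_right_mono) auto
      ultimately have A: "4 * (\<Sum>S\<in>?A. z S * ?m S) \<le> z Q * ?m Q"
        by (simp add: sum_distrib_left[symmetric] mult_ac)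
      have "ennreal (\<Sum>S\<in>\<S>. z S powr q * ?m S) = (\<Sum>S\<in>\<S>. ennreal (z S powr q * ?m S))" by simp
      also have "\<dots> = (\<Sum>S\<in>\<S>. \<integral>\<^sup>+x\<in>S. ennreal (g x powr q) \<partial>lebesgue)"
        using z \<S>(1) by (intro sum.cong) auto
      also have "\<dots> \<le> (\<integral>\<^sup>+x\<in>Q. ennreal (g x powr q) \<partial>lebesgue)"
        using st by (intro sum_disjoint_nn_integral_le finS \<S>(2) SR) auto
      also have "\<dots> = ennreal (z Q powr q * ?m Q)" using z[OF Q] by simp
      finally have sum_z: "(\<Sum>S\<in>\<S>. z S powr q * ?m S) \<le> z Q powr q * ?m Q"
        using mQ by (subst (asm) ennreal_le_iff) auto
      \<comment> \<open>If \<open>z Q = 0\<close>, then \<open>sum_z\<close> leaves no room for a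
        member of \<open>?B\<close>. Otherwise the jump makes \<open>z S\<close> at most a quarter
        of \<open>z Q powr (1 - q) * z S powr q\<close>, and these terms are summed by
        \<open>sum_z\<close>.\<close>
      have B: "4 * (\<Sum>S\<in>?B. z S * ?m S) \<le> z Q * ?m Q"
      proof (cases "z Q = 0")
        case True
        have "?B = {}"
        proof (rule ccontr)
          assume "?B \<noteq> {}"
          then obtain S where S: "S \<in> \<S>" "0 < z S" using True by auto
          have "0 < z S powr q * ?m S" using S SR rect_facts(2)[of S] by auto
          also have "\<dots> \<le> (\<Sum>S\<in>\<S>. z S powr q * ?m S)" using finS S by (intro member_le_sum) auto
          finally show False using sum_z True q by simp
        qed
        then have "(\<Sum>S\<in>?B. z S * ?m S) = 0" by (simp only: sum.empty)
        then show ?thesis by (simp only: True)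
      next
        case False
        then have zQ': "0 < z Q" using zQ by simp
        have "z S * ?m S \<le> (1 / 4 * z Q powr (1 - q)) * (z S powr q * ?m S)" if "S \<in> ?B" for S
        proof -
          have pos: "0 < Mq * z Q" using Mq zQ' by simp
          have zS': "Mq * z Q < z S" using that by simp
          then have zSpos: "0 < z S" using pos by linarith
          have "z S = z S powr (1 - q) * z S powr q"
            using zSpos by (simp flip: powr_add)
          also have "\<dots> \<le> (Mq * z Q) powr (1 - q) * z S powr q"
            using pos zS' q by (intro mult_right_mono powr_mono2') auto
          also have "(Mq * z Q) powr (1 - q) = 1 / 4 * z Q powr (1 - q)"
            by (simp only: powr_mult Mq(2))
          finally show ?thesis by (simp only: mult.assoc[symmetric]) (rule mult_right_mono, simp_all)
        qed
        then have "(\<Sum>S\<in>?B. z S * ?m S) \<le> (\<Sum>S\<in>?B. (1 / 4 * z Q powr (1 - q)) * (z S powr q * ?m S))"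
          by (rule sum_mono)
        also have "\<dots> \<le> (\<Sum>S\<in>\<S>. (1 / 4 * z Q powr (1 - q)) * (z S powr q * ?m S))"
          using finS by (intro sum_mono2) auto
        also have "\<dots> \<le> (1 / 4 * z Q powr (1 - q)) * (z Q powr q * ?m Q)"
          unfolding sum_distrib_left[symmetric] by (intro mult_left_mono sum_z) auto
        also have "\<dots> = 1 / 4 * (z Q powr (1 - q) * z Q powr q) * ?m Q" by simp
        also have "z Q powr (1 - q) * z Q powr q = z Q" using zQ' by (simp flip: powr_add)
        finally show ?thesis by simp
      qed
      have "(\<Sum>S\<in>\<S>. z S * ?m S) = (\<Sum>S\<in>?A. z S * ?m S) + (\<Sum>S\<in>?B. z S * ?m S)"
        using finS by (subst sum.union_disjoint[symmetric]) (auto intro!: sum.cong)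
      then have "2 * (\<Sum>S\<in>\<S>. z S * ?m S) \<le> z Q * ?m Q" using A B by simp
      then have "ennreal (2 * (\<Sum>S\<in>\<S>. z S * ?m S)) \<le> ennreal (z Q * ?m Q)" by (rule ennreal_leI)
      then show ?thesis
        using zQ zS to_real[OF \<S>(1)] rect_facts(3)[OF QR] by (simp add: ennreal_mult sum_nonneg)
    qed
    show "(\<Sum>S\<in>\<S>. ennreal (z S) * emeasure lebesgue S) \<le> emeasure lebesgue \<Omega> + (\<integral>\<^sup>+x. ennreal (g x powr q) \<partial>lebesgue)"
      if \<S>: "\<S> \<subseteq> \<Q>" "disjoint \<S>" for \<S>
    proof -
      have finS: "finite \<S>" using \<S> fin finite_subset by blast
      have SR: "\<S> \<subseteq> rects D1 D2" using \<S> sub by auto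
      have "(\<Sum>S\<in>\<S>. ennreal (z S) * emeasure lebesgue S) \<le>
          (\<Sum>S\<in>\<S>. emeasure lebesgue S + (\<integral>\<^sup>+x\<in>S. ennreal (g x powr q) \<partial>lebesgue))"
      proof (rule sum_mono)
        fix S assume S: "S \<in> \<S>"
        then have SQ: "S \<in> \<Q>" and SR': "S \<in> rects D1 D2" using \<S> SR by auto
        have "z S \<le> 1 + z S powr q"
        proof (cases "z S \<le> 1")
          case False
          then have "z S powr 1 \<le> z S powr q" using q by (intro powr_mono) auto
          then show ?thesis using False by simp
        qed (simp add: add_increasing2)
        then have "z S * ?m S \<le> (1 + z S powr q) * ?m S" by (rule mult_right_mono) simp
        then have "ennreal (z S * ?m S) \<le> ennreal (?m S + z S powr q * ?m S)"
          by (intro ennreal_leI) (simp add: distrib_right)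
        then show "ennreal (z S) * emeasure lebesgue S \<le> emeasure lebesgue S + (\<integral>\<^sup>+x\<in>S. ennreal (g x powr q) \<partial>lebesgue)"
          using z_nonneg[OF SQ] by (simp add: z[OF SQ, symmetric] rect_facts(3)[OF SR'] ennreal_mult ennreal_plus)
      qed
      also have "\<dots> = (\<Sum>S\<in>\<S>. emeasure lebesgue S) + (\<Sum>S\<in>\<S>. \<integral>\<^sup>+x\<in>S. ennreal (g x powr q) \<partial>lebesgue)"
        by (rule sum.distrib)
      also have "\<dots> \<le> emeasure lebesgue \<Omega> + (\<integral>\<^sup>+x\<in>UNIV. ennreal (g x powr q) \<partial>lebesgue)"
        using \<Omega> \<S>(1) by (intro add_mono sum_disjoint_emeasure_le sum_disjoint_nn_integral_le finS \<S>(2) SR) auto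
      finally show ?thesis by simp
    qed
  qed simp
  also have "2 * ennreal (lam Mq * Mq) * ennreal (1 + Cw) = ennreal C2"
    using Cw_nonneg lam[of Mq] Mq by (simp add: C2_def ennreal_mult)
  finally show ?thesis .
qed

section \<open>Exchanging rows for columns and the two-parameter maximal bound\<close>

lemma average_norm_le:
  assumes R: "R \<in> rects D1 D2"
  shows "(\<integral>\<^sup>+x. ennreal (norm (vp x *v e)) \<partial>avg R) \<le> ennreal (norm (Vred R *v e))"
proof -
  have "(\<integral>\<^sup>+x. ennreal (norm (vp x *v e) * 1) \<partial>avg R) \<le> ennreal (norm (Vred R *v e) * 1)"
    using p q reducing_lower[OF R] emeasure_avg[OF R] by (intro nn_integral_Holder[of p q]) auto
  then show ?thesis by simp
qed

text \<open>The convexity step of the iteration: replacing the long side \<open>Q1\<close> of \<open>Q1 \<times> Q2\<close> by a short one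
  costs only an average of the one-parameter maximal function \<open>g\<close> of the rows.\<close>

lemma norm_Vred_row_le:
  assumes Q1: "Q1 \<in> D1" and Q2: "Q2 \<in> D2" and I: "I \<in> D1" "I \<subseteq> Q1"
    and A2: "A2 \<subseteq> D2" "finite A2" "disjoint A2" and un: "\<Union>{P\<in>A2. P \<subseteq> Q2} = Q2"
    and [measurable]: "g \<in> borel_measurable lebesgue" and g_nonneg: "\<And>x. 0 \<le> g x"
    and g: "\<And>P x. P \<in> A2 \<Longrightarrow> P \<subseteq> Q2 \<Longrightarrow> x \<in> I \<times> P \<Longrightarrow> w (Q1 \<times> P) x \<le> g x"
    and z: "0 \<le> z" "(\<integral>\<^sup>+x. ennreal (g x powr q) \<partial>avg (I \<times> Q2)) \<le> ennreal (z powr q)"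
  shows "norm (Vred (Q1 \<times> Q2) *v e) \<le> (1 + Cw) * (z * norm (Vred (I \<times> Q2) *v e))"
proof -
  let ?P = "{P\<in>A2. P \<subseteq> Q2}" and ?l = "emeasure lborel" and ?n = "\<lambda>R. ennreal (norm (Vred R *v e))"
  let ?f = "\<lambda>x. ennreal (norm (vp x *v e))" and ?C = "ennreal (1 + Cw)"
  have P: "finite ?P" "\<And>P. P \<in> ?P \<Longrightarrow> P \<in> D2" using A2 by auto
  have [measurable]: "Q1 \<times> P \<in> sets lebesgue" "I \<times> P \<in> sets lebesgue" if "P \<in> ?P" for P
    using rect_facts(1)[OF rectsI] Q1 I(1) P(2)[OF that] by auto
  have split: "(\<integral>\<^sup>+x\<in>X \<times> Q2. h x \<partial>lebesgue) = (\<Sum>P\<in>?P. \<integral>\<^sup>+x\<in>X \<times> P. h x \<partial>lebesgue)"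
    if X: "X \<in> D1" and [measurable]: "h \<in> borel_measurable lebesgue" for X h
  proof -
    have [measurable]: "X \<times> P \<in> sets lebesgue" if "P \<in> ?P" for P
      using rect_facts(1)[OF rectsI] X P(2)[OF that] by auto
    have cover: "X \<times> Q2 = (\<Union>P\<in>?P. X \<times> P)" using un by blast
    have "disjoint_family_on (\<lambda>P. X \<times> P) ?P"
      unfolding disjoint_family_on_def
    proof (intro ballI impI)
      fix P P' assume "P \<in> ?P" "P' \<in> ?P" "P \<noteq> P'"
      then have "P \<inter> P' = {}" using pairwiseD[OF A2(3), of P P'] by (simp add: disjnt_def)
      then show "X \<times> P \<inter> X \<times> P' = {}" by (simp add: Times_Int_Times)
    qed
    then have "indicator (X \<times> Q2) x = (\<Sum>P\<in>?P. indicator (X \<times> P) x :: ennreal)" for x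
      unfolding cover by (rule indicator_UN_disjoint[OF P(1)])
    then have "(\<integral>\<^sup>+x\<in>X \<times> Q2. h x \<partial>lebesgue) = (\<integral>\<^sup>+x. (\<Sum>P\<in>?P. h x * indicator (X \<times> P) x) \<partial>lebesgue)"
      by (simp add: sum_distrib_left)
    also have "\<dots> = (\<Sum>P\<in>?P. \<integral>\<^sup>+x\<in>X \<times> P. h x \<partial>lebesgue)"
      by (intro nn_integral_sum) measurable
    finally show ?thesis .
  qed
  have row: "(\<integral>\<^sup>+x\<in>Q1 \<times> P. ?f x \<partial>lebesgue) \<le> ?l Q1 * (?n (Q1 \<times> P) * ?l P)" if "P \<in> ?P" for P
  proof -
    have R: "Q1 \<times> P \<in> rects D1 D2" by (intro rectsI Q1 P(2) that)
    have "(\<integral>\<^sup>+x\<in>Q1 \<times> P. ?f x \<partial>lebesgue) \<le> ?n (Q1 \<times> P) * emeasure lebesgue (Q1 \<times> P)"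
      by (subst set_integral_avg[OF R]) (auto intro!: mult_right_mono average_norm_le R)
    then show ?thesis by (simp add: times_emeasure[OF Q1 P(2)[OF that]] mult_ac)
  qed
  \<comment> \<open>The norm attached to the long row \<open>Q1 \<times> P\<close> is a constant, so
    it may be integrated over the short piece \<open>I \<times> P\<close> alone; there
    \<open>w (Q1 \<times> P) x \<le> g x\<close> trades it for the values of
    \<open>vp\<close>.\<close>
  have short: "?l I * (?n (Q1 \<times> P) * ?l P) \<le> (\<integral>\<^sup>+x\<in>I \<times> P. ennreal (g x * norm (vp x *v e)) \<partial>lebesgue)"
    if "P \<in> ?P" for P
  proof -
    have "?l I * (?n (Q1 \<times> P) * ?l P) = (\<integral>\<^sup>+x. ?n (Q1 \<times> P) * indicator (I \<times> P) x \<partial>lebesgue)"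
      using times_emeasure[OF I(1) P(2)[OF that]] that by (subst nn_integral_cmult_indicator) (auto simp: mult_ac)
    also have "\<dots> \<le> (\<integral>\<^sup>+x\<in>I \<times> P. ennreal (g x * norm (vp x *v e)) \<partial>lebesgue)"
    proof (rule nn_integral_mono_AE)
      show "AE x in lebesgue. ?n (Q1 \<times> P) * indicator (I \<times> P) x \<le> ennreal (g x * norm (vp x *v e)) * indicator (I \<times> P) x"
        using AE_pos_def
      proof eventually_elim
        case (elim x)
        show ?case
        proof (cases "x \<in> I \<times> P")
          case True
          have "norm (Vred (Q1 \<times> P) *v e) \<le> w (Q1 \<times> P) x * norm (vp x *v e)"
            by (rule norm_Vred_le_w[OF elim])
          also have "\<dots> \<le> g x * norm (vp x *v e)"
            using g[of P x] that True by (intro mult_right_mono) auto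
          finally show ?thesis by (intro mult_right_mono ennreal_leI) auto
        qed simp
      qed
    qed
    finally show ?thesis .
  qed
  have RQ: "Q1 \<times> Q2 \<in> rects D1 D2" and RI: "I \<times> Q2 \<in> rects D1 D2"
    using rectsI Q1 Q2 I by auto
  \<comment> \<open>The ratio of the two lengths is never formed; both stay as factors until
    \<open>?l Q1\<close> cancels. What remains is an average over \<open>I \<times> Q2\<close>,
    which Hoelder splits into \<open>z\<close> and the reducing operator of that column.\<close>
  have "?l Q1 * (?n (Q1 \<times> Q2) * emeasure lebesgue (I \<times> Q2)) = ?l I * (?n (Q1 \<times> Q2) * emeasure lebesgue (Q1 \<times> Q2))"
    by (simp add: times_emeasure Q1 Q2 I mult_ac)
  also have "\<dots> \<le> ?l I * ((?C * (\<integral>\<^sup>+x. ?f x \<partial>avg (Q1 \<times> Q2))) * emeasure lebesgue (Q1 \<times> Q2))"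
    by (intro mult_left_mono mult_right_mono reducing_upper_average RQ) auto
  also have "\<dots> = ?C * (?l I * (\<integral>\<^sup>+x\<in>Q1 \<times> Q2. ?f x \<partial>lebesgue))"
    by (subst set_integral_avg[OF RQ]) (auto simp: mult_ac)
  also have "\<dots> \<le> ?C * (?l I * (\<Sum>P\<in>?P. ?l Q1 * (?n (Q1 \<times> P) * ?l P)))"
    by (subst split[OF Q1]) (auto intro!: mult_left_mono sum_mono row)
  also have "\<dots> = ?l Q1 * (?C * (\<Sum>P\<in>?P. ?l I * (?n (Q1 \<times> P) * ?l P)))"
    by (simp add: sum_distrib_left mult_ac)
  also have "\<dots> \<le> ?l Q1 * (?C * (\<Sum>P\<in>?P. \<integral>\<^sup>+x\<in>I \<times> P. ennreal (g x * norm (vp x *v e)) \<partial>lebesgue))"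
    by (intro mult_left_mono sum_mono short) auto
  also have "\<dots> = ?l Q1 * (?C * (\<integral>\<^sup>+x\<in>I \<times> Q2. ennreal (g x * norm (vp x *v e)) \<partial>lebesgue))"
    by (subst split[OF I(1)]) auto
  also have "\<dots> = ?l Q1 * ((?C * (\<integral>\<^sup>+x. ennreal (g x * norm (vp x *v e)) \<partial>avg (I \<times> Q2))) * emeasure lebesgue (I \<times> Q2))"
    by (subst set_integral_avg[OF RI]) (auto simp: mult_ac)
  finally have "?n (Q1 \<times> Q2) * emeasure lebesgue (I \<times> Q2) \<le>
      (?C * (\<integral>\<^sup>+x. ennreal (g x * norm (vp x *v e)) \<partial>avg (I \<times> Q2))) * emeasure lebesgue (I \<times> Q2)"
    using side_emeasure(1)[OF Q1] by (subst (asm) ennreal_mult_le_mult_iff) auto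
  then have "?n (Q1 \<times> Q2) \<le> ?C * (\<integral>\<^sup>+x. ennreal (g x * norm (vp x *v e)) \<partial>avg (I \<times> Q2))"
    using rect_facts(4,5)[OF RI]
    by (subst (asm) (1 2) mult.commute, subst (asm) ennreal_mult_le_mult_iff) auto
  also have "(\<integral>\<^sup>+x. ennreal (g x * norm (vp x *v e)) \<partial>avg (I \<times> Q2)) \<le> ennreal (z * norm (Vred (I \<times> Q2) *v e))"
    using p q z g_nonneg reducing_lower[OF RI] by (intro nn_integral_Holder[of q p]) auto
  finally have "?n (Q1 \<times> Q2) \<le> ?C * ennreal (z * norm (Vred (I \<times> Q2) *v e))"
    by (simp add: mult_left_mono)
  then have "?n (Q1 \<times> Q2) \<le> ennreal ((1 + Cw) * (z * norm (Vred (I \<times> Q2) *v e)))"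
    using z Cw_nonneg by (subst ennreal_mult) auto
  then show ?thesis using z Cw_nonneg by (subst (asm) ennreal_le_iff) auto
qed

definition CM :: real where "CM = (1 + Cw) * (C2 * (1 + C1))"

lemma CM_nonneg: "0 \<le> CM" using Cw_nonneg C1_nonneg C2_nonneg by (simp add: CM_def)

text \<open>\<open>g\<close> is the maximal function of the rows, with integrable
  \<open>q\<close>-th power, and \<open>z\<close> collects its \<open>q\<close>-averages over the
  columns. The convexity step bounds \<open>w (Q1 \<times> Q2)\<close> by a multiple of
  \<open>z * w\<close> for each column piece of the rectangle, so the supremum passes to the laminar
  family of columns.\<close>

lemma maximal_w_bound:
  assumes fin: "finite G" and sub: "G \<subseteq> D1 \<times> D2" and \<Omega>: "\<Omega> \<in> sets lebesgue" "emeasure lebesgue \<Omega> < top"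
    and sub\<Omega>: "\<And>Q1 Q2. (Q1, Q2) \<in> G \<Longrightarrow> Q1 \<times> Q2 \<subseteq> \<Omega>"
  shows "(\<integral>\<^sup>+x. (SUP (Q1, Q2)\<in>G. indicator (Q1 \<times> Q2) x * ennreal (w (Q1 \<times> Q2) x)) \<partial>lebesgue)
    \<le> ennreal CM * emeasure lebesgue \<Omega>"
proof -
  obtain A1 A2 where A: "A1 \<subseteq> D1" "A2 \<subseteq> D2" "finite A1" "finite A2" "disjoint A1" "disjoint A2"
    and un: "\<forall>(Q1, Q2)\<in>G. \<Union>{I\<in>A1. I \<subseteq> Q1} = Q1 \<and> \<Union>{P\<in>A2. P \<subseteq> Q2} = Q2"
    using common_refinement[OF fin sub] by (elim exE conjE)
  have un1: "\<Union>{I\<in>A1. I \<subseteq> Q1} = Q1" and un2: "\<Union>{P\<in>A2. P \<subseteq> Q2} = Q2"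
    if "(Q1, Q2) \<in> G" for Q1 Q2
    using bspec[OF un that] by auto
  define F1 F2 where "F1 = rows G A2" and "F2 = columns G A1"
  have finF: "finite F1" "finite F2" and rectsF: "F1 \<subseteq> rects D1 D2" "F2 \<subseteq> rects D1 D2"
    and lam1: "laminar F1" and lam2: "laminar F2"
    unfolding F1_def F2_def using rows_laminar[OF fin sub A(4,2,6)] columns_laminar[OF fin sub A(3,1,5)] by auto
  have F1I: "Q1 \<times> P \<in> F1" if "(Q1, Q2) \<in> G" "P \<in> A2" "P \<subseteq> Q2" for Q1 Q2 P
    unfolding F1_def using that by (rule rowsI)
  have F2I: "I \<times> Q2 \<in> F2" if "(Q1, Q2) \<in> G" "I \<in> A1" "I \<subseteq> Q1" for Q1 Q2 I
    unfolding F2_def using that by (rule columnsI)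
  have sub1: "Q \<subseteq> \<Omega>" if Q: "Q \<in> F1" for Q
    using rowsE[OF Q[unfolded F1_def]] sub\<Omega> by fastforce
  have sub2: "Q \<subseteq> \<Omega>" if Q: "Q \<in> F2" for Q
    using columnsE[OF Q[unfolded F2_def]] sub\<Omega> by fastforce
  have [measurable]: "Q \<in> sets lebesgue" if "Q \<in> F1 \<union> F2" for Q
    using that rectsF rect_facts(1) by blast
  define S where "S x = (SUP Q\<in>F1. indicator Q x * ennreal (w Q x powr q))" for x
  have [measurable]: "S \<in> borel_measurable lebesgue"
    unfolding S_def[abs_def] by (intro borel_measurable_SUP countable_finite finF(1)) auto
  have S_fin: "S x < top" for x
  proof -
    have "S x \<le> (\<Sum>Q\<in>F1. indicator Q x * ennreal (w Q x powr q))"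
      unfolding S_def using finF(1)
      by (intro SUP_least member_le_sum[of _ F1 "\<lambda>Q. indicator Q x * ennreal (w Q x powr q)"]) auto
    also have "\<dots> < top" using finF(1) by (auto simp: ennreal_mult_less_top)
    finally show ?thesis .
  qed
  define g where "g x = enn2real (S x) powr (1 / q)" for x
  have g_nonneg: "0 \<le> g x" for x by (simp add: g_def)
  have [measurable]: "g \<in> borel_measurable lebesgue" unfolding g_def[abs_def] by measurable
  have g_powr: "ennreal (g x powr q) = S x" for x
    using S_fin[of x] q by (simp add: g_def powr_powr)
  have w_le_g: "w Q x \<le> g x" if "Q \<in> F1" "x \<in> Q" for Q x
  proof -
    have "ennreal (w Q x powr q) \<le> S x"
      unfolding S_def using that by (intro SUP_upper2[of Q]) auto
    also have "S x = ennreal (g x powr q)" by (simp add: g_powr)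
    finally have "w Q x powr q \<le> g x powr q" by simp
    then have "(w Q x powr q) powr (1 / q) \<le> (g x powr q) powr (1 / q)"
      by (rule powr_mono2[rotated 2]) (use q in auto)
    moreover have "(w Q x powr q) powr (1 / q) = w Q x" "(g x powr q) powr (1 / q) = g x"
      using q g_nonneg by (simp_all add: powr_powr)
    ultimately show ?thesis by (simp only:)
  qed
  have g_int: "(\<integral>\<^sup>+x. ennreal (g x powr q) \<partial>lebesgue) \<le> ennreal C1 * emeasure lebesgue \<Omega>"
    unfolding g_powr unfolding S_def
    by (rule laminar_maximal_w_powr[OF finF(1) lam1 rectsF(1) \<Omega>(1) sub1])
  have g_int_fin: "(\<integral>\<^sup>+x. ennreal (g x powr q) \<partial>lebesgue) < top"
    using \<Omega>(2) by (intro le_less_trans[OF g_int]) (simp add: ennreal_mult_less_top)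
  define N where "N Q = enn2real (\<integral>\<^sup>+x\<in>Q. ennreal (g x powr q) \<partial>lebesgue)" for Q
  have N: "ennreal (N Q) = (\<integral>\<^sup>+x\<in>Q. ennreal (g x powr q) \<partial>lebesgue)" for Q
  proof -
    have "(\<integral>\<^sup>+x\<in>Q. ennreal (g x powr q) \<partial>lebesgue) \<le> (\<integral>\<^sup>+x. ennreal (g x powr q) \<partial>lebesgue)"
      by (intro nn_integral_mono) (auto simp: indicator_def)
    then show ?thesis using g_int_fin by (simp add: N_def)
  qed
  have N_nonneg: "0 \<le> N Q" for Q by (simp add: N_def)
  define z where "z Q = (N Q / measure lebesgue Q) powr (1 / q)" for Q
  have z_nonneg: "0 \<le> z Q" for Q by (simp add: z_def)
  have z_powr: "z Q powr q = N Q / measure lebesgue Q" for Q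
    using q N_nonneg by (simp add: z_def powr_powr)
  have z_eq: "ennreal (z Q powr q * measure lebesgue Q) = (\<integral>\<^sup>+x\<in>Q. ennreal (g x powr q) \<partial>lebesgue)"
    if "Q \<in> F2" for Q
    using rect_facts(2)[of Q] that rectsF by (auto simp: z_powr N)
  have z_avg: "(\<integral>\<^sup>+x. ennreal (g x powr q) \<partial>avg Q) \<le> ennreal (z Q powr q)" if Q: "Q \<in> F2" for Q
  proof -
    have QR: "Q \<in> rects D1 D2" using Q rectsF by blast
    have "(\<integral>\<^sup>+x. ennreal (g x powr q) \<partial>avg Q) = (\<integral>\<^sup>+x\<in>Q. ennreal (g x powr q) \<partial>lebesgue) / emeasure lebesgue Q"
      unfolding avg_def using Q by (intro nn_integral_uniform_measure) auto
    also have "\<dots> = ennreal (N Q / measure lebesgue Q)"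
      unfolding N[symmetric] using rect_facts[OF QR] N_nonneg by (simp add: divide_ennreal)
    finally show ?thesis by (simp add: z_powr)
  qed
  have w_row: "w (Q1 \<times> Q2) x \<le> (1 + Cw) * (z (I \<times> Q2) * w (I \<times> Q2) x)"
    if G: "(Q1, Q2) \<in> G" and I: "I \<in> A1" "I \<subseteq> Q1" for Q1 Q2 I x
  proof -
    have "norm (Vred (Q1 \<times> Q2) *v e) \<le> (1 + Cw) * (z (I \<times> Q2) * norm (Vred (I \<times> Q2) *v e))" for e
    proof (rule norm_Vred_row_le[of Q1 Q2 I A2 g])
      show "w (Q1 \<times> P) x \<le> g x" if "P \<in> A2" "P \<subseteq> Q2" "x \<in> I \<times> P" for P x
        using that I by (intro w_le_g F1I[OF G]) auto
    qed (use G sub I A un2 g_nonneg z_nonneg z_avg F2I in auto)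
    \<comment> \<open>The bound holds for every vector, so \<open>x\<close> may be fixed and
      \<open>e = vm x *v v\<close> inserted; this turns it into a bound of operator norms.\<close>
    from this[of "vm x *v v" for v]
    have "norm ((Vred (Q1 \<times> Q2) ** vm x) *v v) \<le> (1 + Cw) * (z (I \<times> Q2) * norm ((Vred (I \<times> Q2) ** vm x) *v v))" for v
      by (simp add: matrix_vector_mul_assoc)
    also have "\<dots> v \<le> (1 + Cw) * (z (I \<times> Q2) * (opnorm (Vred (I \<times> Q2) ** vm x) * norm v))" for v
      using Cw_nonneg z_nonneg by (intro mult_left_mono norm_matrix_vector_le) auto
    finally show ?thesis unfolding w_def by (intro opnorm_le) (simp add: mult.assoc)
  qed
  let ?M2 = "\<lambda>x. SUP Q\<in>F2. indicator Q x * (ennreal (z Q) * ennreal (w Q x))"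
  have [measurable]: "?M2 \<in> borel_measurable lebesgue"
    by (intro borel_measurable_SUP countable_finite finF(2)) auto
  have "(\<integral>\<^sup>+x. (SUP (Q1, Q2)\<in>G. indicator (Q1 \<times> Q2) x * ennreal (w (Q1 \<times> Q2) x)) \<partial>lebesgue)
      \<le> (\<integral>\<^sup>+x. ennreal (1 + Cw) * ?M2 x \<partial>lebesgue)"
  proof (intro nn_integral_mono SUP_least)
    fix x QQ assume QQ: "QQ \<in> G"
    obtain Q1 Q2 where QQ_eq: "QQ = (Q1, Q2)" by (cases QQ)
    then have G: "(Q1, Q2) \<in> G" using QQ by simp
    have "indicator (Q1 \<times> Q2) x * ennreal (w (Q1 \<times> Q2) x) \<le> ennreal (1 + Cw) * ?M2 x"
    proof (cases "x \<in> Q1 \<times> Q2")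
      case True
      then have "fst x \<in> \<Union>{I\<in>A1. I \<subseteq> Q1}" using un1[OF G] by auto
      then obtain I where I: "I \<in> A1" "I \<subseteq> Q1" "fst x \<in> I" by auto
      then have xI: "x \<in> I \<times> Q2" using True by (simp add: mem_Times_iff)
      have "ennreal (w (Q1 \<times> Q2) x) \<le> ennreal ((1 + Cw) * (z (I \<times> Q2) * w (I \<times> Q2) x))"
        by (intro ennreal_leI w_row G I)
      also have "\<dots> = ennreal (1 + Cw) * (indicator (I \<times> Q2) x * (ennreal (z (I \<times> Q2)) * ennreal (w (I \<times> Q2) x)))"
        using Cw_nonneg z_nonneg xI by (simp add: ennreal_mult)
      also have "\<dots> \<le> ennreal (1 + Cw) * ?M2 x"
        by (intro mult_left_mono SUP_upper F2I[OF G] I) auto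
      finally show ?thesis using True by simp
    qed simp
    then show "(case QQ of (Q1, Q2) \<Rightarrow> indicator (Q1 \<times> Q2) x * ennreal (w (Q1 \<times> Q2) x)) \<le> ennreal (1 + Cw) * ?M2 x"
      by (simp add: QQ_eq)
  qed
  also have "\<dots> = ennreal (1 + Cw) * (\<integral>\<^sup>+x. ?M2 x \<partial>lebesgue)" by (rule nn_integral_cmult) measurable
  also have "\<dots> \<le> ennreal (1 + Cw) * (ennreal C2 * (emeasure lebesgue \<Omega> + (\<integral>\<^sup>+x. ennreal (g x powr q) \<partial>lebesgue)))"
    by (intro mult_left_mono laminar_maximal_weighted_w[OF finF(2) lam2 rectsF(2) \<Omega>(1) sub2] z_nonneg z_eq) auto
  also have "\<dots> \<le> ennreal (1 + Cw) * (ennreal C2 * (emeasure lebesgue \<Omega> + ennreal C1 * emeasure lebesgue \<Omega>))"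
    by (intro mult_left_mono add_left_mono g_int) auto
  also have "\<dots> = ennreal CM * emeasure lebesgue \<Omega>"
    using Cw_nonneg C1_nonneg C2_nonneg by (simp add: CM_def ennreal_mult ennreal_plus distrib_right mult.assoc)
  finally show ?thesis .
qed

end

section \<open>Duality for scalar sequences\<close>

lemma sigma_finite_lebesgue: "sigma_finite_measure (lebesgue :: 'a::euclidean_space measure)"
proof
  obtain A :: "'a set set" where A: "countable A" "A \<subseteq> sets lborel" "\<Union>A = space lborel"
    "\<forall>a\<in>A. emeasure lborel a \<noteq> \<infinity>"
    using lborel.sigma_finite_countable by auto
  then show "\<exists>A. countable A \<and> A \<subseteq> sets lebesgue \<and> \<Union>A = space lebesgue \<and>
      (\<forall>a\<in>A. emeasure (lebesgue :: 'a measure) a \<noteq> \<infinity>)"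
    by (intro exI[of _ A]) (auto simp: subset_eq)
qed

text \<open>Fubini for the region under the graph of \<open>S\<close>; the indicator removes the
  negative levels, above which \<open>S\<close> lies everywhere.\<close>

lemma layer_cake:
  fixes S :: "'a::euclidean_space \<Rightarrow> real"
  assumes [measurable]: "S \<in> borel_measurable lebesgue" and S: "\<And>x. 0 \<le> S x"
  shows "(\<lambda>t. indicator {0..} t * emeasure lebesgue {x. t < S x}) \<in> borel_measurable lborel"
    and "(\<integral>\<^sup>+t. indicator {0..} t * emeasure lebesgue {x. t < S x} \<partial>lborel) = (\<integral>\<^sup>+x. ennreal (S x) \<partial>lebesgue)"
proof -
  interpret L: sigma_finite_measure "lebesgue :: 'a measure" by (rule sigma_finite_lebesgue)
  interpret P: pair_sigma_finite "lborel :: real measure" "lebesgue :: 'a measure" ..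
  let ?f = "\<lambda>t x. indicator {z. 0 \<le> fst z \<and> fst z < S (snd z)} (t, x) :: ennreal"
  have "Measurable.pred (lborel \<Otimes>\<^sub>M lebesgue) (\<lambda>z. 0 \<le> fst z \<and> fst z < S (snd z))" by measurable
  then have "{z. 0 \<le> fst z \<and> fst z < S (snd z)} \<in> sets (lborel \<Otimes>\<^sub>M lebesgue)"
    by (simp add: pred_def space_pair_measure)
  then have f_meas: "case_prod ?f \<in> borel_measurable (lborel \<Otimes>\<^sub>M lebesgue)"
    by (simp add: case_prod_beta')
  have eq: "indicator {0..} t * emeasure lebesgue {x. t < S x} = (\<integral>\<^sup>+x. ?f t x \<partial>lebesgue)" for t
  proof -
    have "Measurable.pred lebesgue (\<lambda>x. t < S x)" by measurable
    then have "{x. t < S x} \<in> sets lebesgue" by (simp add: pred_def)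
    then have "indicator {0..} t * emeasure lebesgue {x. t < S x} = (\<integral>\<^sup>+x. indicator {0..} t * indicator {x. t < S x} x \<partial>lebesgue)"
      by (simp add: nn_integral_cmult)
    also have "\<dots> = (\<integral>\<^sup>+x. ?f t x \<partial>lebesgue)" by (intro nn_integral_cong) (auto simp: indicator_def)
    finally show ?thesis .
  qed
  show "(\<lambda>t. indicator {0..} t * emeasure lebesgue {x. t < S x}) \<in> borel_measurable lborel"
    unfolding eq by (rule L.borel_measurable_nn_integral[OF f_meas])
  have "(\<integral>\<^sup>+t. indicator {0..} t * emeasure lebesgue {x. t < S x} \<partial>lborel) = (\<integral>\<^sup>+x. \<integral>\<^sup>+t. ?f t x \<partial>lborel \<partial>lebesgue)"
    unfolding eq by (rule P.Fubini'[symmetric, OF f_meas])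
  also have "\<dots> = (\<integral>\<^sup>+x. ennreal (S x) \<partial>lebesgue)"
  proof (intro nn_integral_cong)
    fix x
    have "(\<integral>\<^sup>+t. ?f t x \<partial>lborel) = (\<integral>\<^sup>+t. indicator {0..<S x} t \<partial>lborel)"
      by (intro nn_integral_cong) (auto simp: indicator_def)
    then show "(\<integral>\<^sup>+t. ?f t x \<partial>lborel) = ennreal (S x)" using S[of x] by simp
  qed
  finally show "(\<integral>\<^sup>+t. indicator {0..} t * emeasure lebesgue {x. t < S x} \<partial>lborel) = (\<integral>\<^sup>+x. ennreal (S x) \<partial>lebesgue)" .
qed

context dyadic_grids
begin

text \<open>For every rectangle \<open>R\<close>, \<open>\<tau> R\<close> is a median of \<open>S\<close> on \<open>R\<close>. Splitting \<open>a R * b R\<close> as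
  \<open>(a R / sqrt (\<tau> R)) * (sqrt (\<tau> R) * b R)\<close>, the first factors are controlled by \<open>S\<close> on the half of \<open>R\<close> below
  the median, the second ones through the level sets of \<open>S\<close> above it.\<close>

lemma scalar_duality:
  fixes a b :: "('n, 'm) rect \<Rightarrow> real"
  assumes fin: "finite F" and F: "F \<subseteq> rects D1 D2"
    and nonneg: "\<And>R. 0 \<le> a R" "\<And>R. 0 \<le> b R" "0 \<le> \<beta>" "0 \<le> J"
    and H: "\<And>R. R \<in> F \<Longrightarrow> H R \<in> sets lebesgue \<and> H R \<subseteq> R"
    and H_large: "\<And>R. R \<in> F \<Longrightarrow> 4 * measure lebesgue (R - H R) \<le> measure lebesgue R"
    and bmo: "\<And>\<Omega>. \<Omega> \<in> sets lebesgue \<Longrightarrow> 0 < emeasure lebesgue \<Omega> \<Longrightarrow> emeasure lebesgue \<Omega> < top \<Longrightarrow>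
      ennreal (\<Sum>R\<in>{R\<in>F. R \<subseteq> \<Omega>}. (b R)\<^sup>2) \<le> ennreal (\<beta>\<^sup>2) * emeasure lebesgue \<Omega>"
    and J: "(\<integral>\<^sup>+x. ennreal (sqrt (\<Sum>R\<in>F. (a R)\<^sup>2 / measure lebesgue R * indicator (H R) x)) \<partial>lebesgue) \<le> ennreal J"
  shows "(\<Sum>R\<in>F. a R * b R) \<le> 8 * \<beta> * J"
proof -
  let ?m = "measure lebesgue"
  define S where "S x = sqrt (\<Sum>R\<in>F. (a R)\<^sup>2 / ?m R * indicator (H R) x)" for x
  have [measurable]: "R \<in> sets lebesgue" "H R \<in> sets lebesgue" if "R \<in> F" for R
    using that H F rect_facts(1) by blast+
  have [measurable]: "S \<in> borel_measurable lebesgue" unfolding S_def[abs_def] by measurable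
  have S_nonneg: "0 \<le> S x" for x by (simp add: S_def sum_nonneg)
  have S_J: "(\<integral>\<^sup>+x. ennreal (S x) \<partial>lebesgue) \<le> ennreal J" using J by (simp add: S_def)
  have mpos: "0 < ?m R" if "R \<in> F" for R using that F rect_facts(2) by blast
  have R_fm: "R \<in> fmeasurable lebesgue" if "R \<in> F" for R
    using that F rect_facts(1,5)[of R] by (intro fmeasurableI) (auto simp: less_top)
  \<comment> \<open>\<open>S\<close> takes finitely many values, so a median can be chosen as a
    least admissible value instead of an infimum.\<close>
  have "range S \<subseteq> (\<lambda>T. sqrt (\<Sum>R\<in>T. (a R)\<^sup>2 / ?m R)) ` Pow F"
  proof
    fix y assume "y \<in> range S"
    then obtain x where "y = S x" by blast
    also have "S x = sqrt (\<Sum>R\<in>{R\<in>F. x \<in> H R}. (a R)\<^sup>2 / ?m R)"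
      unfolding S_def
      by (subst sum.inter_filter[OF fin]) (auto intro!: arg_cong[where f = sqrt] sum.cong simp: indicator_def)
    finally show "y \<in> (\<lambda>T. sqrt (\<Sum>R\<in>T. (a R)\<^sup>2 / ?m R)) ` Pow F" by blast
  qed
  then have "finite (range S)" by (rule finite_subset) (use fin in simp)
  then have finT: "finite (insert 0 (range S))" by simp
  define above where "above t = {x. t < S x}" for t
  have [measurable]: "above t \<in> sets lebesgue" for t
  proof -
    have "Measurable.pred lebesgue (\<lambda>x. t < S x)" by measurable
    then show ?thesis by (simp add: above_def pred_def)
  qed
  \<comment> \<open>Including 0 guarantees a candidate below every nonnegative level, also when
    \<open>S\<close> never vanishes; \<open>below_\<tau>\<close> relies on it.\<close>
  define ok where "ok R = {t\<in>insert 0 (range S). 2 * ?m (R \<inter> above t) \<le> ?m R}" for R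
  define \<tau> where "\<tau> R = Min (ok R)" for R
  have fin_ok: "finite (ok R)" for R using finT by (simp add: ok_def)
  have ok_ne: "ok R \<noteq> {}" for R
  proof -
    have "above (Max (insert 0 (range S))) = {}"
      unfolding above_def using Max_ge[OF finT] by (auto simp: not_less)
    moreover have "Max (insert 0 (range S)) \<in> insert 0 (range S)" using finT by (rule Max_in) simp
    ultimately have "Max (insert 0 (range S)) \<in> ok R" by (simp add: ok_def)
    then show ?thesis by blast
  qed
  have \<tau>_ok: "\<tau> R \<in> ok R" for R unfolding \<tau>_def using fin_ok ok_ne by (rule Min_in)
  have \<tau>_nonneg: "0 \<le> \<tau> R" for R using \<tau>_ok[of R] S_nonneg by (auto simp: ok_def)
  \<comment> \<open>Only candidates compete for the minimum, but \<open>above t\<close> is the same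
    set as \<open>above s\<close> for the largest candidate \<open>s \<le> t\<close>.\<close>
  have below_\<tau>: "?m R < 2 * ?m (R \<inter> above t)" if "0 \<le> t" "t < \<tau> R" for R t
  proof (rule ccontr)
    assume neg: "\<not> ?thesis"
    define s where "s = Max {u\<in>insert 0 (range S). u \<le> t}"
    have fin_u: "finite {u\<in>insert 0 (range S). u \<le> t}" using finT by simp
    have "s \<in> {u\<in>insert 0 (range S). u \<le> t}" unfolding s_def using fin_u that by (intro Max_in) auto
    moreover have "above s = above t"
    proof -
      have "t < S x" if "s < S x" for x
      proof (rule ccontr)
        assume "\<not> t < S x"
        then have "S x \<le> s" unfolding s_def using fin_u by (intro Max_ge) auto
        then show False using that by simp
      qed
      then show ?thesis using \<open>s \<in> _\<close> by (auto simp: above_def)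
    qed
    ultimately have "s \<in> ok R" "s \<le> t" using neg by (auto simp: ok_def)
    then have "\<tau> R \<le> t" unfolding \<tau>_def using Min_le[OF fin_ok] by (meson order_trans)
    then show False using that by simp
  qed
  \<comment> \<open>At most a quarter of \<open>R\<close> lies outside \<open>H R\<close> and at
    most half of it above the median, which leaves a quarter.\<close>
  have H_below: "?m R \<le> 4 * ?m (H R - above (\<tau> R))" if R: "R \<in> F" for R
  proof -
    have "?m R \<le> ?m ((R - H R) \<union> (R \<inter> above (\<tau> R)) \<union> (H R - above (\<tau> R)))"
      using R R_fm[OF R] H[OF R]
      by (intro measure_mono_fmeasurable) (auto intro: fmeasurableI2)
    also have "\<dots> \<le> ?m ((R - H R) \<union> (R \<inter> above (\<tau> R))) + ?m (H R - above (\<tau> R))"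
      using R by (intro measure_Un_le) auto
    also have "\<dots> \<le> ?m (R - H R) + ?m (R \<inter> above (\<tau> R)) + ?m (H R - above (\<tau> R))"
      using R by (intro add_right_mono measure_Un_le) auto
    finally show ?thesis using H_large[OF R] \<tau>_ok[of R] by (simp add: ok_def)
  qed
  let ?F = "{R\<in>F. 0 < a R}"
  have S_ge: "a R / sqrt (?m R) \<le> S x" if "R \<in> F" "x \<in> H R" for R x
  proof -
    have "(a R)\<^sup>2 / ?m R * indicator (H R) x \<le> (\<Sum>R\<in>F. (a R)\<^sup>2 / ?m R * indicator (H R) x)"
      using fin that by (intro member_le_sum) auto
    then have "sqrt ((a R)\<^sup>2 / ?m R) \<le> S x" unfolding S_def using that by (intro real_sqrt_le_mono) simp
    then show ?thesis using nonneg(1)[of R] by (simp add: real_sqrt_divide)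
  qed
  have \<tau>_pos: "0 < \<tau> R" if R: "R \<in> ?F" for R
  proof -
    have "?m (H R - above (\<tau> R)) \<noteq> 0" using H_below[of R] mpos[of R] R by auto
    then have "H R - above (\<tau> R) \<noteq> {}" by (metis measure_empty)
    then obtain x where "x \<in> H R - above (\<tau> R)" by (meson ex_in_conv)
    then have "a R / sqrt (?m R) \<le> \<tau> R" using S_ge[of R x] R by (auto simp: above_def)
    moreover have "0 < a R / sqrt (?m R)" using R mpos by auto
    ultimately show ?thesis by linarith
  qed
  \<comment> \<open>On the remaining quarter \<open>S x \<le> \<tau> R\<close>, so
    \<open>1 / \<tau> R\<close> may be replaced by \<open>1 / S x\<close> under the integral.
    Summing over \<open>R\<close> produces \<open>4 * (S x)\<^sup>2 / S x\<close>.\<close>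
  have first: "(\<Sum>R\<in>?F. (a R)\<^sup>2 / \<tau> R) \<le> 4 * J"
  proof -
    have "ennreal (\<Sum>R\<in>?F. (a R)\<^sup>2 / \<tau> R) = (\<Sum>R\<in>?F. ennreal ((a R)\<^sup>2 / \<tau> R))"
      using \<tau>_nonneg by simp
    also have "\<dots> \<le> (\<Sum>R\<in>?F. \<integral>\<^sup>+x. ennreal (4 * ((a R)\<^sup>2 / ?m R) / S x) * indicator (H R) x \<partial>lebesgue)"
    proof (rule sum_mono)
      fix R assume R: "R \<in> ?F"
      then have RF: "R \<in> F" by simp
      have "(a R)\<^sup>2 / \<tau> R = (a R)\<^sup>2 / ?m R / \<tau> R * ?m R" using mpos[OF RF] by simp
      also have "\<dots> \<le> (a R)\<^sup>2 / ?m R / \<tau> R * (4 * ?m (H R - above (\<tau> R)))"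
        using \<tau>_nonneg by (intro mult_left_mono H_below RF) auto
      finally have "(a R)\<^sup>2 / \<tau> R \<le> 4 * ((a R)\<^sup>2 / ?m R) / \<tau> R * ?m (H R - above (\<tau> R))"
        by (simp add: mult_ac)
      then have "ennreal ((a R)\<^sup>2 / \<tau> R) \<le> ennreal (4 * ((a R)\<^sup>2 / ?m R) / \<tau> R) * ennreal (?m (H R - above (\<tau> R)))"
        using \<tau>_nonneg by (subst ennreal_mult[symmetric]) (auto intro: ennreal_leI)
      also have "ennreal (?m (H R - above (\<tau> R))) = emeasure lebesgue (H R - above (\<tau> R))"
        using R_fm[OF RF] H[OF RF] RF
        by (intro emeasure_eq_measure2[symmetric]) (auto intro: fmeasurableI2)
      also have "ennreal (4 * ((a R)\<^sup>2 / ?m R) / \<tau> R) * \<dots> =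
          (\<integral>\<^sup>+x. ennreal (4 * ((a R)\<^sup>2 / ?m R) / \<tau> R) * indicator (H R - above (\<tau> R)) x \<partial>lebesgue)"
        using RF by (intro nn_integral_cmult_indicator[symmetric]) auto
      also have "\<dots> \<le> (\<integral>\<^sup>+x. ennreal (4 * ((a R)\<^sup>2 / ?m R) / S x) * indicator (H R) x \<partial>lebesgue)"
      proof (intro nn_integral_mono)
        fix x
        show "ennreal (4 * ((a R)\<^sup>2 / ?m R) / \<tau> R) * indicator (H R - above (\<tau> R)) x
            \<le> ennreal (4 * ((a R)\<^sup>2 / ?m R) / S x) * indicator (H R) x"
        proof (cases "x \<in> H R - above (\<tau> R)")
          case True
          have "0 < a R / sqrt (?m R)" using R mpos by auto
          then have "0 < S x" using S_ge[OF RF, of x] True by auto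
          moreover have "S x \<le> \<tau> R" using True by (auto simp: above_def)
          ultimately have "4 * ((a R)\<^sup>2 / ?m R) / \<tau> R \<le> 4 * ((a R)\<^sup>2 / ?m R) / S x"
            by (intro divide_left_mono) auto
          then show ?thesis using True by (auto intro: ennreal_leI)
        qed simp
      qed
      finally show "ennreal ((a R)\<^sup>2 / \<tau> R) \<le> \<dots>" .
    qed
    also have "\<dots> = (\<integral>\<^sup>+x. (\<Sum>R\<in>?F. ennreal (4 * ((a R)\<^sup>2 / ?m R) / S x) * indicator (H R) x) \<partial>lebesgue)"
      by (intro nn_integral_sum[symmetric]) auto
    also have "\<dots> \<le> (\<integral>\<^sup>+x. 4 * ennreal (S x) \<partial>lebesgue)"
    proof (intro nn_integral_mono)
      fix x
      have "(\<Sum>R\<in>?F. ennreal (4 * ((a R)\<^sup>2 / ?m R) / S x) * indicator (H R) x)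
          = (\<Sum>R\<in>?F. ennreal (4 * ((a R)\<^sup>2 / ?m R) / S x * indicator (H R) x))"
        by (intro sum.cong) (auto simp: indicator_def)
      also have "\<dots> = ennreal (\<Sum>R\<in>?F. 4 * ((a R)\<^sup>2 / ?m R) / S x * indicator (H R) x)"
        using S_nonneg by (intro sum_ennreal) (auto simp: indicator_def)
      also have "\<dots> \<le> ennreal (\<Sum>R\<in>F. 4 * ((a R)\<^sup>2 / ?m R) / S x * indicator (H R) x)"
        using fin S_nonneg by (intro ennreal_leI sum_mono2) (auto simp: indicator_def)
      also have "(\<Sum>R\<in>F. 4 * ((a R)\<^sup>2 / ?m R) / S x * indicator (H R) x) =
          4 / S x * (\<Sum>R\<in>F. (a R)\<^sup>2 / ?m R * indicator (H R) x)"
        by (simp add: sum_distrib_left mult_ac)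
      also have "(\<Sum>R\<in>F. (a R)\<^sup>2 / ?m R * indicator (H R) x) = (S x)\<^sup>2"
        by (simp add: S_def sum_nonneg)
      also have "4 / S x * (S x)\<^sup>2 = 4 * S x" by (simp add: power2_eq_square)
      finally show "(\<Sum>R\<in>?F. ennreal (4 * ((a R)\<^sup>2 / ?m R) / S x) * indicator (H R) x) \<le> 4 * ennreal (S x)"
        using S_nonneg by (simp add: ennreal_mult)
    qed
    also have "\<dots> = 4 * (\<integral>\<^sup>+x. ennreal (S x) \<partial>lebesgue)" by (rule nn_integral_cmult) measurable
    also have "\<dots> \<le> 4 * ennreal J" by (intro mult_left_mono S_J) auto
    also have "\<dots> = ennreal (4 * J)" using nonneg by (simp add: ennreal_mult)
    finally show ?thesis using nonneg by simp
  qed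
  \<comment> \<open>For \<open>t < \<tau> R\<close> more than half of \<open>R\<close> lies in
    \<open>above t\<close>, so the strong density bound controls the measure of the union of these
    \<open>R\<close>. The BMO condition is applied to that union, which is no rectangle.\<close>
  have level: "ennreal (\<Sum>R\<in>{R\<in>F. t < \<tau> R}. (b R)\<^sup>2) \<le> ennreal (16 * \<beta>\<^sup>2) * emeasure lebesgue (above t)"
    if t: "0 \<le> t" for t
  proof (cases "{R\<in>F. t < \<tau> R} = {}")
    case True
    then show ?thesis by (simp only: sum.empty ennreal_0 zero_le)
  next
    case False
    let ?\<Omega> = "\<Union>{R\<in>F. t < \<tau> R}"
    let ?G = "{(Q1, Q2)\<in>D1 \<times> D2. Q1 \<times> Q2 \<in> F \<and> t < \<tau> (Q1 \<times> Q2)}"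
    have finG: "finite ?G"
      by (rule finite_subset[OF _ finite_pairs_of_rects[OF fin]]) auto
    have \<Omega>_eq: "?\<Omega> = (\<Union>(Q1, Q2)\<in>?G. Q1 \<times> Q2)"
    proof (intro equalityI subsetI)
      fix x assume "x \<in> ?\<Omega>"
      then obtain R where R: "R \<in> F" "t < \<tau> R" "x \<in> R" by blast
      then obtain Q1 Q2 where "R = Q1 \<times> Q2" "Q1 \<in> D1" "Q2 \<in> D2" using F by (auto simp: rects_def)
      then show "x \<in> (\<Union>(Q1, Q2)\<in>?G. Q1 \<times> Q2)" using R by (intro UN_I[of "(Q1, Q2)"]) auto
    qed auto
    have "emeasure lebesgue ?\<Omega> \<le> 16 * emeasure lebesgue (above t)"
      unfolding \<Omega>_eq
    proof (rule strong_density_union[OF finG])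
      fix Q1 Q2 assume "(Q1, Q2) \<in> ?G"
      then have Q: "Q1 \<times> Q2 \<in> F" "t < \<tau> (Q1 \<times> Q2)" by auto
      have "ennreal (?m (Q1 \<times> Q2)) < ennreal (2 * ?m (Q1 \<times> Q2 \<inter> above t))"
        using below_\<tau>[OF t Q(2)] measure_nonneg[of lebesgue "Q1 \<times> Q2"]
        by (intro ennreal_lessI) linarith+
      moreover have "ennreal (?m (Q1 \<times> Q2 \<inter> above t)) = emeasure lebesgue (above t \<inter> Q1 \<times> Q2)"
        using R_fm[OF Q(1)] Q(1)
        by (subst Int_commute, intro emeasure_eq_measure2[symmetric]) (auto intro: fmeasurableI2)
      moreover have "emeasure lebesgue (Q1 \<times> Q2) = ennreal (?m (Q1 \<times> Q2))"
        using Q F rect_facts(3) by blast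
      ultimately show "emeasure lebesgue (Q1 \<times> Q2) < 2 * emeasure lebesgue (above t \<inter> Q1 \<times> Q2)"
        by (simp add: ennreal_mult)
    qed auto
    moreover have "ennreal (\<Sum>R\<in>{R\<in>F. R \<subseteq> ?\<Omega>}. (b R)\<^sup>2) \<le> ennreal (\<beta>\<^sup>2) * emeasure lebesgue ?\<Omega>"
    proof (rule bmo)
      show \<Omega>_sets: "?\<Omega> \<in> sets lebesgue" using fin by (intro sets.finite_Union) auto
      obtain R where R: "R \<in> F" "t < \<tau> R" using False by blast
      have "0 < emeasure lebesgue R" using R F rect_facts(4)[of R] by (auto simp: zero_less_iff_neq_zero)
      also have "\<dots> \<le> emeasure lebesgue ?\<Omega>" using R \<Omega>_sets by (intro emeasure_mono) auto
      finally show "0 < emeasure lebesgue ?\<Omega>" .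
      have "emeasure lebesgue ?\<Omega> \<le> (\<Sum>R\<in>{R\<in>F. t < \<tau> R}. emeasure lebesgue R)"
        using fin F rect_facts(1)
        by (intro emeasure_subadditive_finite[of _ "\<lambda>R. R", unfolded image_ident]) auto
      also have "\<dots> < top" using F by (subst sum_emeasure_rects) auto
      finally show "emeasure lebesgue ?\<Omega> < top" .
    qed
    moreover have "ennreal (\<Sum>R\<in>{R\<in>F. t < \<tau> R}. (b R)\<^sup>2) \<le> ennreal (\<Sum>R\<in>{R\<in>F. R \<subseteq> ?\<Omega>}. (b R)\<^sup>2)"
      using fin by (intro ennreal_leI sum_mono2) auto
    ultimately have "ennreal (\<Sum>R\<in>{R\<in>F. t < \<tau> R}. (b R)\<^sup>2) \<le> ennreal (\<beta>\<^sup>2) * (16 * emeasure lebesgue (above t))"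
      by (meson order.trans mult_left_mono zero_le)
    then show ?thesis by (simp add: ennreal_mult mult_ac)
  qed
  \<comment> \<open>\<open>\<tau> R\<close> is the length of the interval of levels below it. The
    weighted sum is thus at most the integral over \<open>t\<close> of the sums in
    \<open>level\<close>, and the layer cake formula returns the integral of
    \<open>S\<close>.\<close>
  have second: "(\<Sum>R\<in>?F. \<tau> R * (b R)\<^sup>2) \<le> 16 * \<beta>\<^sup>2 * J"
  proof -
    have "ennreal (\<Sum>R\<in>?F. \<tau> R * (b R)\<^sup>2) \<le> ennreal (\<Sum>R\<in>F. \<tau> R * (b R)\<^sup>2)"
      using fin \<tau>_nonneg by (intro ennreal_leI sum_mono2) auto
    also have "\<dots> = (\<Sum>R\<in>F. ennreal ((b R)\<^sup>2) * ennreal (\<tau> R))"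
      using \<tau>_nonneg by (simp add: mult.commute flip: ennreal_mult)
    also have "\<dots> = (\<Sum>R\<in>F. \<integral>\<^sup>+t. ennreal ((b R)\<^sup>2) * indicator {0..<\<tau> R} t \<partial>lborel)"
      using \<tau>_nonneg by (simp add: nn_integral_cmult)
    also have "\<dots> = (\<integral>\<^sup>+t. (\<Sum>R\<in>F. ennreal ((b R)\<^sup>2) * indicator {0..<\<tau> R} t) \<partial>lborel)"
      by (intro nn_integral_sum[symmetric]) auto
    also have "\<dots> \<le> (\<integral>\<^sup>+t. ennreal (16 * \<beta>\<^sup>2) * (indicator {0..} t * emeasure lebesgue (above t)) \<partial>lborel)"
    proof (intro nn_integral_mono)
      fix t :: real
      show "(\<Sum>R\<in>F. ennreal ((b R)\<^sup>2) * indicator {0..<\<tau> R} t) \<le>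
          ennreal (16 * \<beta>\<^sup>2) * (indicator {0..} t * emeasure lebesgue (above t))"
      proof (cases "0 \<le> t")
        case True
        have "(\<Sum>R\<in>F. ennreal ((b R)\<^sup>2) * indicator {0..<\<tau> R} t) = (\<Sum>R\<in>F. if t < \<tau> R then ennreal ((b R)\<^sup>2) else 0)"
          using True by (intro sum.cong) auto
        also have "\<dots> = ennreal (\<Sum>R\<in>{R\<in>F. t < \<tau> R}. (b R)\<^sup>2)"
          using fin by (simp add: sum.inter_filter[symmetric])
        finally show ?thesis using level[OF True] True by simp
      qed simp
    qed
    also have "\<dots> = ennreal (16 * \<beta>\<^sup>2) * (\<integral>\<^sup>+t. indicator {0..} t * emeasure lebesgue (above t) \<partial>lborel)"
      unfolding above_def by (intro nn_integral_cmult layer_cake(1)) (auto simp: S_nonneg)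
    also have "(\<integral>\<^sup>+t. indicator {0..} t * emeasure lebesgue (above t) \<partial>lborel) = (\<integral>\<^sup>+x. ennreal (S x) \<partial>lebesgue)"
      unfolding above_def by (rule layer_cake(2)) (auto simp: S_nonneg)
    also have "ennreal (16 * \<beta>\<^sup>2) * \<dots> \<le> ennreal (16 * \<beta>\<^sup>2) * ennreal J"
      by (intro mult_left_mono S_J) auto
    also have "\<dots> = ennreal (16 * \<beta>\<^sup>2 * J)" using nonneg by (simp add: ennreal_mult)
    finally show ?thesis using nonneg by simp
  qed
  have "(\<Sum>R\<in>F. a R * b R) = (\<Sum>R\<in>?F. a R * b R)"
    using fin nonneg(1) by (intro sum.mono_neutral_right) (auto simp: less_le)
  also have "\<dots> = (\<Sum>R\<in>?F. (a R / sqrt (\<tau> R)) * (sqrt (\<tau> R) * b R))"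
  proof (rule sum.cong)
    fix R assume "R \<in> ?F"
    then show "a R * b R = (a R / sqrt (\<tau> R)) * (sqrt (\<tau> R) * b R)"
      using \<tau>_pos[of R] by simp
  qed simp
  finally have "(\<Sum>R\<in>F. a R * b R)\<^sup>2 = (\<Sum>R\<in>?F. (a R / sqrt (\<tau> R)) * (sqrt (\<tau> R) * b R))\<^sup>2" by simp
  also have "\<dots> \<le> (\<Sum>R\<in>?F. (a R / sqrt (\<tau> R))\<^sup>2) * (\<Sum>R\<in>?F. (sqrt (\<tau> R) * b R)\<^sup>2)"
    by (rule Cauchy_Schwarz_ineq_sum)
  also have "\<dots> = (\<Sum>R\<in>?F. (a R)\<^sup>2 / \<tau> R) * (\<Sum>R\<in>?F. \<tau> R * (b R)\<^sup>2)"
    using \<tau>_nonneg by (simp add: power_divide power_mult_distrib)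
  also have "\<dots> \<le> (4 * J) * (16 * \<beta>\<^sup>2 * J)"
    using \<tau>_nonneg nonneg by (intro mult_mono first second sum_nonneg) auto
  also have "\<dots> = (8 * \<beta> * J)\<^sup>2" by (simp add: power2_eq_square)
  finally show ?thesis by (rule power2_le_imp_le) (use nonneg in auto)
qed

end

section \<open>Square functions\<close>

lemma ennpow_mono: "0 \<le> s \<Longrightarrow> x \<le> y \<Longrightarrow> ennpow x s \<le> ennpow y s"
  unfolding ennpow_def
  by (auto simp: top_unique less_top intro!: ennreal_leI powr_mono2 enn2real_mono)

lemma borel_measurable_ennpow [measurable (raw)]:
  assumes [measurable]: "f \<in> borel_measurable M"
  shows "(\<lambda>x. ennpow (f x) s) \<in> borel_measurable M"
proof -
  have "f -` {top} \<inter> space M \<in> sets M"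
    by (rule measurable_sets[OF assms]) (simp add: borel_closed)
  then have [measurable]: "{x\<in>space M. f x = top} \<in> sets M" by (simp add: vimage_def Int_def conj_commute)
  have [measurable]: "(\<lambda>x. ennreal (enn2real (f x) powr s)) \<in> borel_measurable M"
    by measurable
  show ?thesis unfolding ennpow_def by measurable
qed

lemma ennpow_half_square: "(ennpow x (1 / 2))\<^sup>2 = x"
proof (cases "x = top")
  case True
  then show ?thesis by (simp add: ennpow_def power2_eq_square ennreal_top_mult)
next
  case False
  then obtain r where r: "x = ennreal r" "0 \<le> r" by (cases x) auto
  then show ?thesis by (simp add: ennpow_ennreal ennreal_power powr_half_sqrt)
qed

lemma ennpow_square_half: "ennpow (x\<^sup>2) (1 / 2) = x"
proof (cases "x = top")
  case True
  then show ?thesis by (simp add: ennpow_def power2_eq_square ennreal_top_mult)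
next
  case False
  then obtain r where r: "x = ennreal r" "0 \<le> r" by (cases x) auto
  then show ?thesis by (simp add: ennpow_ennreal ennreal_power powr_half_sqrt)
qed

lemma ennpow_half_mult: "ennpow (x * y) (1 / 2) = ennpow x (1 / 2) * ennpow y (1 / 2)"
  by (metis ennpow_half_square ennpow_square_half power_mult_distrib)

lemma ennpow_half_ennreal: "0 \<le> r \<Longrightarrow> ennpow (ennreal r) (1 / 2) = ennreal (sqrt r)"
  by (simp add: ennpow_ennreal powr_half_sqrt)

section \<open>Unordered sums of nonnegative extended reals\<close>

lemma infsum_ennreal_SUP:
  fixes f :: "'a \<Rightarrow> ennreal"
  shows "infsum f A = (SUP F\<in>{F. finite F \<and> F \<subseteq> A}. sum f F)"
  by (rule nonneg_infsum_complete) simp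

lemma infsum_ennreal_least:
  fixes f :: "'a \<Rightarrow> ennreal"
  assumes "\<And>F. finite F \<Longrightarrow> F \<subseteq> A \<Longrightarrow> sum f F \<le> c"
  shows "infsum f A \<le> c"
  unfolding infsum_ennreal_SUP using assms by (intro SUP_least) auto

lemma sum_le_infsum_ennreal:
  fixes f :: "'a \<Rightarrow> ennreal"
  assumes "finite F" "F \<subseteq> A"
  shows "sum f F \<le> infsum f A"
  unfolding infsum_ennreal_SUP using assms by (intro SUP_upper) auto

lemma infsum_ennreal_mono:
  fixes f g :: "'a \<Rightarrow> ennreal"
  assumes "\<And>x. x \<in> A \<Longrightarrow> f x \<le> g x"
  shows "infsum f A \<le> infsum g A"
proof (rule infsum_ennreal_least)
  fix F assume F: "finite F" "F \<subseteq> A"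
  then have "sum f F \<le> sum g F" using assms by (intro sum_mono) auto
  also have "\<dots> \<le> infsum g A" by (rule sum_le_infsum_ennreal[OF F])
  finally show "sum f F \<le> infsum g A" .
qed

lemma borel_measurable_infsum_ennreal:
  fixes f :: "'i \<Rightarrow> 'a \<Rightarrow> ennreal"
  assumes "countable A" "\<And>i. i \<in> A \<Longrightarrow> f i \<in> borel_measurable M"
  shows "(\<lambda>x. \<Sum>\<^sub>\<infinity>i\<in>A. f i x) \<in> borel_measurable M"
  unfolding infsum_ennreal_SUP
  by (intro borel_measurable_SUP borel_measurable_sum countable_Collect_finite_subset assms) auto

text \<open>Some finite partial sum comes within \<open>e\<close> of the total; once
  \<open>E n\<close> contains its index set, the rest adds at most \<open>e\<close>.\<close>

lemma infsum_ennreal_tail_tendsto: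
  fixes f :: "'a \<Rightarrow> ennreal"
  assumes fin: "infsum f A < top" and E: "\<And>n. finite (E n)" "\<And>n. E n \<subseteq> A" "mono E" "(\<Union>n. E n) = A"
  shows "(\<lambda>n. infsum f (A - E n)) \<longlonglongrightarrow> 0"
proof (rule tendsto_0_if_Limsup_eq_0_ennreal)
  have "Limsup sequentially (\<lambda>n. infsum f (A - E n)) \<le> 0"
  proof (rule ennreal_le_epsilon)
    fix e :: real assume e: "0 < e"
    show "Limsup sequentially (\<lambda>n. infsum f (A - E n)) \<le> 0 + ennreal e"
    \<comment> \<open>Subtraction on \<open>ennreal\<close> is truncated at 0, so subtracting
      \<open>e\<close> lowers the total only if it is positive.\<close>
    proof (cases "infsum f A = 0")
      case True
      have "infsum f (A - E n) \<le> 0" for n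
        unfolding True[symmetric]
        by (rule infsum_ennreal_least) (rule sum_le_infsum_ennreal, auto)
      then show ?thesis by (intro Limsup_bounded always_eventually) (auto intro: order.trans)
    next
      case False
      obtain r where "infsum f A = ennreal r" "0 \<le> r" using fin by (cases "infsum f A") auto
      with False have "infsum f A - ennreal e < infsum f A"
        using e by (auto simp: ennreal_minus intro!: ennreal_lessI)
      then obtain F where F: "finite F" "F \<subseteq> A" "infsum f A - ennreal e < sum f F"
        unfolding infsum_ennreal_SUP[of f A] less_SUP_iff by auto
      have "\<forall>x\<in>F. \<exists>n. x \<in> E n" using F E(4) by auto
      then obtain m where m: "\<And>x. x \<in> F \<Longrightarrow> x \<in> E (m x)" by metis
      define N where "N = Max (insert 0 (m ` F))"
      have FN: "F \<subseteq> E n" if "N \<le> n" for n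
      proof
        fix x assume x: "x \<in> F"
        then have "m x \<le> N" using F(1) by (simp add: N_def)
        then have "E (m x) \<subseteq> E n" using E(3) that by (auto dest: monoD[of E "m x" n])
        then show "x \<in> E n" using m[OF x] by blast
      qed
      have "infsum f (A - E n) \<le> ennreal e" if n: "N \<le> n" for n
      proof (rule infsum_ennreal_least)
        fix G assume G: "finite G" "G \<subseteq> A - E n"
        have "sum f F + sum f G = sum f (F \<union> G)"
          using F G FN[OF n] by (intro sum.union_disjoint[symmetric]) auto
        also have "\<dots> \<le> infsum f A" using F G by (intro sum_le_infsum_ennreal) auto
        also have "\<dots> \<le> sum f F + ennreal e"
          using F(3) by (auto simp: ennreal_minus_le_iff add.commute dest: less_imp_le)
        finally have "sum f F + sum f G \<le> sum f F + ennreal e" .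
        moreover have "sum f F < top"
          using sum_le_infsum_ennreal[OF F(1,2), of f] fin by (rule le_less_trans)
        ultimately show "sum f G \<le> ennreal e" by (subst (asm) ennreal_add_left_cancel_le) auto
      qed
      then show ?thesis by (intro Limsup_bounded eventually_sequentiallyI[of N]) simp
    qed
  qed
  then show "Limsup sequentially (\<lambda>n. infsum f (A - E n)) = 0" by simp
qed

section \<open>The two-weight setting and the upper bound\<close>

locale bloom_weights = reduced_weight D1 D2 p K V Vred
  for D1 :: "(real^'n) set set" and D2 :: "(real^'m) set set" and p K
    and V :: "(real^'n) \<times> (real^'m) \<Rightarrow> complex^'d^'d" and Vred :: "('n, 'm) rect \<Rightarrow> complex^'d^'d" +
  fixes Ured :: "('n, 'm) rect \<Rightarrow> complex^'d^'d"
  assumes Ured_pos_def: "R \<in> rects D1 D2 \<Longrightarrow> pos_def (Ured R)"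
begin

lemma Ured_inv:
  assumes "R \<in> rects D1 D2"
  shows "Ured R ** matrix_inv (Ured R) = mat 1" "matrix_inv (Ured R) ** Ured R = mat 1"
    "conj_transpose (Ured R) = Ured R" "conj_transpose (matrix_inv (Ured R)) = matrix_inv (Ured R)"
  using Ured_pos_def[OF assms] pos_def_matrix_inv[of "Ured R"] conj_transpose_matrix_inv[of "Ured R"]
  by (auto simp: pos_def_def)

abbreviation idx :: "(('n, 'm) rect \<times> ('n, 'm) signature) set" where
  "idx \<equiv> rects D1 D2 \<times> signatures"

definition sq :: "('n, 'm, 'd) matrix_seq \<Rightarrow> ('n, 'm) rect \<times> ('n, 'm) signature \<Rightarrow> (real^'n) \<times> (real^'m) \<Rightarrow> ennreal" where
  "sq \<Phi> i x = ennreal ((opnorm (vm x ** \<Phi> (fst i) (snd i) ** Ured (fst i)))\<^sup>2) * indicator (fst i) x / emeasure lebesgue (fst i)"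

lemma H1_norm_sq: "H1_norm p D1 D2 Ured V \<Phi> = (\<integral>\<^sup>+x. ennpow (\<Sum>\<^sub>\<infinity>i\<in>idx. sq \<Phi> i x) (1 / 2) \<partial>lebesgue)"
  unfolding H1_norm_def sq_def vm_def case_prod_unfold ..

lemma idx_countable: "countable idx"
  using rects_countable[OF grid1 grid2] by auto

lemma sq_measurable [measurable]: "i \<in> idx \<Longrightarrow> sq \<Phi> i \<in> borel_measurable lebesgue"
  using rect_facts(1)[of "fst i"] unfolding sq_def[abs_def] by (auto intro!: borel_measurable_times_ennreal borel_measurable_divide_ennreal)

lemma infsum_sq_measurable [measurable]: "(\<lambda>x. \<Sum>\<^sub>\<infinity>i\<in>idx. sq \<Phi> i x) \<in> borel_measurable lebesgue"
  by (intro borel_measurable_infsum_ennreal idx_countable sq_measurable)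

text \<open>\<open>nv\<close> and \<open>nb\<close> are the operator norms of the normalized
  coefficients, N and M in the overview.\<close>

definition nv :: "('n, 'm, 'd) matrix_seq \<Rightarrow> ('n, 'm) rect \<Rightarrow> ('n, 'm) signature \<Rightarrow> real" where
  "nv \<Phi> R \<epsilon> = opnorm (matrix_inv (Vred R) ** \<Phi> R \<epsilon> ** Ured R)"

definition nb :: "('n, 'm, 'd) matrix_seq \<Rightarrow> ('n, 'm) rect \<Rightarrow> ('n, 'm) signature \<Rightarrow> real" where
  "nb B R \<epsilon> = opnorm (Vred R ** B R \<epsilon> ** matrix_inv (Ured R))"

lemma nv_nonneg [simp]: "0 \<le> nv \<Phi> R \<epsilon>" by (simp add: nv_def)
lemma nb_nonneg [simp]: "0 \<le> nb B R \<epsilon>" by (simp add: nb_def)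

text \<open>Cyclicity of the trace brings \<open>matrix_inv (Ured R)\<close> next to
  \<open>Ured R\<close>, and \<open>Vred R\<close> meets its inverse in the middle; taking the
  adjoint does no harm since reducing operators are Hermitian.\<close>

lemma trace_pairing:
  assumes R: "R \<in> rects D1 D2"
  shows "trace (conj_transpose B ** \<Phi>) =
    trace (conj_transpose (Vred R ** B ** matrix_inv (Ured R)) ** (matrix_inv (Vred R) ** \<Phi> ** Ured R))"
proof -
  have "conj_transpose (Vred R ** B ** matrix_inv (Ured R)) ** (matrix_inv (Vred R) ** \<Phi> ** Ured R) =
      matrix_inv (Ured R) ** (conj_transpose B ** (Vred R ** matrix_inv (Vred R)) ** \<Phi>) ** Ured R"
    by (simp only: conj_transpose_mult Vred_inv(3)[OF R] Ured_inv(4)[OF R] matrix_mul_assoc)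
  also have "\<dots> = matrix_inv (Ured R) ** (conj_transpose B ** \<Phi> ** Ured R)"
    by (simp add: Vred_inv R matrix_mul_assoc)
  also have "trace \<dots> = trace (conj_transpose B ** \<Phi> ** Ured R ** matrix_inv (Ured R))"
    by (rule trace_mul_sym)
  also have "\<dots> = trace (conj_transpose B ** \<Phi>)"
    by (simp add: Ured_inv R flip: matrix_mul_assoc)
  finally show ?thesis by simp
qed

lemma norm_trace_pairing:
  assumes R: "R \<in> rects D1 D2"
  shows "norm (trace (conj_transpose (B R \<epsilon>) ** \<Phi> R \<epsilon>)) \<le> real CARD('d) * (nb B R \<epsilon> * nv \<Phi> R \<epsilon>)"
  unfolding nb_def nv_def by (subst trace_pairing[OF R]) (rule norm_trace_adjoint_mult_le_opnorm)

lemma bmo_norm_bound: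
  assumes "bmo_norm D1 D2 Ured Vred B \<le> ennreal \<beta>" "0 \<le> \<beta>"
    and \<Omega>: "\<Omega> \<in> sets lebesgue" "0 < emeasure lebesgue \<Omega>" "emeasure lebesgue \<Omega> < top"
    and F: "finite F" "F \<subseteq> {R \<in> rects D1 D2. R \<subseteq> \<Omega>} \<times> signatures"
  shows "ennreal (\<Sum>(R, \<epsilon>)\<in>F. (nb B R \<epsilon>)\<^sup>2) \<le> ennreal (\<beta>\<^sup>2) * emeasure lebesgue \<Omega>"
proof -
  let ?X = "\<Sum>\<^sub>\<infinity>(R, \<epsilon>)\<in>{R \<in> rects D1 D2. R \<subseteq> \<Omega>} \<times> signatures. ennreal ((nb B R \<epsilon>)\<^sup>2)"
  have "ennpow ?X (1 / 2) / ennpow (emeasure lebesgue \<Omega>) (1 / 2) \<le> bmo_norm D1 D2 Ured Vred B"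
    unfolding bmo_norm_def nb_def using \<Omega> by (intro SUP_upper2[of \<Omega>]) auto
  also note assms(1)
  finally have le: "ennpow ?X (1 / 2) / ennpow (emeasure lebesgue \<Omega>) (1 / 2) \<le> ennreal \<beta>" .
  obtain m where m: "emeasure lebesgue \<Omega> = ennreal m" "0 < m"
    using \<Omega> by (cases "emeasure lebesgue \<Omega>") (auto simp: ennreal_less_zero_iff)
  have sm: "ennpow (emeasure lebesgue \<Omega>) (1 / 2) = ennreal (sqrt m)" using m by (simp add: ennpow_half_ennreal)
  have "ennpow ?X (1 / 2) = ennpow ?X (1 / 2) / ennreal (sqrt m) * ennreal (sqrt m)"
    using m by (simp add: ennreal_divide_times ennreal_mult_divide_eq)
  also have "\<dots> \<le> ennreal \<beta> * ennreal (sqrt m)" using le unfolding sm by (rule mult_right_mono) simp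
  finally have "(ennpow ?X (1 / 2))\<^sup>2 \<le> (ennreal \<beta> * ennreal (sqrt m))\<^sup>2" by (rule power_mono) simp
  then have "?X \<le> ennreal (\<beta>\<^sup>2) * emeasure lebesgue \<Omega>"
    using m assms(2) by (simp add: ennpow_half_square power_mult_distrib ennreal_power)
  moreover have "ennreal (\<Sum>(R, \<epsilon>)\<in>F. (nb B R \<epsilon>)\<^sup>2) \<le> ?X"
  proof -
    have "ennreal (\<Sum>(R, \<epsilon>)\<in>F. (nb B R \<epsilon>)\<^sup>2) = (\<Sum>(R, \<epsilon>)\<in>F. ennreal ((nb B R \<epsilon>)\<^sup>2))"
      by (simp add: case_prod_beta)
    also have "\<dots> \<le> ?X" by (rule sum_le_infsum_ennreal[OF F])
    finally show ?thesis .
  qed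
  ultimately show ?thesis by (rule order.trans[rotated])
qed

text \<open>Chebyshev's level: by \<open>Clam powr p = 4 * Cv\<close> it is exceeded on at most a
  quarter of a rectangle, the share that \<open>scalar_duality\<close> allows.\<close>

definition Clam :: real where "Clam = (4 * Cv) powr (1 / p)"
definition Cup :: real where "Cup = real CARD('d) * (8 * Clam)"

lemma Clam_pos: "0 < Clam" and Cup_pos: "0 < Cup"
  using Cv_pos by (simp_all add: Clam_def Cup_def)

text \<open>Here \<open>nv \<Phi> R \<epsilon>\<close> is at most \<open>Clam\<close> times the norm
  of \<open>vm x ** \<Phi> R \<epsilon> ** Ured R\<close>. Positive definiteness is built in so that
  this holds at every point of the set and not just almost everywhere.\<close>

definition good_part :: "('n, 'm) rect \<Rightarrow> ((real^'n) \<times> (real^'m)) set" where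
  "good_part R = {x\<in>R. opnorm (vp x ** matrix_inv (Vred R)) \<le> Clam \<and> pos_def (V x)}"

lemma good_part:
  assumes R: "R \<in> rects D1 D2"
  shows "good_part R \<in> sets lebesgue" "4 * measure lebesgue (R - good_part R) \<le> measure lebesgue R"
proof -
  let ?v = "\<lambda>x. opnorm (vp x ** matrix_inv (Vred R))"
  have [measurable]: "R \<in> sets lebesgue" by (rule rect_facts(1)[OF R])
  have "AE x in lborel. \<not> \<not> pos_def (V x)" using AE_pos_def by (simp add: AE_completion_iff)
  then have "Measurable.pred lebesgue (\<lambda>x. \<not> pos_def (V x))" by (rule sets_completion_AE)
  then have "Measurable.pred lebesgue (\<lambda>x. \<not> \<not> pos_def (V x))" by (rule pred_intros_logic)
  then have [measurable]: "Measurable.pred lebesgue (\<lambda>x. pos_def (V x))" by simp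
  have "Measurable.pred lebesgue (\<lambda>x. x \<in> R \<and> ?v x \<le> Clam \<and> pos_def (V x))" by measurable
  then show G: "good_part R \<in> sets lebesgue" by (simp add: good_part_def pred_def)
  have "emeasure lebesgue (R - good_part R) = (\<integral>\<^sup>+x. indicator (R - good_part R) x \<partial>lebesgue)"
    using G by simp
  also have "\<dots> \<le> (\<integral>\<^sup>+x. ennreal (1 / (4 * Cv)) * (ennreal (?v x powr p) * indicator R x) \<partial>lebesgue)"
  proof (rule nn_integral_mono_AE)
    show "AE x in lebesgue. indicator (R - good_part R) x \<le> ennreal (1 / (4 * Cv)) * (ennreal (?v x powr p) * indicator R x)"
      using AE_pos_def
    proof eventually_elim
      case (elim x)
      show ?case
      proof (cases "x \<in> R - good_part R")
        case True
        then have "Clam \<le> ?v x" using elim by (auto simp: good_part_def)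
        then have "Clam powr p \<le> ?v x powr p" using p Clam_pos by (intro powr_mono2) auto
        moreover have "Clam powr p = 4 * Cv" using p Cv_pos by (simp add: Clam_def powr_powr)
        ultimately have "1 \<le> 1 / (4 * Cv) * ?v x powr p" using Cv_pos by (simp add: field_simps)
        then have "ennreal 1 \<le> ennreal (1 / (4 * Cv) * ?v x powr p)" by (rule ennreal_leI)
        also have "\<dots> = ennreal (1 / (4 * Cv)) * ennreal (?v x powr p)"
          using Cv_pos by (intro ennreal_mult) auto
        finally show ?thesis using True by simp
      qed simp
    qed
  qed
  also have "\<dots> = ennreal (1 / (4 * Cv)) * (\<integral>\<^sup>+x\<in>R. ennreal (?v x powr p) \<partial>lebesgue)"
    by (rule nn_integral_cmult) measurable
  also have "\<dots> \<le> ennreal (1 / (4 * Cv)) * (ennreal Cv * emeasure lebesgue R)"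
    by (subst set_integral_avg[OF R]) (auto intro!: mult_left_mono mult_right_mono average_vp_inverse R)
  also have "\<dots> = ennreal (1 / (4 * Cv) * (Cv * measure lebesgue R))"
    using Cv_pos rect_facts(3)[OF R] by (simp only: ennreal_mult[symmetric] less_imp_le measure_nonneg mult_nonneg_nonneg divide_nonneg_nonneg zero_le_one zero_le_numeral)
  also have "1 / (4 * Cv) * (Cv * measure lebesgue R) = measure lebesgue R / 4" using Cv_pos by simp
  finally have "measure lebesgue (R - good_part R) \<le> measure lebesgue R / 4"
    unfolding measure_def[of lebesgue "R - good_part R"] by (intro enn2real_leI) auto
  then show "4 * measure lebesgue (R - good_part R) \<le> measure lebesgue R" by simp
qed

text \<open>Bounding finite sums of absolute values yields absolute convergence together with the
  estimate. Cauchy-Schwarz over the finitely many signatures leaves one pair \<open>a R\<close>,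
  \<open>b R\<close> per rectangle, to which the scalar duality applies.\<close>

lemma sum_pairing_bound:
  assumes \<beta>: "bmo_norm D1 D2 Ured Vred B \<le> ennreal \<beta>" "0 \<le> \<beta>"
    and h: "H1_norm p D1 D2 Ured V \<Phi> \<le> ennreal h" "0 \<le> h"
    and F: "finite F" "F \<subseteq> idx"
  shows "(\<Sum>(R, \<epsilon>)\<in>F. norm (trace (conj_transpose (B R \<epsilon>) ** \<Phi> R \<epsilon>))) \<le> Cup * (\<beta> * h)"
proof -
  define a where "a R = sqrt (\<Sum>\<epsilon>\<in>signatures. (nv \<Phi> R \<epsilon>)\<^sup>2)" for R
  define b where "b R = sqrt (\<Sum>\<epsilon>\<in>signatures. (nb B R \<epsilon>)\<^sup>2)" for R
  have ab: "0 \<le> a R" "0 \<le> b R" for R by (simp_all add: a_def b_def sum_nonneg)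
  have finS: "finite (signatures :: ('n, 'm) signature set)" by simp
  let ?F = "fst ` F"
  have F1: "finite ?F" "?F \<subseteq> rects D1 D2" using F by auto
  have "(\<Sum>(R, \<epsilon>)\<in>F. norm (trace (conj_transpose (B R \<epsilon>) ** \<Phi> R \<epsilon>)))
      \<le> (\<Sum>(R, \<epsilon>)\<in>?F \<times> signatures. norm (trace (conj_transpose (B R \<epsilon>) ** \<Phi> R \<epsilon>)))"
    using F finS by (intro sum_mono2) (auto intro: rev_image_eqI)
  also have "\<dots> = (\<Sum>R\<in>?F. \<Sum>\<epsilon>\<in>signatures. norm (trace (conj_transpose (B R \<epsilon>) ** \<Phi> R \<epsilon>)))"
    using F1 finS by (intro sum.cartesian_product[symmetric])
  also have "\<dots> \<le> (\<Sum>R\<in>?F. real CARD('d) * (a R * b R))"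
  proof (rule sum_mono)
    fix R assume "R \<in> ?F"
    then have R: "R \<in> rects D1 D2" using F1 by blast
    have "(\<Sum>\<epsilon>\<in>signatures. norm (trace (conj_transpose (B R \<epsilon>) ** \<Phi> R \<epsilon>)))
        \<le> (\<Sum>\<epsilon>\<in>signatures. real CARD('d) * (nb B R \<epsilon> * nv \<Phi> R \<epsilon>))"
      by (intro sum_mono norm_trace_pairing R)
    also have "\<dots> = real CARD('d) * (\<Sum>\<epsilon>\<in>signatures. \<bar>nb B R \<epsilon>\<bar> * \<bar>nv \<Phi> R \<epsilon>\<bar>)"
      by (simp add: sum_distrib_left)
    also have "\<dots> \<le> real CARD('d) * (L2_set (nb B R) signatures * L2_set (nv \<Phi> R) signatures)"
      by (intro mult_left_mono L2_set_mult_ineq) auto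
    finally show "(\<Sum>\<epsilon>\<in>signatures. norm (trace (conj_transpose (B R \<epsilon>) ** \<Phi> R \<epsilon>))) \<le> real CARD('d) * (a R * b R)"
      by (simp add: a_def b_def L2_set_def mult.commute)
  qed
  also have "\<dots> = real CARD('d) * (\<Sum>R\<in>?F. a R * b R)" by (simp add: sum_distrib_left)
  also have "\<dots> \<le> real CARD('d) * (8 * \<beta> * (Clam * h))"
  proof (intro mult_left_mono scalar_duality[where H = good_part])
    show "ennreal (\<Sum>R\<in>{R\<in>?F. R \<subseteq> \<Omega>}. (b R)\<^sup>2) \<le> ennreal (\<beta>\<^sup>2) * emeasure lebesgue \<Omega>"
      if "\<Omega> \<in> sets lebesgue" "0 < emeasure lebesgue \<Omega>" "emeasure lebesgue \<Omega> < top" for \<Omega>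
    proof -
      have "(\<Sum>R\<in>{R\<in>?F. R \<subseteq> \<Omega>}. (b R)\<^sup>2) = (\<Sum>R\<in>{R\<in>?F. R \<subseteq> \<Omega>}. \<Sum>\<epsilon>\<in>signatures. (nb B R \<epsilon>)\<^sup>2)"
        by (simp add: b_def sum_nonneg)
      also have "\<dots> = (\<Sum>(R, \<epsilon>)\<in>{R\<in>?F. R \<subseteq> \<Omega>} \<times> signatures. (nb B R \<epsilon>)\<^sup>2)"
        using F1 finS by (intro sum.cartesian_product)
      finally show ?thesis
        using bmo_norm_bound[OF \<beta> that, of "{R\<in>?F. R \<subseteq> \<Omega>} \<times> signatures"] F1 finS by auto
    qed
    have "(\<integral>\<^sup>+x. ennreal (sqrt (\<Sum>R\<in>?F. (a R)\<^sup>2 / measure lebesgue R * indicator (good_part R) x)) \<partial>lebesgue)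
        \<le> (\<integral>\<^sup>+x. ennreal Clam * ennpow (\<Sum>\<^sub>\<infinity>i\<in>idx. sq \<Phi> i x) (1 / 2) \<partial>lebesgue)"
    proof (intro nn_integral_mono)
      fix x
      let ?s = "\<Sum>R\<in>?F. (a R)\<^sup>2 / measure lebesgue R * indicator (good_part R) x"
      have pt: "ennreal ((nv \<Phi> R \<epsilon>)\<^sup>2 / measure lebesgue R * indicator (good_part R) x) \<le> ennreal (Clam\<^sup>2) * sq \<Phi> (R, \<epsilon>) x"
        if "R \<in> ?F" for R \<epsilon>
      proof (cases "x \<in> good_part R")
        case True
        have R: "R \<in> rects D1 D2" using that F1 by blast
        have x: "x \<in> R" "opnorm (vp x ** matrix_inv (Vred R)) \<le> Clam" "pos_def (V x)"
          using True by (auto simp: good_part_def)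
        have "matrix_inv (Vred R) ** \<Phi> R \<epsilon> ** Ured R = (matrix_inv (Vred R) ** vp x) ** (vm x ** \<Phi> R \<epsilon> ** Ured R)"
        proof -
          have "(matrix_inv (Vred R) ** vp x) ** (vm x ** \<Phi> R \<epsilon> ** Ured R) =
              matrix_inv (Vred R) ** (vp x ** vm x) ** \<Phi> R \<epsilon> ** Ured R" by (simp only: matrix_mul_assoc)
          then show ?thesis by (simp add: vp_vm(1)[OF x(3)])
        qed
        then have "nv \<Phi> R \<epsilon> \<le> opnorm (matrix_inv (Vred R) ** vp x) * opnorm (vm x ** \<Phi> R \<epsilon> ** Ured R)"
          unfolding nv_def by (simp only: opnorm_mult_le)
        also have "opnorm (matrix_inv (Vred R) ** vp x) = opnorm (vp x ** matrix_inv (Vred R))"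
          by (intro opnorm_mult_swap Vred_inv(4)[OF R] vp_vm(3)[OF x(3)])
        also have "\<dots> * opnorm (vm x ** \<Phi> R \<epsilon> ** Ured R) \<le> Clam * opnorm (vm x ** \<Phi> R \<epsilon> ** Ured R)"
          using x by (intro mult_right_mono) auto
        finally have "(nv \<Phi> R \<epsilon>)\<^sup>2 \<le> (Clam * opnorm (vm x ** \<Phi> R \<epsilon> ** Ured R))\<^sup>2"
          by (intro power_mono) auto
        then have "(nv \<Phi> R \<epsilon>)\<^sup>2 / measure lebesgue R \<le> Clam\<^sup>2 * ((opnorm (vm x ** \<Phi> R \<epsilon> ** Ured R))\<^sup>2 / measure lebesgue R)"
          using rect_facts(2)[OF R] by (simp add: power_mult_distrib divide_right_mono)
        then have "ennreal ((nv \<Phi> R \<epsilon>)\<^sup>2 / measure lebesgue R) \<le>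
            ennreal (Clam\<^sup>2) * ennreal ((opnorm (vm x ** \<Phi> R \<epsilon> ** Ured R))\<^sup>2 / measure lebesgue R)"
          by (subst ennreal_mult[symmetric]) (auto intro: ennreal_leI)
        also have "ennreal ((opnorm (vm x ** \<Phi> R \<epsilon> ** Ured R))\<^sup>2 / measure lebesgue R) = sq \<Phi> (R, \<epsilon>) x"
          unfolding sq_def fst_conv snd_conv rect_facts(3)[OF R]
          using x rect_facts(2)[OF R] by (simp add: divide_ennreal)
        finally show ?thesis using True by simp
      qed simp
      have "ennreal ?s = ennreal (\<Sum>(R, \<epsilon>)\<in>?F \<times> signatures. (nv \<Phi> R \<epsilon>)\<^sup>2 / measure lebesgue R * indicator (good_part R) x)"
        using F1 finS by (subst sum.cartesian_product[symmetric])
          (simp add: a_def sum_nonneg sum_divide_distrib sum_distrib_right)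
      also have "\<dots> = (\<Sum>(R, \<epsilon>)\<in>?F \<times> signatures. ennreal ((nv \<Phi> R \<epsilon>)\<^sup>2 / measure lebesgue R * indicator (good_part R) x))"
        by (subst sum_ennreal[symmetric]) (auto simp: case_prod_beta)
      also have "\<dots> \<le> (\<Sum>i\<in>?F \<times> signatures. ennreal (Clam\<^sup>2) * sq \<Phi> i x)"
      proof (rule sum_mono)
        fix i assume i: "i \<in> ?F \<times> (signatures :: ('n, 'm) signature set)"
        show "(case i of (R, \<epsilon>) \<Rightarrow> ennreal ((nv \<Phi> R \<epsilon>)\<^sup>2 / measure lebesgue R * indicator (good_part R) x)) \<le> ennreal (Clam\<^sup>2) * sq \<Phi> i x"
          using pt[of "fst i" "snd i"] i unfolding case_prod_beta prod.collapse by (simp only: mem_Times_iff)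
      qed
      also have "\<dots> = ennreal (Clam\<^sup>2) * (\<Sum>i\<in>?F \<times> signatures. sq \<Phi> i x)" by (simp add: sum_distrib_left)
      also have "\<dots> \<le> ennreal (Clam\<^sup>2) * (\<Sum>\<^sub>\<infinity>i\<in>idx. sq \<Phi> i x)"
        using F1 finS by (intro mult_left_mono sum_le_infsum_ennreal) auto
      finally have "ennpow (ennreal ?s) (1 / 2) \<le> ennpow (ennreal (Clam\<^sup>2) * (\<Sum>\<^sub>\<infinity>i\<in>idx. sq \<Phi> i x)) (1 / 2)"
        by (rule ennpow_mono[rotated]) simp
      then show "ennreal (sqrt ?s) \<le> ennreal Clam * ennpow (\<Sum>\<^sub>\<infinity>i\<in>idx. sq \<Phi> i x) (1 / 2)"
        using Clam_pos
        by (simp add: ennpow_half_mult ennpow_half_ennreal sum_nonneg)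
    qed
    also have "\<dots> = ennreal Clam * H1_norm p D1 D2 Ured V \<Phi>"
      unfolding H1_norm_sq by (rule nn_integral_cmult) measurable
    also have "\<dots> \<le> ennreal Clam * ennreal h" by (intro mult_left_mono h) auto
    also have "\<dots> = ennreal (Clam * h)" using Clam_pos h by (simp add: ennreal_mult)
    finally show "(\<integral>\<^sup>+x. ennreal (sqrt (\<Sum>R\<in>?F. (a R)\<^sup>2 / measure lebesgue R * indicator (good_part R) x)) \<partial>lebesgue)
        \<le> ennreal (Clam * h)" .
  qed (use F1 ab \<beta> h Clam_pos good_part in \<open>auto simp: good_part_def[of _]\<close>)
  finally show ?thesis by (simp add: Cup_def mult_ac)
qed

section \<open>Norms of finite sequences and the lower bound\<close>

definition Ct :: real where "Ct = sqrt (CM * (1 + Cw))"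

lemma Ct_nonneg: "0 \<le> Ct" using CM_nonneg Cw_nonneg by (simp add: Ct_def)

text \<open>Up to normalization each term of the square function is at most \<open>w R x\<close>
  times \<open>(nv \<Phi> R \<epsilon>)\<^sup>2 * w R x\<close>. The first factor goes into the
  supremum \<open>X\<close>, whose integral is the maximal bound; the second is summed into
  \<open>Y\<close>, whose integral needs averages of \<open>w R\<close> only. Cauchy-Schwarz for the
  square roots of \<open>X\<close> and \<open>Y\<close> gives \<open>Ct\<close>.\<close>

lemma finite_support_H1_norm:
  assumes F: "finite F" "F \<subseteq> idx" and supp: "\<And>R \<epsilon>. (R, \<epsilon>) \<notin> F \<Longrightarrow> \<Phi> R \<epsilon> = 0"
    and \<Omega>: "\<Omega> \<in> sets lebesgue" "emeasure lebesgue \<Omega> = ennreal m" "0 \<le> m" "\<And>R \<epsilon>. (R, \<epsilon>) \<in> F \<Longrightarrow> R \<subseteq> \<Omega>"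
  shows "H1_norm p D1 D2 Ured V \<Phi> \<le> ennreal (Ct * sqrt (m * (\<Sum>(R, \<epsilon>)\<in>F. (nv \<Phi> R \<epsilon>)\<^sup>2)))"
proof -
  let ?G = "{(Q1, Q2)\<in>D1 \<times> D2. Q1 \<times> Q2 \<in> fst ` F}"
  define X where "X x = (SUP (Q1, Q2)\<in>?G. indicator (Q1 \<times> Q2) x * ennreal (w (Q1 \<times> Q2) x))" for x
  define Y where "Y x = (\<Sum>i\<in>F. ennreal ((nv \<Phi> (fst i) (snd i))\<^sup>2) * (ennreal (w (fst i) x) * indicator (fst i) x / emeasure lebesgue (fst i)))" for x
  have finG: "finite ?G" using F by (intro finite_pairs_of_rects) auto
  have F_rects: "fst i \<in> rects D1 D2" if "i \<in> F" for i using that F by auto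
  have [measurable]: "fst i \<in> sets lebesgue" if "i \<in> F" for i using F_rects[OF that] rect_facts(1) by blast
  have [measurable]: "Q1 \<times> Q2 \<in> sets lebesgue" if "(Q1, Q2) \<in> ?G" for Q1 Q2
    using that rect_facts(1)[OF rectsI] by auto
  have [measurable]: "X \<in> borel_measurable lebesgue"
    unfolding X_def[abs_def] by (intro borel_measurable_SUP countable_finite finG) (auto intro!: borel_measurable_times_ennreal)
  have [measurable]: "Y \<in> borel_measurable lebesgue"
    unfolding Y_def[abs_def] by (intro borel_measurable_sum borel_measurable_times_ennreal borel_measurable_divide_ennreal) auto
  have X_int: "(\<integral>\<^sup>+x. X x \<partial>lebesgue) \<le> ennreal CM * ennreal m"
    unfolding X_def \<Omega>(2)[symmetric]
  proof (rule maximal_w_bound[OF finG])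
    show "Q1 \<times> Q2 \<subseteq> \<Omega>" if "(Q1, Q2) \<in> ?G" for Q1 Q2
      using that \<Omega>(4) by force
  qed (use \<Omega> in auto)
  have Y_int: "(\<integral>\<^sup>+x. Y x \<partial>lebesgue) \<le> ennreal (1 + Cw) * ennreal (\<Sum>(R, \<epsilon>)\<in>F. (nv \<Phi> R \<epsilon>)\<^sup>2)"
  proof -
    have "(\<integral>\<^sup>+x. Y x \<partial>lebesgue) = (\<Sum>i\<in>F. ennreal ((nv \<Phi> (fst i) (snd i))\<^sup>2) * (\<integral>\<^sup>+x. ennreal (w (fst i) x) \<partial>avg (fst i)))"
      unfolding Y_def
    proof (subst nn_integral_sum)
      show "(\<Sum>i\<in>F. \<integral>\<^sup>+x. ennreal ((nv \<Phi> (fst i) (snd i))\<^sup>2) * (ennreal (w (fst i) x) * indicator (fst i) x / emeasure lebesgue (fst i)) \<partial>lebesgue) =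
          (\<Sum>i\<in>F. ennreal ((nv \<Phi> (fst i) (snd i))\<^sup>2) * (\<integral>\<^sup>+x. ennreal (w (fst i) x) \<partial>avg (fst i)))"
      proof (rule sum.cong)
        fix i assume i: "i \<in> F"
        have "(\<integral>\<^sup>+x. ennreal (w (fst i) x) \<partial>avg (fst i)) = (\<integral>\<^sup>+x. ennreal (w (fst i) x) * indicator (fst i) x / emeasure lebesgue (fst i) \<partial>lebesgue)"
          unfolding avg_def using i by (subst nn_integral_uniform_measure) (auto simp: nn_integral_divide)
        then show "(\<integral>\<^sup>+x. ennreal ((nv \<Phi> (fst i) (snd i))\<^sup>2) * (ennreal (w (fst i) x) * indicator (fst i) x / emeasure lebesgue (fst i)) \<partial>lebesgue) =
            ennreal ((nv \<Phi> (fst i) (snd i))\<^sup>2) * (\<integral>\<^sup>+x. ennreal (w (fst i) x) \<partial>avg (fst i))"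
          using i by (simp only:) (rule nn_integral_cmult, auto intro!: borel_measurable_times_ennreal borel_measurable_divide_ennreal)
      qed simp
    qed (auto intro!: borel_measurable_times_ennreal borel_measurable_divide_ennreal)
    also have "\<dots> \<le> (\<Sum>i\<in>F. ennreal ((nv \<Phi> (fst i) (snd i))\<^sup>2) * ennreal (1 + Cw))"
      by (intro sum_mono mult_left_mono average_w F_rects) auto
    also have "\<dots> = ennreal (1 + Cw) * ennreal (\<Sum>(R, \<epsilon>)\<in>F. (nv \<Phi> R \<epsilon>)\<^sup>2)"
      by (subst sum_distrib_right[symmetric]) (simp add: mult.commute case_prod_beta)
    finally show ?thesis .
  qed
  have sq_XY: "(\<Sum>\<^sub>\<infinity>i\<in>idx. sq \<Phi> i x) \<le> X x * Y x" if x: "pos_def (V x)" for x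
  proof -
    have zero: "sq \<Phi> i x = 0" if "i \<in> idx - F" for i
    proof -
      have "\<Phi> (fst i) (snd i) = 0" using supp[of "fst i" "snd i"] that by auto
      then show ?thesis by (simp add: sq_def)
    qed
    have "(\<Sum>\<^sub>\<infinity>i\<in>idx. sq \<Phi> i x) = (\<Sum>\<^sub>\<infinity>i\<in>F. sq \<Phi> i x)"
      using F zero by (intro infsum_cong_neutral) auto
    also have "\<dots> = (\<Sum>i\<in>F. sq \<Phi> i x)" using F by simp
    also have "\<dots> \<le> (\<Sum>i\<in>F. X x * (ennreal ((nv \<Phi> (fst i) (snd i))\<^sup>2) * (ennreal (w (fst i) x) * indicator (fst i) x / emeasure lebesgue (fst i))))"
    proof (rule sum_mono)
      fix i assume i: "i \<in> F"
      let ?R = "fst i" and ?\<epsilon> = "snd i"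
      have R: "?R \<in> rects D1 D2" by (rule F_rects[OF i])
      show "sq \<Phi> i x \<le> X x * (ennreal ((nv \<Phi> ?R ?\<epsilon>)\<^sup>2) * (ennreal (w ?R x) * indicator ?R x / emeasure lebesgue ?R))"
      proof (cases "x \<in> ?R")
        case True
        have wX: "ennreal (w ?R x) \<le> X x"
        proof -
          obtain Q1 Q2 where Q: "?R = Q1 \<times> Q2" "Q1 \<in> D1" "Q2 \<in> D2" using R by (auto simp: rects_def)
          then have "(Q1, Q2) \<in> ?G" using i by (auto intro: rev_image_eqI)
          then show ?thesis unfolding X_def using Q True by (intro SUP_upper2[of "(Q1, Q2)"]) auto
        qed
        have "vm x ** \<Phi> ?R ?\<epsilon> ** Ured ?R = (vm x ** Vred ?R) ** (matrix_inv (Vred ?R) ** \<Phi> ?R ?\<epsilon> ** Ured ?R)"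
        proof -
          have "(vm x ** Vred ?R) ** (matrix_inv (Vred ?R) ** \<Phi> ?R ?\<epsilon> ** Ured ?R) =
              vm x ** (Vred ?R ** matrix_inv (Vred ?R)) ** \<Phi> ?R ?\<epsilon> ** Ured ?R" by (simp only: matrix_mul_assoc)
          then show ?thesis by (simp add: Vred_inv R)
        qed
        then have "opnorm (vm x ** \<Phi> ?R ?\<epsilon> ** Ured ?R) \<le> opnorm (vm x ** Vred ?R) * nv \<Phi> ?R ?\<epsilon>"
          unfolding nv_def by (simp only: opnorm_mult_le)
        also have "opnorm (vm x ** Vred ?R) = w ?R x"
          unfolding w_def by (intro opnorm_mult_swap Vred_inv(3)[OF R] vp_vm(4)[OF x])
        finally have "(opnorm (vm x ** \<Phi> ?R ?\<epsilon> ** Ured ?R))\<^sup>2 \<le> (w ?R x * nv \<Phi> ?R ?\<epsilon>)\<^sup>2"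
          by (intro power_mono) auto
        also have "\<dots> = w ?R x * ((nv \<Phi> ?R ?\<epsilon>)\<^sup>2 * w ?R x)" by (simp add: power2_eq_square)
        finally have "ennreal ((opnorm (vm x ** \<Phi> ?R ?\<epsilon> ** Ured ?R))\<^sup>2) \<le> ennreal (w ?R x * ((nv \<Phi> ?R ?\<epsilon>)\<^sup>2 * w ?R x))"
          by (rule ennreal_leI)
        also have "\<dots> = ennreal (w ?R x) * (ennreal ((nv \<Phi> ?R ?\<epsilon>)\<^sup>2) * ennreal (w ?R x))"
          by (simp only: ennreal_mult w_nonneg zero_le_power2 mult_nonneg_nonneg)
        also have "\<dots> \<le> X x * (ennreal ((nv \<Phi> ?R ?\<epsilon>)\<^sup>2) * ennreal (w ?R x))"
          by (rule mult_right_mono[OF wX]) simp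
        finally have "ennreal ((opnorm (vm x ** \<Phi> ?R ?\<epsilon> ** Ured ?R))\<^sup>2) \<le> X x * (ennreal ((nv \<Phi> ?R ?\<epsilon>)\<^sup>2) * ennreal (w ?R x))" .
        then have "ennreal ((opnorm (vm x ** \<Phi> ?R ?\<epsilon> ** Ured ?R))\<^sup>2) / emeasure lebesgue ?R \<le> X x * (ennreal ((nv \<Phi> ?R ?\<epsilon>)\<^sup>2) * ennreal (w ?R x)) / emeasure lebesgue ?R"
          by (rule divide_right_mono_ennreal)
        then show ?thesis using True by (simp add: sq_def ennreal_times_divide)
      qed (simp add: sq_def)
    qed
    also have "\<dots> = X x * Y x" by (simp add: Y_def sum_distrib_left)
    finally show ?thesis .
  qed
  have "(H1_norm p D1 D2 Ured V \<Phi>)\<^sup>2 \<le> (\<integral>\<^sup>+x. ennpow (X x) (1 / 2) * ennpow (Y x) (1 / 2) \<partial>lebesgue)\<^sup>2"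
    unfolding H1_norm_sq ennpow_half_mult[symmetric]
  proof (intro power_mono nn_integral_mono_AE)
    show "AE x in lebesgue. ennpow (\<Sum>\<^sub>\<infinity>i\<in>idx. sq \<Phi> i x) (1 / 2) \<le> ennpow (X x * Y x) (1 / 2)"
      using AE_pos_def by eventually_elim (intro ennpow_mono sq_XY, simp_all)
  qed simp
  also have "\<dots> \<le> (\<integral>\<^sup>+x. (ennpow (X x) (1 / 2))\<^sup>2 \<partial>lebesgue) * (\<integral>\<^sup>+x. (ennpow (Y x) (1 / 2))\<^sup>2 \<partial>lebesgue)"
    by (rule Cauchy_Schwarz_nn_integral) measurable
  also have "\<dots> \<le> (ennreal CM * ennreal m) * (ennreal (1 + Cw) * ennreal (\<Sum>(R, \<epsilon>)\<in>F. (nv \<Phi> R \<epsilon>)\<^sup>2))"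
    unfolding ennpow_half_square by (intro mult_mono X_int Y_int) auto
  also have "\<dots> = ennreal ((CM * m) * ((1 + Cw) * (\<Sum>(R, \<epsilon>)\<in>F. (nv \<Phi> R \<epsilon>)\<^sup>2)))"
    using CM_nonneg Cw_nonneg \<Omega>(3)
    by (simp only: ennreal_mult mult_nonneg_nonneg sum_nonneg case_prod_beta zero_le_power2 add_nonneg_nonneg zero_le_one)
  finally have "ennpow ((H1_norm p D1 D2 Ured V \<Phi>)\<^sup>2) (1 / 2) \<le> ennpow (ennreal ((CM * m) * ((1 + Cw) * (\<Sum>(R, \<epsilon>)\<in>F. (nv \<Phi> R \<epsilon>)\<^sup>2)))) (1 / 2)"
    by (rule ennpow_mono[rotated]) simp
  also have "\<dots> = ennreal (sqrt ((CM * m) * ((1 + Cw) * (\<Sum>(R, \<epsilon>)\<in>F. (nv \<Phi> R \<epsilon>)\<^sup>2))))"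
    using CM_nonneg Cw_nonneg \<Omega>(3) by (intro ennpow_half_ennreal) (auto intro!: mult_nonneg_nonneg sum_nonneg)
  finally show ?thesis
    by (simp add: ennpow_square_half Ct_def real_sqrt_mult mult_ac)
qed

text \<open>M is tested against itself: the pairing is at least the sum s of the
  \<open>(nb B R \<epsilon>)\<^sup>2\<close>, the H^1 norm is at most
  \<open>Ct * sqrt (m * s)\<close>, and one square root of s cancels. As the hypothesis concerns
  finite sequences alone, it fits \<open>ell\<close> as well as a functional that is not yet
  represented.\<close>

lemma bmo_norm_le_functional:
  fixes l :: "('n, 'm, 'd) matrix_seq \<Rightarrow> complex"
  assumes L: "0 \<le> L"
    and bound: "\<And>\<Phi> F. finite F \<Longrightarrow> F \<subseteq> idx \<Longrightarrow> (\<And>R \<epsilon>. (R, \<epsilon>) \<notin> F \<Longrightarrow> \<Phi> R \<epsilon> = 0) \<Longrightarrow>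
      ennreal (norm (\<Sum>(R, \<epsilon>)\<in>F. trace (conj_transpose (B R \<epsilon>) ** \<Phi> R \<epsilon>))) \<le> ennreal L * H1_norm p D1 D2 Ured V \<Phi>"
  shows "bmo_norm D1 D2 Ured Vred B \<le> ennreal (Ct * L)"
  unfolding bmo_norm_def
proof (rule SUP_least, clarify)
  fix \<Omega> :: "((real^'n) \<times> (real^'m)) set"
  assume \<Omega>: "\<Omega> \<in> sets lebesgue" "0 < emeasure lebesgue \<Omega>" "emeasure lebesgue \<Omega> < top"
  obtain m where m: "emeasure lebesgue \<Omega> = ennreal m" "0 < m"
    using \<Omega> by (cases "emeasure lebesgue \<Omega>") (auto simp: ennreal_less_zero_iff)
  let ?X = "\<Sum>\<^sub>\<infinity>(R, \<epsilon>)\<in>{R \<in> rects D1 D2. R \<subseteq> \<Omega>} \<times> signatures. ennreal ((nb B R \<epsilon>)\<^sup>2)"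
  have "?X \<le> ennreal ((Ct * L)\<^sup>2 * m)"
  proof (rule infsum_ennreal_least)
    fix F :: "(('n, 'm) rect \<times> ('n, 'm) signature) set"
    assume F: "finite F" "F \<subseteq> {R \<in> rects D1 D2. R \<subseteq> \<Omega>} \<times> signatures"
    then have Fidx: "F \<subseteq> idx" by auto
    define M where "M R \<epsilon> = Vred R ** B R \<epsilon> ** matrix_inv (Ured R)" for R \<epsilon>
    \<comment> \<open>The outer factors are undone by the normalization, so that N = M on
      \<open>F\<close>.\<close>
    define \<Phi> where "\<Phi> R \<epsilon> = (if (R, \<epsilon>) \<in> F then Vred R ** M R \<epsilon> ** matrix_inv (Ured R) else 0)" for R \<epsilon>
    let ?s = "\<Sum>(R, \<epsilon>)\<in>F. (nb B R \<epsilon>)\<^sup>2"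
    have s: "0 \<le> ?s" by (simp add: sum_nonneg case_prod_beta)
    have core: "matrix_inv (Vred R) ** \<Phi> R \<epsilon> ** Ured R = M R \<epsilon>" if "(R, \<epsilon>) \<in> F" for R \<epsilon>
    proof -
      have R: "R \<in> rects D1 D2" using that F by auto
      have "matrix_inv (Vred R) ** (Vred R ** M R \<epsilon> ** matrix_inv (Ured R)) ** Ured R =
          (matrix_inv (Vred R) ** Vred R) ** M R \<epsilon> ** (matrix_inv (Ured R) ** Ured R)"
        by (simp only: matrix_mul_assoc)
      then show ?thesis using that by (simp add: \<Phi>_def Vred_inv Ured_inv R)
    qed
    have nv: "nv \<Phi> R \<epsilon> = nb B R \<epsilon>" if "(R, \<epsilon>) \<in> F" for R \<epsilon>
      using core[OF that] by (simp add: nv_def nb_def M_def)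
    have sum_nv: "(\<Sum>(R, \<epsilon>)\<in>F. (nv \<Phi> R \<epsilon>)\<^sup>2) = ?s" by (intro sum.cong) (auto simp: nv)
    have "(\<Sum>(R, \<epsilon>)\<in>F. trace (conj_transpose (B R \<epsilon>) ** \<Phi> R \<epsilon>)) = of_real (\<Sum>(R, \<epsilon>)\<in>F. (norm (M R \<epsilon>))\<^sup>2)"
      unfolding of_real_sum
    proof (rule sum.cong)
      fix i assume i: "i \<in> F"
      obtain R \<epsilon> where i': "i = (R, \<epsilon>)" by (cases i)
      have R: "R \<in> rects D1 D2" using i i' F by auto
      have "trace (conj_transpose (B R \<epsilon>) ** \<Phi> R \<epsilon>) = trace (conj_transpose (M R \<epsilon>) ** M R \<epsilon>)"
        using core i i' by (subst trace_pairing[OF R]) (simp add: M_def)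
      then show "(case i of (R, \<epsilon>) \<Rightarrow> trace (conj_transpose (B R \<epsilon>) ** \<Phi> R \<epsilon>)) = of_real (case i of (R, \<epsilon>) \<Rightarrow> (norm (M R \<epsilon>))\<^sup>2)"
        by (simp add: i' trace_adjoint_self)
    qed simp
    then have "norm (\<Sum>(R, \<epsilon>)\<in>F. trace (conj_transpose (B R \<epsilon>) ** \<Phi> R \<epsilon>)) = (\<Sum>(R, \<epsilon>)\<in>F. (norm (M R \<epsilon>))\<^sup>2)"
      by (simp add: sum_nonneg case_prod_beta del: of_real_sum)
    moreover have "?s \<le> (\<Sum>(R, \<epsilon>)\<in>F. (norm (M R \<epsilon>))\<^sup>2)"
      by (intro sum_mono) (auto simp: nb_def M_def intro!: power_mono opnorm_le_norm)
    ultimately have "ennreal ?s \<le> ennreal (norm (\<Sum>(R, \<epsilon>)\<in>F. trace (conj_transpose (B R \<epsilon>) ** \<Phi> R \<epsilon>)))"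
      by (intro ennreal_leI) simp
    also have "\<dots> \<le> ennreal L * H1_norm p D1 D2 Ured V \<Phi>"
      by (rule bound[OF F(1) Fidx]) (simp add: \<Phi>_def)
    also have "\<dots> \<le> ennreal L * ennreal (Ct * sqrt (m * (\<Sum>(R, \<epsilon>)\<in>F. (nv \<Phi> R \<epsilon>)\<^sup>2)))"
      using \<Omega>(1) m F
      by (intro mult_left_mono finite_support_H1_norm[OF F(1) Fidx]) (auto simp: \<Phi>_def)
    also have "\<dots> = ennreal (L * (Ct * sqrt (m * ?s)))"
      unfolding sum_nv using L Ct_nonneg s m by (intro ennreal_mult[symmetric]) auto
    finally have "?s \<le> L * (Ct * sqrt (m * ?s))"
      using L Ct_nonneg s m by (subst (asm) ennreal_le_iff) auto
    then have "sqrt ?s * sqrt ?s \<le> (Ct * L * sqrt m) * sqrt ?s"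
      using s by (simp add: real_sqrt_mult mult_ac)
    then have "sqrt ?s \<le> Ct * L * sqrt m"
      using s L Ct_nonneg m by (cases "?s = 0") (auto simp del: real_sqrt_mult_self dest: mult_right_le_imp_le)
    then have "(sqrt ?s)\<^sup>2 \<le> (Ct * L * sqrt m)\<^sup>2" using s by (intro power_mono) auto
    then have "?s \<le> (Ct * L)\<^sup>2 * m" using s m by (simp add: power_mult_distrib)
    then have "ennreal ?s \<le> ennreal ((Ct * L)\<^sup>2 * m)" by (rule ennreal_leI)
    then show "(\<Sum>(R, \<epsilon>)\<in>F. ennreal ((nb B R \<epsilon>)\<^sup>2)) \<le> ennreal ((Ct * L)\<^sup>2 * m)"
      by (simp add: case_prod_beta)
  qed
  then have "ennpow ?X (1 / 2) \<le> ennpow (ennreal ((Ct * L)\<^sup>2 * m)) (1 / 2)" by (intro ennpow_mono) simp_all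
  also have "\<dots> = ennreal (sqrt ((Ct * L)\<^sup>2 * m))" using m by (intro ennpow_half_ennreal) auto
  also have "sqrt ((Ct * L)\<^sup>2 * m) = (Ct * L) * sqrt m" using m L Ct_nonneg by (simp add: real_sqrt_mult)
  also have "ennreal \<dots> = ennreal (Ct * L) * ennreal (sqrt m)"
    using m L Ct_nonneg by (intro ennreal_mult) auto
  finally have "ennpow ?X (1 / 2) / ennreal (sqrt m) \<le> ennreal (Ct * L) * ennreal (sqrt m) / ennreal (sqrt m)"
    by (rule divide_right_mono_ennreal)
  also have "\<dots> = ennreal (Ct * L)" using m by (simp add: ennreal_mult_divide_eq)
  finally show "ennpow (\<Sum>\<^sub>\<infinity>(R, \<epsilon>)\<in>{R \<in> rects D1 D2. R \<subseteq> \<Omega>} \<times> signatures.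
      ennreal ((opnorm (Vred R ** B R \<epsilon> ** matrix_inv (Ured R)))\<^sup>2)) (1 / 2) / ennpow (emeasure lebesgue \<Omega>) (1 / 2) \<le> ennreal (Ct * L)"
    using m by (simp add: nb_def ennpow_half_ennreal)
qed

end

section \<open>The duality\<close>

lemma ennpow_half_tendsto_0:
  assumes "(f \<longlongrightarrow> 0) F"
  shows "((\<lambda>n. ennpow (f n) (1 / 2)) \<longlongrightarrow> 0) F"
proof (rule order_tendstoI)
  fix a :: ennreal assume a: "0 < a"
  then have "0 < a\<^sup>2" by (simp add: zero_less_iff_neq_zero)
  from order_tendstoD(2)[OF assms this]
  show "\<forall>\<^sub>F n in F. ennpow (f n) (1 / 2) < a"
  proof eventually_elim
    case (elim n)
    show ?case
    proof (rule ccontr)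
      assume "\<not> ennpow (f n) (1 / 2) < a"
      then have "a\<^sup>2 \<le> (ennpow (f n) (1 / 2))\<^sup>2" by (intro power_mono) auto
      then show False using elim by (simp add: ennpow_half_square)
    qed
  qed
qed simp

lemma map_matrix_cmult_nth: "map_matrix ((*) c) A $ i $ j = c * A $ i $ j"
  by (simp add: map_matrix_def)

lemma map_matrix_cmult_mult:
  fixes A B :: "complex^'d^'d"
  shows "A ** map_matrix ((*) c) B = map_matrix ((*) c) (A ** B)" "map_matrix ((*) c) A ** B = map_matrix ((*) c) (A ** B)"
  by (simp_all add: vec_eq_iff map_matrix_cmult_nth matrix_matrix_mult_def sum_distrib_left mult_ac)

lemma map_matrix_cmult_vector: "map_matrix ((*) c) A *v v = c *s (A *v v)"
  by (simp add: vec_eq_iff map_matrix_cmult_nth matrix_vector_mult_def sum_distrib_left mult_ac)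

lemma opnorm_cmult_le: "opnorm (map_matrix ((*) c) A) \<le> norm c * opnorm A"
proof (rule opnorm_le)
  fix v
  have "norm (map_matrix ((*) c) A *v v) = norm c * norm (A *v v)"
    by (simp add: map_matrix_cmult_vector norm_scale)
  also have "\<dots> \<le> norm c * (opnorm A * norm v)" by (intro mult_left_mono norm_matrix_vector_le) auto
  finally show "norm (map_matrix ((*) c) A *v v) \<le> norm c * opnorm A * norm v" by (simp add: mult.assoc)
qed

lemma trace_cmult: "trace (map_matrix ((*) c) A) = c * trace A"
  by (simp add: trace_def map_matrix_cmult_nth sum_distrib_left)

context bloom_weights
begin

abbreviation "hnorm \<equiv> H1_norm p D1 D2 Ured V"
abbreviation "H \<equiv> H1 p D1 D2 Ured V"
abbreviation "bnorm \<equiv> bmo_norm D1 D2 Ured Vred"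

lemma summable_pairing:
  assumes B: "bnorm B \<le> ennreal \<beta>" "0 \<le> \<beta>" and \<Phi>: "hnorm \<Phi> \<le> ennreal h" "0 \<le> h"
  shows "(\<lambda>(R, \<epsilon>). norm (trace (conj_transpose (B R \<epsilon>) ** \<Phi> R \<epsilon>))) summable_on idx"
    and "norm (ell D1 D2 B \<Phi>) \<le> Cup * (\<beta> * h)"
proof -
  let ?f = "\<lambda>(R, \<epsilon>). norm (trace (conj_transpose (B R \<epsilon>) ** \<Phi> R \<epsilon>))"
  show s: "?f summable_on idx"
  proof (rule nonneg_bounded_partial_sums_imp_summable_on)
    show "\<forall>\<^sub>F X in finite_subsets_at_top idx. sum ?f X \<le> Cup * (\<beta> * h)"
      by (rule eventually_finite_subsets_at_top_weakI) (rule sum_pairing_bound[OF B \<Phi>])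
  qed auto
  then have abs: "(\<lambda>i. norm (case i of (R, \<epsilon>) \<Rightarrow> trace (conj_transpose (B R \<epsilon>) ** \<Phi> R \<epsilon>))) summable_on idx"
    by (simp add: case_prod_unfold)
  have "norm (ell D1 D2 B \<Phi>) \<le> (\<Sum>\<^sub>\<infinity>i\<in>idx. norm (case i of (R, \<epsilon>) \<Rightarrow> trace (conj_transpose (B R \<epsilon>) ** \<Phi> R \<epsilon>)))"
    unfolding ell_def by (rule norm_infsum_bound[OF abs])
  also have "\<dots> = infsum ?f idx" by (simp add: case_prod_unfold)
  also have "\<dots> \<le> Cup * (\<beta> * h)"
    by (rule infsum_le_finite_sums[OF s]) (rule sum_pairing_bound[OF B \<Phi>])
  finally show "norm (ell D1 D2 B \<Phi>) \<le> Cup * (\<beta> * h)" .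
qed

lemma H1_finite:
  assumes "\<Phi> \<in> H"
  obtains h where "hnorm \<Phi> = ennreal h" "0 \<le> h"
  using assms by (cases "hnorm \<Phi>") (auto simp: H1_def)

lemma BMO_finite:
  assumes "B \<in> BMO D1 D2 Ured Vred"
  obtains \<beta> where "bnorm B = ennreal \<beta>" "0 \<le> \<beta>"
  using assms by (cases "bnorm B") (auto simp: BMO_def)

lemma ell_bound:
  assumes B: "bnorm B = ennreal \<beta>" "0 \<le> \<beta>" and \<Phi>: "\<Phi> \<in> H"
  shows "ennreal (norm (ell D1 D2 B \<Phi>)) \<le> ennreal (Cup * \<beta>) * hnorm \<Phi>"
proof -
  obtain h where h: "hnorm \<Phi> = ennreal h" "0 \<le> h" using H1_finite[OF \<Phi>] .
  have "norm (ell D1 D2 B \<Phi>) \<le> (Cup * \<beta>) * h"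
    using summable_pairing(2)[of B \<beta> \<Phi> h] B h by (simp add: mult.assoc)
  then have "ennreal (norm (ell D1 D2 B \<Phi>)) \<le> ennreal ((Cup * \<beta>) * h)" by (rule ennreal_leI)
  also have "\<dots> = ennreal (Cup * \<beta>) * ennreal h" using h B Cup_pos by (intro ennreal_mult) auto
  finally show ?thesis by (simp add: h)
qed

lemma ell_summable:
  assumes B: "B \<in> BMO D1 D2 Ured Vred" and \<Phi>: "\<Phi> \<in> H"
  shows "(\<lambda>(R, \<epsilon>). norm (trace (conj_transpose (B R \<epsilon>) ** \<Phi> R \<epsilon>))) summable_on idx"
    and "(\<lambda>(R, \<epsilon>). trace (conj_transpose (B R \<epsilon>) ** \<Phi> R \<epsilon>)) summable_on idx"
proof -
  obtain \<beta> where \<beta>: "bnorm B = ennreal \<beta>" "0 \<le> \<beta>" using BMO_finite[OF B] .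
  obtain h where h: "hnorm \<Phi> = ennreal h" "0 \<le> h" using H1_finite[OF \<Phi>] .
  show s: "(\<lambda>(R, \<epsilon>). norm (trace (conj_transpose (B R \<epsilon>) ** \<Phi> R \<epsilon>))) summable_on idx"
    using summable_pairing(1)[of B \<beta> \<Phi> h] \<beta> h by simp
  show "(\<lambda>(R, \<epsilon>). trace (conj_transpose (B R \<epsilon>) ** \<Phi> R \<epsilon>)) summable_on idx"
    by (rule abs_summable_summable) (use s in \<open>simp add: case_prod_unfold\<close>)
qed

lemma ell_functional:
  assumes B: "B \<in> BMO D1 D2 Ured Vred"
  shows "H1_bounded_functional p D1 D2 Ured V (ell D1 D2 B)"
  unfolding H1_bounded_functional_def
proof (intro conjI ballI allI)
  fix \<Phi> \<Psi> assume "\<Phi> \<in> H" "\<Psi> \<in> H"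
  note s = ell_summable(2)[OF B this(1)] ell_summable(2)[OF B this(2)]
  have "ell D1 D2 B (\<lambda>R \<epsilon>. \<Phi> R \<epsilon> + \<Psi> R \<epsilon>) =
      (\<Sum>\<^sub>\<infinity>i\<in>idx. (case i of (R, \<epsilon>) \<Rightarrow> trace (conj_transpose (B R \<epsilon>) ** \<Phi> R \<epsilon>)) +
        (case i of (R, \<epsilon>) \<Rightarrow> trace (conj_transpose (B R \<epsilon>) ** \<Psi> R \<epsilon>)))"
    unfolding ell_def by (intro infsum_cong) (auto simp: matrix_add_ldistrib trace_add)
  also have "\<dots> = ell D1 D2 B \<Phi> + ell D1 D2 B \<Psi>"
    unfolding ell_def by (rule infsum_add[OF s])
  finally show "ell D1 D2 B (\<lambda>R \<epsilon>. \<Phi> R \<epsilon> + \<Psi> R \<epsilon>) = ell D1 D2 B \<Phi> + ell D1 D2 B \<Psi>" .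
next
  fix \<Phi> c assume "\<Phi> \<in> H"
  note s = ell_summable(2)[OF B this]
  have "ell D1 D2 B (\<lambda>R \<epsilon>. map_matrix ((*) c) (\<Phi> R \<epsilon>)) =
      (\<Sum>\<^sub>\<infinity>i\<in>idx. c * (case i of (R, \<epsilon>) \<Rightarrow> trace (conj_transpose (B R \<epsilon>) ** \<Phi> R \<epsilon>)))"
    unfolding ell_def by (intro infsum_cong) (auto simp: map_matrix_cmult_mult trace_cmult)
  also have "\<dots> = c * ell D1 D2 B \<Phi>"
    unfolding ell_def by (rule infsum_cmult_right) (rule s)
  finally show "ell D1 D2 B (\<lambda>R \<epsilon>. map_matrix ((*) c) (\<Phi> R \<epsilon>)) = c * ell D1 D2 B \<Phi>" .
next
  obtain \<beta> where \<beta>: "bnorm B = ennreal \<beta>" "0 \<le> \<beta>" using BMO_finite[OF B] .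
  show "\<exists>C. \<forall>\<Phi>\<in>H. ennreal (norm (ell D1 D2 B \<Phi>)) \<le> ennreal C * hnorm \<Phi>"
    using ell_bound[OF \<beta>] by blast
qed

lemma H1_norm_cmult_le: "hnorm (\<lambda>R \<epsilon>. map_matrix ((*) c) (\<Phi> R \<epsilon>)) \<le> ennreal (norm c) * hnorm \<Phi>"
proof -
  let ?\<Psi> = "\<lambda>R \<epsilon>. map_matrix ((*) c) (\<Phi> R \<epsilon>)"
  have sq_le: "sq ?\<Psi> i x \<le> ennreal ((norm c)\<^sup>2) * sq \<Phi> i x" for i x
  proof -
    have "opnorm (vm x ** ?\<Psi> (fst i) (snd i) ** Ured (fst i)) \<le> norm c * opnorm (vm x ** \<Phi> (fst i) (snd i) ** Ured (fst i))"
      unfolding map_matrix_cmult_mult by (rule opnorm_cmult_le)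
    then have "(opnorm (vm x ** ?\<Psi> (fst i) (snd i) ** Ured (fst i)))\<^sup>2 \<le> (norm c * opnorm (vm x ** \<Phi> (fst i) (snd i) ** Ured (fst i)))\<^sup>2"
      by (intro power_mono) auto
    then have "ennreal ((opnorm (vm x ** ?\<Psi> (fst i) (snd i) ** Ured (fst i)))\<^sup>2) \<le>
        ennreal ((norm c)\<^sup>2 * (opnorm (vm x ** \<Phi> (fst i) (snd i) ** Ured (fst i)))\<^sup>2)"
      by (intro ennreal_leI) (simp add: power_mult_distrib)
    also have "\<dots> = ennreal ((norm c)\<^sup>2) * ennreal ((opnorm (vm x ** \<Phi> (fst i) (snd i) ** Ured (fst i)))\<^sup>2)"
      by (intro ennreal_mult) auto
    finally have "ennreal ((opnorm (vm x ** ?\<Psi> (fst i) (snd i) ** Ured (fst i)))\<^sup>2) * indicator (fst i) x / emeasure lebesgue (fst i)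
        \<le> ennreal ((norm c)\<^sup>2) * ennreal ((opnorm (vm x ** \<Phi> (fst i) (snd i) ** Ured (fst i)))\<^sup>2) * indicator (fst i) x / emeasure lebesgue (fst i)"
      by (intro divide_right_mono_ennreal mult_right_mono) auto
    then show ?thesis by (simp add: sq_def ennreal_times_divide mult.assoc)
  qed
  have inf_le: "(\<Sum>\<^sub>\<infinity>i\<in>idx. sq ?\<Psi> i x) \<le> ennreal ((norm c)\<^sup>2) * (\<Sum>\<^sub>\<infinity>i\<in>idx. sq \<Phi> i x)" for x
  proof (rule infsum_ennreal_least)
    fix F assume F: "finite F" "F \<subseteq> idx"
    have "(\<Sum>i\<in>F. sq ?\<Psi> i x) \<le> (\<Sum>i\<in>F. ennreal ((norm c)\<^sup>2) * sq \<Phi> i x)" by (intro sum_mono sq_le)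
    also have "\<dots> = ennreal ((norm c)\<^sup>2) * (\<Sum>i\<in>F. sq \<Phi> i x)" by (simp add: sum_distrib_left)
    also have "\<dots> \<le> ennreal ((norm c)\<^sup>2) * (\<Sum>\<^sub>\<infinity>i\<in>idx. sq \<Phi> i x)"
      by (intro mult_left_mono sum_le_infsum_ennreal F) auto
    finally show "(\<Sum>i\<in>F. sq ?\<Psi> i x) \<le> ennreal ((norm c)\<^sup>2) * (\<Sum>\<^sub>\<infinity>i\<in>idx. sq \<Phi> i x)" .
  qed
  have "hnorm ?\<Psi> \<le> (\<integral>\<^sup>+x. ennreal (norm c) * ennpow (\<Sum>\<^sub>\<infinity>i\<in>idx. sq \<Phi> i x) (1 / 2) \<partial>lebesgue)"
    unfolding H1_norm_sq
  proof (intro nn_integral_mono)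
    fix x
    have "ennpow (\<Sum>\<^sub>\<infinity>i\<in>idx. sq ?\<Psi> i x) (1 / 2) \<le> ennpow (ennreal ((norm c)\<^sup>2) * (\<Sum>\<^sub>\<infinity>i\<in>idx. sq \<Phi> i x)) (1 / 2)"
      by (intro ennpow_mono inf_le) simp
    also have "\<dots> = ennreal (norm c) * ennpow (\<Sum>\<^sub>\<infinity>i\<in>idx. sq \<Phi> i x) (1 / 2)"
      by (simp add: ennpow_half_mult ennpow_half_ennreal)
    finally show "ennpow (\<Sum>\<^sub>\<infinity>i\<in>idx. sq ?\<Psi> i x) (1 / 2) \<le> ennreal (norm c) * ennpow (\<Sum>\<^sub>\<infinity>i\<in>idx. sq \<Phi> i x) (1 / 2)" .
  qed
  also have "\<dots> = ennreal (norm c) * hnorm \<Phi>"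
    unfolding H1_norm_sq by (rule nn_integral_cmult) measurable
  finally show ?thesis .
qed

section \<open>Finite sequences and the representation of functionals\<close>

definition supported_on :: "(('n, 'm) rect \<times> ('n, 'm) signature) set \<Rightarrow> ('n, 'm, 'd) matrix_seq set" where
  "supported_on F = {\<Phi>. \<forall>R \<epsilon>. (R, \<epsilon>) \<notin> F \<longrightarrow> \<Phi> R \<epsilon> = 0}"

lemma supported_onD: "\<Phi> \<in> supported_on F \<Longrightarrow> (R, \<epsilon>) \<notin> F \<Longrightarrow> \<Phi> R \<epsilon> = 0"
  unfolding supported_on_def by blast

lemma supported_onI: "(\<And>R \<epsilon>. (R, \<epsilon>) \<notin> F \<Longrightarrow> \<Phi> R \<epsilon> = 0) \<Longrightarrow> \<Phi> \<in> supported_on F"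
  unfolding supported_on_def by blast

text \<open>The union of the supporting rectangles has finite measure and serves as
  \<open>\<Omega>\<close> in the test estimate, which thus also supplies finiteness of the
  norm.\<close>

lemma supported_on_H1:
  assumes F: "finite F" "F \<subseteq> idx" and \<Phi>: "\<Phi> \<in> supported_on F"
  shows "\<Phi> \<in> H"
proof -
  let ?\<Omega> = "\<Union>(fst ` F)"
  have rects: "fst ` F \<subseteq> rects D1 D2" using F by auto
  then have sets: "fst ` F \<subseteq> sets lebesgue" using rect_facts(1) by blast
  have "emeasure lebesgue ?\<Omega> \<le> (\<Sum>R\<in>fst ` F. emeasure lebesgue R)"
    using F sets by (intro emeasure_subadditive_finite[of _ "\<lambda>R. R", unfolded image_ident]) auto
  also have "\<dots> < top" using rects by (subst sum_emeasure_rects) auto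
  finally obtain m where m: "emeasure lebesgue ?\<Omega> = ennreal m" "0 \<le> m"
    by (cases "emeasure lebesgue ?\<Omega>") auto
  have "hnorm \<Phi> \<le> ennreal (Ct * sqrt (m * (\<Sum>(R, \<epsilon>)\<in>F. (nv \<Phi> R \<epsilon>)\<^sup>2)))"
  proof (rule finite_support_H1_norm[OF F _ _ m])
    show "\<Phi> R \<epsilon> = 0" if "(R, \<epsilon>) \<notin> F" for R \<epsilon> using \<Phi> that by (rule supported_onD)
    show "?\<Omega> \<in> sets lebesgue" using F sets by (intro sets.finite_Union) auto
    show "R \<subseteq> ?\<Omega>" if "(R, \<epsilon>) \<in> F" for R \<epsilon> using that by force
  qed
  then have "hnorm \<Phi> < top" by (rule le_less_trans) simp
  moreover have "\<Phi> \<in> matrix_seqs D1 D2"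
    using supported_onD[OF \<Phi>] F(2) unfolding matrix_seqs_def by blast
  ultimately show ?thesis by (simp add: H1_def)
qed

lemma ell_supported_on:
  assumes F: "finite F" "F \<subseteq> idx" and \<Phi>: "\<Phi> \<in> supported_on F"
  shows "ell D1 D2 B \<Phi> = (\<Sum>(R, \<epsilon>)\<in>F. trace (conj_transpose (B R \<epsilon>) ** \<Phi> R \<epsilon>))"
proof -
  have zero: "trace (conj_transpose (B R \<epsilon>) ** \<Phi> R \<epsilon>) = 0" if "(R, \<epsilon>) \<notin> F" for R \<epsilon>
    unfolding trace_adjoint_mult using supported_onD[OF \<Phi> that] by simp
  have "ell D1 D2 B \<Phi> = (\<Sum>\<^sub>\<infinity>(R, \<epsilon>)\<in>F. trace (conj_transpose (B R \<epsilon>) ** \<Phi> R \<epsilon>))"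
    unfolding ell_def using F zero by (intro infsum_cong_neutral) auto
  then show ?thesis using F by simp
qed

lemma functional_add:
  assumes "H1_bounded_functional p D1 D2 Ured V l" "\<Phi> \<in> H" "\<Psi> \<in> H"
  shows "l (\<lambda>R \<epsilon>. \<Phi> R \<epsilon> + \<Psi> R \<epsilon>) = l \<Phi> + l \<Psi>"
  using assms unfolding H1_bounded_functional_def by simp

lemma functional_cmult:
  assumes "H1_bounded_functional p D1 D2 Ured V l" "\<Phi> \<in> H"
  shows "l (\<lambda>R \<epsilon>. map_matrix ((*) c) (\<Phi> R \<epsilon>)) = c * l \<Phi>"
  using assms unfolding H1_bounded_functional_def by simp

lemma functional_bounded:
  assumes "H1_bounded_functional p D1 D2 Ured V l"
  shows "\<exists>C\<ge>0. \<forall>\<Phi>\<in>H. ennreal (norm (l \<Phi>)) \<le> ennreal C * hnorm \<Phi>"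
proof -
  obtain C where C: "\<forall>\<Phi>\<in>H. ennreal (norm (l \<Phi>)) \<le> ennreal C * hnorm \<Phi>"
    using assms unfolding H1_bounded_functional_def by (elim conjE exE)
  have "ennreal (norm (l \<Phi>)) \<le> ennreal (max 0 C) * hnorm \<Phi>" if "\<Phi> \<in> H" for \<Phi>
    using C that by (intro order.trans[OF bspec[OF C that]] mult_right_mono ennreal_leI) auto
  then show ?thesis by (intro exI[of _ "max 0 C"]) simp
qed

lemma functional_norm_bound:
  assumes l: "H1_bounded_functional p D1 D2 Ured V l" and \<Phi>: "\<Phi> \<in> H"
  shows "ennreal (norm (l \<Phi>)) \<le> H1_functional_norm p D1 D2 Ured V l * hnorm \<Phi>"
proof -
  obtain C where C: "0 \<le> C" "\<forall>\<Phi>\<in>H. ennreal (norm (l \<Phi>)) \<le> ennreal C * hnorm \<Phi>"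
    using functional_bounded[OF l] by (elim exE conjE)
  obtain h where h: "hnorm \<Phi> = ennreal h" "0 \<le> h" using H1_finite[OF \<Phi>] .
  show ?thesis
  \<comment> \<open>A sequence of norm 0 cannot be normalized; there the constant \<open>C\<close>
    of boundedness forces \<open>l \<Phi> = 0\<close>.\<close>
  proof (cases "h = 0")
    case True
    then show ?thesis using bspec[OF C(2) \<Phi>] h by simp
  next
    case False
    then have hpos: "0 < h" using h by simp
    let ?c = "complex_of_real (1 / h)" let ?\<Psi> = "\<lambda>R \<epsilon>. map_matrix ((*) ?c) (\<Phi> R \<epsilon>)"
    have "hnorm ?\<Psi> \<le> ennreal (norm ?c) * hnorm \<Phi>" by (rule H1_norm_cmult_le)
    also have "\<dots> = 1" using hpos h by (simp add: norm_divide flip: ennreal_mult)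
    finally have le1: "hnorm ?\<Psi> \<le> 1" .
    have "?\<Psi> \<in> matrix_seqs D1 D2"
      using \<Phi> by (auto simp: H1_def matrix_seqs_def vec_eq_iff map_matrix_cmult_nth)
    then have "?\<Psi> \<in> H" using le1 by (auto simp: H1_def intro: le_less_trans)
    then have "ennreal (norm (l ?\<Psi>)) \<le> H1_functional_norm p D1 D2 Ured V l"
      unfolding H1_functional_norm_def using le1 by (intro SUP_upper) auto
    moreover have "ennreal (norm (l \<Phi>)) = ennreal (norm (l ?\<Psi>)) * ennreal h"
      using hpos by (subst functional_cmult[OF l \<Phi>]) (simp add: norm_mult norm_divide flip: ennreal_mult)
    ultimately show ?thesis by (simp add: h mult_right_mono)
  qed
qed

lemma functional_norm_upper:
  assumes B: "B \<in> BMO D1 D2 Ured Vred"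
  shows "H1_functional_norm p D1 D2 Ured V (ell D1 D2 B) \<le> ennreal Cup * bnorm B"
  unfolding H1_functional_norm_def
proof (rule SUP_least)
  fix \<Phi> assume \<Phi>: "\<Phi> \<in> {\<Phi>\<in>H. hnorm \<Phi> \<le> 1}"
  obtain \<beta> where \<beta>: "bnorm B = ennreal \<beta>" "0 \<le> \<beta>" using BMO_finite[OF B] .
  have "ennreal (norm (ell D1 D2 B \<Phi>)) \<le> ennreal (Cup * \<beta>) * hnorm \<Phi>"
    using \<Phi> by (intro ell_bound[OF \<beta>]) auto
  also have "\<dots> \<le> ennreal (Cup * \<beta>) * 1" using \<Phi> by (intro mult_left_mono) auto
  finally show "ennreal (norm (ell D1 D2 B \<Phi>)) \<le> ennreal Cup * bnorm B"
    using Cup_pos \<beta> by (simp add: ennreal_mult)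
qed

lemma functional_norm_lower:
  assumes B: "B \<in> BMO D1 D2 Ured Vred"
  shows "bnorm B \<le> ennreal Ct * H1_functional_norm p D1 D2 Ured V (ell D1 D2 B)"
proof -
  let ?N = "H1_functional_norm p D1 D2 Ured V (ell D1 D2 B)"
  obtain \<beta> where \<beta>: "bnorm B = ennreal \<beta>" "0 \<le> \<beta>" using BMO_finite[OF B] .
  \<comment> \<open>The upper estimate enters for finiteness: it makes \<open>?N\<close> a real
    number, the constant in the test argument.\<close>
  have "?N \<le> ennreal Cup * ennreal \<beta>" using functional_norm_upper[OF B] by (simp add: \<beta>)
  also have "\<dots> < top" by (simp add: ennreal_mult_less_top)
  finally obtain L where L: "?N = ennreal L" "0 \<le> L" by (cases ?N) auto
  have "bnorm B \<le> ennreal (Ct * L)"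
  proof (rule bmo_norm_le_functional[OF L(2)])
    fix \<Phi> :: "('n, 'm, 'd) matrix_seq" and F
    assume F: "finite F" "F \<subseteq> idx" and "\<And>R \<epsilon>. (R, \<epsilon>) \<notin> F \<Longrightarrow> \<Phi> R \<epsilon> = 0"
    then have \<Phi>: "\<Phi> \<in> supported_on F" by (intro supported_onI)
    show "ennreal (norm (\<Sum>(R, \<epsilon>)\<in>F. trace (conj_transpose (B R \<epsilon>) ** \<Phi> R \<epsilon>))) \<le> ennreal L * hnorm \<Phi>"
      using functional_norm_bound[OF ell_functional[OF B] supported_on_H1[OF F \<Phi>]] L
      by (simp add: ell_supported_on[OF F \<Phi>])
  qed
  then show ?thesis using L Ct_nonneg by (simp add: ennreal_mult)
qed

text \<open>The tails of the square function tend to 0 wherever it is finite, that is almost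
  everywhere, and the full square function dominates them. This is the density of the finite
  sequences.\<close>

lemma tail_norm_tendsto:
  assumes \<Phi>: "\<Phi> \<in> H" and E: "\<And>n. finite (E n)" "\<And>n. E n \<subseteq> idx" "mono E" "(\<Union>n. E n) = idx"
  shows "(\<lambda>n. hnorm (\<lambda>R \<epsilon>. if (R, \<epsilon>) \<in> E n then 0 else \<Phi> R \<epsilon>)) \<longlonglongrightarrow> 0"
proof -
  have tail: "(\<Sum>\<^sub>\<infinity>i\<in>idx. sq (\<lambda>R \<epsilon>. if (R, \<epsilon>) \<in> E n then 0 else \<Phi> R \<epsilon>) i x) = (\<Sum>\<^sub>\<infinity>i\<in>idx - E n. sq \<Phi> i x)" for n x
    by (intro infsum_cong_neutral) (auto simp: sq_def)
  have fin: "(\<integral>\<^sup>+x. ennpow (\<Sum>\<^sub>\<infinity>i\<in>idx. sq \<Phi> i x) (1 / 2) \<partial>lebesgue) < top"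
    using \<Phi> by (simp add: H1_def H1_norm_sq)
  have "(\<lambda>n. \<integral>\<^sup>+x. ennpow (\<Sum>\<^sub>\<infinity>i\<in>idx - E n. sq \<Phi> i x) (1 / 2) \<partial>lebesgue) \<longlonglongrightarrow> (\<integral>\<^sup>+x. 0 \<partial>(lebesgue :: ((real^'n) \<times> (real^'m)) measure))"
  proof (rule nn_integral_dominated_convergence[where w = "\<lambda>x. ennpow (\<Sum>\<^sub>\<infinity>i\<in>idx. sq \<Phi> i x) (1 / 2)"])
    show "(\<lambda>x. ennpow (\<Sum>\<^sub>\<infinity>i\<in>idx - E n. sq \<Phi> i x) (1 / 2)) \<in> borel_measurable lebesgue" for n
      by (intro borel_measurable_ennpow borel_measurable_infsum_ennreal countable_Diff idx_countable sq_measurable) auto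
    show "AE x in lebesgue. ennpow (\<Sum>\<^sub>\<infinity>i\<in>idx - E n. sq \<Phi> i x) (1 / 2) \<le> ennpow (\<Sum>\<^sub>\<infinity>i\<in>idx. sq \<Phi> i x) (1 / 2)" for n
      by (intro AE_I2 ennpow_mono infsum_ennreal_least sum_le_infsum_ennreal) auto
    have "AE x in lebesgue. ennpow (\<Sum>\<^sub>\<infinity>i\<in>idx. sq \<Phi> i x) (1 / 2) \<noteq> \<infinity>"
      using fin by (intro nn_integral_PInf_AE) auto
    then show "AE x in lebesgue. (\<lambda>n. ennpow (\<Sum>\<^sub>\<infinity>i\<in>idx - E n. sq \<Phi> i x) (1 / 2)) \<longlonglongrightarrow> 0"
    proof eventually_elim
      case (elim x)
      then have "(\<Sum>\<^sub>\<infinity>i\<in>idx. sq \<Phi> i x) \<noteq> top" by (auto simp: ennpow_def)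
      then have "(\<Sum>\<^sub>\<infinity>i\<in>idx. sq \<Phi> i x) < top" by (simp add: less_top)
      then show ?case by (intro ennpow_half_tendsto_0 infsum_ennreal_tail_tendsto E)
    qed
  qed (use fin in auto)
  then show ?thesis unfolding H1_norm_sq tail by simp
qed

text \<open>The values of \<open>l\<close> on matrix units determine \<open>B\<close>, which settles
  finite sequences by linearity. The test argument for \<open>l\<close> itself then puts
  \<open>B\<close> into BMO, so \<open>ell D1 D2 B\<close> is bounded too, and density
  finishes.\<close>

lemma functional_representation:
  assumes l: "H1_bounded_functional p D1 D2 Ured V l"
  shows "\<exists>B\<in>BMO D1 D2 Ured Vred. \<forall>\<Phi>\<in>H. l \<Phi> = ell D1 D2 B \<Phi>"
proof -
  obtain C where C: "0 \<le> C" "\<forall>\<Phi>\<in>H. ennreal (norm (l \<Phi>)) \<le> ennreal C * hnorm \<Phi>"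
    using functional_bounded[OF l] by (elim exE conjE)
  note add = functional_add[OF l] and cmult = functional_cmult[OF l]
  define unit :: "('n, 'm) rect \<Rightarrow> ('n, 'm) signature \<Rightarrow> 'd \<Rightarrow> 'd \<Rightarrow> ('n, 'm, 'd) matrix_seq"
    where "unit R' \<epsilon>' i j = (\<lambda>R \<epsilon>. if R = R' \<and> \<epsilon> = \<epsilon>' then \<chi> r s. if r = i \<and> s = j then 1 else 0 else 0)" for R' \<epsilon>' i j
  \<comment> \<open>The conjugate undoes the adjoint of \<open>B\<close> in the pairing.\<close>
  define B :: "('n, 'm, 'd) matrix_seq"
    where "B R \<epsilon> = (if (R, \<epsilon>) \<in> idx then \<chi> i j. cnj (l (unit R \<epsilon> i j)) else 0)" for R \<epsilon>
  \<comment> \<open>All terms share the finite support \<open>F\<close>, so every partial sum stays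
    in \<open>H\<close>, where additivity of \<open>l\<close> is available.\<close>
  have comb: "l (\<lambda>R \<epsilon>. \<Sum>k\<in>J. map_matrix ((*) (c k)) (e k R \<epsilon>)) = (\<Sum>k\<in>J. c k * l (e k))"
    if F: "finite F" "F \<subseteq> idx" and J: "finite J" and e: "\<And>k. k \<in> J \<Longrightarrow> e k \<in> supported_on F"
    for F J and c :: "'k \<Rightarrow> complex" and e
    using J e
  proof (induction J)
    case empty
    have z: "(\<lambda>R \<epsilon>. 0 :: complex^'d^'d) \<in> H" by (rule supported_on_H1[of "{}"]) (auto intro: supported_onI)
    have "(\<lambda>R \<epsilon>. map_matrix ((*) 0) (0 :: complex^'d^'d)) = (\<lambda>(R :: ('n, 'm) rect) (\<epsilon> :: ('n, 'm) signature). 0)"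
      by (simp add: fun_eq_iff vec_eq_iff map_matrix_cmult_nth)
    then have "l (\<lambda>R \<epsilon>. 0) = 0 * l (\<lambda>R \<epsilon>. 0)" using cmult[OF z, of 0] by simp
    then show ?case by simp
  next
    case (insert k J)
    have "(\<lambda>R \<epsilon>. map_matrix ((*) (c k)) (e k R \<epsilon>)) \<in> supported_on F"
      using supported_onD[OF insert.prems[of k]]
      by (intro supported_onI) (simp add: vec_eq_iff map_matrix_cmult_nth)
    moreover have "(\<lambda>R \<epsilon>. \<Sum>k\<in>J. map_matrix ((*) (c k)) (e k R \<epsilon>)) \<in> supported_on F"
      using supported_onD[OF insert.prems]
      by (intro supported_onI sum.neutral ballI) (simp add: vec_eq_iff map_matrix_cmult_nth)
    moreover have "e k \<in> H" using insert.prems by (intro supported_on_H1[OF F]) auto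
    ultimately show ?case
      using insert supported_on_H1[OF F] by (simp add: add cmult)
  qed
  have l_fin: "l \<Phi> = ell D1 D2 B \<Phi>" if F: "finite F" "F \<subseteq> idx" and \<Phi>: "\<Phi> \<in> supported_on F" for F \<Phi>
  proof -
    let ?J = "F \<times> (UNIV :: ('d \<times> 'd) set)"
    let ?c = "\<lambda>k. \<Phi> (fst (fst k)) (snd (fst k)) $ fst (snd k) $ snd (snd k)"
    let ?e = "\<lambda>k. unit (fst (fst k)) (snd (fst k)) (fst (snd k)) (snd (snd k))"
    have "\<Phi> = (\<lambda>R \<epsilon>. \<Sum>k\<in>?J. map_matrix ((*) (?c k)) (?e k R \<epsilon>))"
    proof (intro ext, unfold vec_eq_iff, intro allI)
      fix R \<epsilon> r s
      have "(\<Sum>k\<in>?J. map_matrix ((*) (?c k)) (?e k R \<epsilon>)) $ r $ s = (\<Sum>k\<in>?J. ?c k * ?e k R \<epsilon> $ r $ s)"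
        by (simp add: map_matrix_cmult_nth)
      also have "\<dots> = (\<Sum>k\<in>?J. if k = ((R, \<epsilon>), (r, s)) then \<Phi> R \<epsilon> $ r $ s else 0)"
        by (intro sum.cong) (auto simp: unit_def)
      also have "\<dots> = \<Phi> R \<epsilon> $ r $ s"
        using F supported_onD[OF \<Phi>, of R \<epsilon>] by (subst sum.delta) auto
      finally show "\<Phi> R \<epsilon> $ r $ s = (\<Sum>k\<in>?J. map_matrix ((*) (?c k)) (?e k R \<epsilon>)) $ r $ s" by simp
    qed
    then have "l \<Phi> = l (\<lambda>R \<epsilon>. \<Sum>k\<in>?J. map_matrix ((*) (?c k)) (?e k R \<epsilon>))" by (rule arg_cong)
    also have "\<dots> = (\<Sum>k\<in>?J. ?c k * l (?e k))"
    proof (rule comb[OF F])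
      show "?e k \<in> supported_on F" if "k \<in> ?J" for k
        using that by (intro supported_onI) (auto simp: unit_def)
    qed (use F in auto)
    also have "\<dots> = (\<Sum>i\<in>F. \<Sum>j\<in>UNIV. ?c (i, j) * l (?e (i, j)))"
      by (subst sum.cartesian_product) (simp add: case_prod_unfold)
    also have "\<dots> = (\<Sum>(R, \<epsilon>)\<in>F. trace (conj_transpose (B R \<epsilon>) ** \<Phi> R \<epsilon>))"
    proof (rule sum.cong)
      fix i assume i: "i \<in> F"
      obtain R \<epsilon> where i': "i = (R, \<epsilon>)" by (cases i)
      have idx: "(R, \<epsilon>) \<in> idx" using i i' F by auto
      have "(\<Sum>j\<in>UNIV. ?c (i, j) * l (?e (i, j))) = (\<Sum>r\<in>UNIV. \<Sum>s\<in>UNIV. \<Phi> R \<epsilon> $ r $ s * l (unit R \<epsilon> r s))"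
        by (subst sum.cartesian_product) (simp add: i' case_prod_unfold)
      also have "\<dots> = trace (conj_transpose (B R \<epsilon>) ** \<Phi> R \<epsilon>)"
        using idx by (simp add: trace_adjoint_mult B_def mult.commute)
      finally show "(\<Sum>j\<in>UNIV. ?c (i, j) * l (?e (i, j))) = (case i of (R, \<epsilon>) \<Rightarrow> trace (conj_transpose (B R \<epsilon>) ** \<Phi> R \<epsilon>))"
        by (simp add: i')
    qed simp
    also have "\<dots> = ell D1 D2 B \<Phi>" by (rule ell_supported_on[OF F \<Phi>, symmetric])
    finally show ?thesis .
  qed
  have "bnorm B \<le> ennreal (Ct * C)"
  proof (rule bmo_norm_le_functional[OF C(1)])
    fix \<Phi> :: "('n, 'm, 'd) matrix_seq" and F
    assume F: "finite F" "F \<subseteq> idx" and "\<And>R \<epsilon>. (R, \<epsilon>) \<notin> F \<Longrightarrow> \<Phi> R \<epsilon> = 0"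
    then have \<Phi>: "\<Phi> \<in> supported_on F" by (intro supported_onI)
    show "ennreal (norm (\<Sum>(R, \<epsilon>)\<in>F. trace (conj_transpose (B R \<epsilon>) ** \<Phi> R \<epsilon>))) \<le> ennreal C * hnorm \<Phi>"
      using bspec[OF C(2) supported_on_H1[OF F \<Phi>]] l_fin[OF F \<Phi>] by (simp add: ell_supported_on[OF F \<Phi>])
  qed
  then have "bnorm B < top" by (rule le_less_trans) simp
  moreover have "B \<in> matrix_seqs D1 D2" by (simp add: matrix_seqs_def B_def)
  ultimately have B: "B \<in> BMO D1 D2 Ured Vred" by (simp add: BMO_def)
  obtain \<beta> where \<beta>: "bnorm B = ennreal \<beta>" "0 \<le> \<beta>" using BMO_finite[OF B] .
  define E where "E n = idx \<inter> from_nat_into idx ` {..n}" for n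
  have E: "\<And>n. finite (E n)" "\<And>n. E n \<subseteq> idx" "mono E" by (auto simp: E_def mono_def)
  have "(\<Union>n. E n) = idx"
  proof (intro equalityI subsetI)
    fix i assume i: "i \<in> idx"
    obtain n where "from_nat_into idx n = i" using from_nat_into_surj[OF idx_countable i] by blast
    then show "i \<in> (\<Union>n. E n)" using i by (auto simp: E_def intro!: exI[of _ n])
  qed (auto simp: E_def)
  note E = E this
  have "l \<Phi> = ell D1 D2 B \<Phi>" if \<Phi>: "\<Phi> \<in> H" for \<Phi>
  proof -
    let ?d = "l \<Phi> - ell D1 D2 B \<Phi>"
    let ?head = "\<lambda>n R \<epsilon>. if (R, \<epsilon>) \<in> E n then \<Phi> R \<epsilon> else 0"
    let ?tail = "\<lambda>n R \<epsilon>. if (R, \<epsilon>) \<in> E n then 0 else \<Phi> R \<epsilon>"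
    \<comment> \<open>Both functionals agree on the head, so the difference sees the tail alone,
      where each is bounded by its norm.\<close>
    have bound: "ennreal (norm ?d) \<le> ennreal (C + Cup * \<beta>) * hnorm (?tail n)" for n
    proof -
      have head_s: "?head n \<in> supported_on (E n)" by (intro supported_onI) simp
      have head: "?head n \<in> H" by (rule supported_on_H1[OF E(1,2) head_s])
      have "hnorm (?tail n) \<le> hnorm \<Phi>"
        unfolding H1_norm_sq
      proof (intro nn_integral_mono ennpow_mono infsum_ennreal_mono)
        show "sq (?tail n) i x \<le> sq \<Phi> i x" for i x by (simp add: sq_def)
      qed simp
      then have tail: "?tail n \<in> H" using \<Phi> by (auto simp: H1_def matrix_seqs_def intro: le_less_trans)
      have split: "(\<lambda>R \<epsilon>. ?head n R \<epsilon> + ?tail n R \<epsilon>) = \<Phi>" by (simp add: fun_eq_iff)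
      have "l \<Phi> = l (?head n) + l (?tail n)" using add[OF head tail] by (simp add: split)
      moreover have "ell D1 D2 B \<Phi> = ell D1 D2 B (?head n) + ell D1 D2 B (?tail n)"
        using functional_add[OF ell_functional[OF B] head tail] by (simp add: split)
      moreover have "l (?head n) = ell D1 D2 B (?head n)" by (rule l_fin[OF E(1,2) head_s])
      ultimately have "?d = l (?tail n) - ell D1 D2 B (?tail n)" by simp
      then have "norm ?d \<le> norm (l (?tail n)) + norm (ell D1 D2 B (?tail n))"
        by (simp add: norm_triangle_ineq4)
      then have "ennreal (norm ?d) \<le> ennreal (norm (l (?tail n)) + norm (ell D1 D2 B (?tail n)))"
        by (rule ennreal_leI)
      also have "\<dots> = ennreal (norm (l (?tail n))) + ennreal (norm (ell D1 D2 B (?tail n)))"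
        by (rule ennreal_plus) auto
      also have "\<dots> \<le> ennreal C * hnorm (?tail n) + ennreal (Cup * \<beta>) * hnorm (?tail n)"
        by (intro add_mono bspec[OF C(2)] ell_bound[OF \<beta>] tail)
      also have "\<dots> = ennreal (C + Cup * \<beta>) * hnorm (?tail n)"
        using C(1) Cup_pos \<beta> by (simp add: ennreal_plus distrib_right)
      finally show ?thesis .
    qed
    have "(\<lambda>n. ennreal (C + Cup * \<beta>) * hnorm (?tail n)) \<longlonglongrightarrow> ennreal (C + Cup * \<beta>) * 0"
      by (intro ennreal_tendsto_cmult tail_norm_tendsto[OF \<Phi> E]) simp
    then have "ennreal (norm ?d) \<le> ennreal (C + Cup * \<beta>) * 0"
      by (rule LIMSEQ_le_const) (use bound in blast)
    then show ?thesis by simp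
  qed
  with B show ?thesis by blast
qed

end

section \<open>Uniform constants and the final statement\<close>

lemma bloom_weightsI:
  assumes p: "1 < p" and D: "dyadic_grid D1" "dyadic_grid D2" and V: "Ap_weight p D1 D2 V"
    and red: "\<forall>R\<in>rects D1 D2. reducing_operator p U R (Ured R) \<and> reducing_operator p V R (Vred R)"
  shows "bloom_weights D1 D2 p (enn2real (Ap_char p D1 D2 V)) V Vred Ured"
proof
  have "Ap_char p D1 D2 V < top" "matrix_weight V" using V by (simp_all add: Ap_weight_def)
  then show "matrix_weight V" "Ap_char p D1 D2 V \<le> ennreal (enn2real (Ap_char p D1 D2 V))" by simp_all
  show "reducing_operator p V R (Vred R)" "pos_def (Ured R)" if "R \<in> rects D1 D2" for R
    using bspec[OF red that] by (simp_all add: reducing_operator_def)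
qed (use p D in simp_all)

theorem theorem2:
  fixes p :: real and K :: ennreal
  assumes "1 < p"
  shows "\<exists>c C :: real. 0 < c \<and> 0 < C \<and>
    (\<forall>(D1 :: (real^'n) set set) (D2 :: (real^'m) set set)
      (U :: (real^'n) \<times> (real^'m) \<Rightarrow> complex^'d^'d) (V :: (real^'n) \<times> (real^'m) \<Rightarrow> complex^'d^'d)
      (Ured :: ('n, 'm) rect \<Rightarrow> complex^'d^'d) (Vred :: ('n, 'm) rect \<Rightarrow> complex^'d^'d).
      dyadic_grid D1 \<and> dyadic_grid D2 \<and>
      Ap_weight p D1 D2 U \<and> Ap_weight p D1 D2 V \<and> Ap_char p D1 D2 V = K \<and>
      (\<forall>R\<in>rects D1 D2. reducing_operator p U R (Ured R) \<and> reducing_operator p V R (Vred R)) \<longrightarrow>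
      (\<forall>B\<in>BMO D1 D2 Ured Vred.
        (\<forall>\<Phi>\<in>H1 p D1 D2 Ured V.
          (\<lambda>(R, \<epsilon>). norm (trace (conj_transpose (B R \<epsilon>) ** \<Phi> R \<epsilon>)))
            summable_on (rects D1 D2 \<times> signatures)) \<and>
        H1_bounded_functional p D1 D2 Ured V (ell D1 D2 B) \<and>
        ennreal c * bmo_norm D1 D2 Ured Vred B
          \<le> H1_functional_norm p D1 D2 Ured V (ell D1 D2 B) \<and>
        H1_functional_norm p D1 D2 Ured V (ell D1 D2 B)
          \<le> ennreal C * bmo_norm D1 D2 Ured Vred B) \<and>
      (\<forall>l. H1_bounded_functional p D1 D2 Ured V l \<longrightarrow>
        (\<exists>B\<in>BMO D1 D2 Ured Vred. \<forall>\<Phi>\<in>H1 p D1 D2 Ured V. l \<Phi> = ell D1 D2 B \<Phi>)))"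
proof -
  define k where "k = enn2real K"
  \<comment> \<open>Seen from outside the locale the constants show their parameters:
    \<open>Ct\<close> depends on \<open>'d\<close>, \<open>p\<close> and \<open>k\<close>, and
    \<open>Cup\<close> on \<open>'d\<close> and \<open>p\<close>. They can therefore be fixed ahead
    of grids, weights and reducing operators.\<close>
  define cl cu where "cl = bloom_weights.Ct TYPE('d) p k" and "cu = bloom_weights.Cup TYPE('d) p"
  show ?thesis
  \<comment> \<open>Absolute values plus 1 make both witnesses positive without a sign for
    \<open>cl\<close> and \<open>cu\<close>, which is known inside the locale only. The reciprocal
    appears because \<open>Ct\<close> stands on the other side of the lower estimate.\<close>
  proof (rule exI[of _ "1 / (\<bar>cl\<bar> + 1)"], rule exI[of _ "\<bar>cu\<bar> + 1"], intro conjI allI impI, goal_cases)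
    case 1
    show ?case by (simp add: add_nonneg_pos)
  next
    case 2
    show ?case by simp
  next
    case (3 D1 D2 U V Ured Vred)
    then have hyp: "dyadic_grid D1" "dyadic_grid D2" "Ap_weight p D1 D2 V"
      "\<forall>R\<in>rects D1 D2. reducing_operator p U R (Ured R) \<and> reducing_operator p V R (Vred R)"
      "Ap_char p D1 D2 V = K"
      by - (elim conjE, assumption)+
    interpret bloom_weights D1 D2 p k V Vred Ured
      using bloom_weightsI[OF assms hyp(1-4)] by (simp only: hyp(5) k_def)
    show ?case
    proof (intro ballI conjI)
      fix B assume B: "B \<in> BMO D1 D2 Ured Vred"
      show "(\<lambda>(R, \<epsilon>). norm (trace (conj_transpose (B R \<epsilon>) ** \<Phi> R \<epsilon>))) summable_on (rects D1 D2 \<times> signatures)"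
        if "\<Phi> \<in> H1 p D1 D2 Ured V" for \<Phi>
        by (rule ell_summable(1)[OF B that])
      show "H1_bounded_functional p D1 D2 Ured V (ell D1 D2 B)" by (rule ell_functional[OF B])
      let ?N = "H1_functional_norm p D1 D2 Ured V (ell D1 D2 B)"
      have "ennreal (1 / (\<bar>cl\<bar> + 1)) * bmo_norm D1 D2 Ured Vred B \<le> ennreal (1 / (\<bar>cl\<bar> + 1)) * (ennreal (\<bar>cl\<bar> + 1) * ?N)"
        by (intro mult_left_mono order.trans[OF functional_norm_lower[OF B]] mult_right_mono ennreal_leI)
          (auto simp: cl_def)
      also have "\<dots> = ennreal (1 / (\<bar>cl\<bar> + 1) * (\<bar>cl\<bar> + 1)) * ?N"
        by (subst ennreal_mult) (auto simp: mult.assoc)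
      also have "1 / (\<bar>cl\<bar> + 1) * (\<bar>cl\<bar> + 1) = 1" by (simp add: add_nonneg_eq_0_iff)
      finally show "ennreal (1 / (\<bar>cl\<bar> + 1)) * bmo_norm D1 D2 Ured Vred B \<le> ?N" by simp
      show "?N \<le> ennreal (\<bar>cu\<bar> + 1) * bmo_norm D1 D2 Ured Vred B"
        by (intro order.trans[OF functional_norm_upper[OF B]] mult_right_mono ennreal_leI)
          (auto simp: cu_def)
    qed
  next
    case (4 D1 D2 U V Ured Vred l)
    then have hyp: "dyadic_grid D1" "dyadic_grid D2" "Ap_weight p D1 D2 V"
      "\<forall>R\<in>rects D1 D2. reducing_operator p U R (Ured R) \<and> reducing_operator p V R (Vred R)"
      "Ap_char p D1 D2 V = K" "H1_bounded_functional p D1 D2 Ured V l"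
      by - (elim conjE, assumption)+
    interpret bloom_weights D1 D2 p k V Vred Ured
      using bloom_weightsI[OF assms hyp(1-4)] by (simp only: hyp(5) k_def)
    show ?case by (rule functional_representation[OF hyp(6)])
  qed
qed

end
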